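(* (1) Let $p$ be an arbitrary, fixed prime. Then the Quillen categories $\mathscr{A}_p(H)$ of almost all (i.e. all but finitely many) main line groups $H$ associated with $G_p$ are pairwise equivalent. (2) The Quillen categories $\mathscr{A}_3(H)$ of almost all (i.e. all but finitely many, up to isomorphism) skeleton groups $H$ associated with $G_9$ are pairwise equivalent.
   Context: Quillen category: for a finite group $H$ and a prime $p$, $\mathscr{A}_p(H)$ is the category whose objects are the elementary abelian $p$-subgroups of $H$ (including the trivial one) and whose morphisms $E\to E'$ are the injective group homomorphisms of the form $x\mapsto hxh^{-1}$ with $h\in H$ and $hEh^{-1}\le E'$. The groups $G_q$: let $q=p^{\ell}$ ($\ell\ge 1$), let $\theta$ be a primitive $q$-th root of unity over $\mathbb{Q}_p$ and let $\mathbb{Z}_p[\theta]\cong\mathbb{Z}_p^{(p-1)p^{\ell-1}}$. Then $G_q=\mathbb{Z}_p[\theta]\rtimes C_q$, where a generator of the cyclic group $C_q$ acts as multiplication by $\theta$ (the irreducible action, unique up to equivalence). $G_q$ is an infinite pro-$p$-group of coclass $\ell$. Coclass and main line groups: the coclass of a group of order $p^n$ and nilpotency class $c$ is $n-c$. For an infinite pro-$p$-group $G$ of coclass $r$, the main line groups associated with $G$ are the (infinitely many) lower central series quotients $G/\gamma_i(G)$ that have coclass $r$. Skeleton groups associated with $G_9$: let $K=\mathbb{Q}_3(\theta)$ with $\theta$ a root of $X^6+X^3+1$, $\mathcal{O}=\mathbb{Z}_3[\theta]$, $\mathfrak{p}=(\theta-1)\mathcal{O}$ its maximal ideal. For $s$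 prime to $3$ let $\sigma_s\in\operatorname{Gal}(K/\mathbb{Q}_3)$ be given by $\sigma_s(\theta)=\theta^s$. Let $\gamma_0\colon \mathfrak{p}\wedge\mathfrak{p}\to\mathcal{O}$, $\gamma_0(x\wedge y)=\sigma_2(x)\sigma_{-1}(y)-\sigma_{-1}(x)\sigma_2(y)$. For an integer $j\ge 7$ put $T=\mathfrak{p}^{j-3}$ and $T_i=\mathfrak{p}^{j-3+i}$; let $k=2j$ if $3\mid j$ and $k=2j-1$ otherwise. For a unit $c\in\mathcal{O}^\times$ put $\gamma=c\gamma_0$. For $m\in\{j,j+1,\dots,k\}$ let $T_{j-3,\gamma,m}$ be the group with underlying set $T/T_m$ and product $(x+T_m)*(y+T_m)=\bigl(x+y+\tfrac12\gamma(x\wedge y)\bigr)+T_m$. The skeleton groups are $R_{j-3,\gamma,m}=T_{j-3,\gamma,m}\rtimes C$, where $C=\langle\tau\rangle$ is cyclic of order $9$ and ${}^{\tau}v=\theta v$ for $v \in T$. *)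

theory Defs
  imports "HOL-Algebra.Algebra"
begin

section \<open>Categories and equivalences of categories\<close>

text \<open>Arrows are indexed by source and target; different hom-sets need not be disjoint.
  \<open>compo C U V W g f\<close> is the composite of \<open>f\<close> from \<open>U\<close> to \<open>V\<close> and \<open>g\<close> from \<open>V\<close> to \<open>W\<close>.\<close>

record ('o, 'm) cat =
  obj :: "'o set"
  arr :: "'o \<Rightarrow> 'o \<Rightarrow> 'm set"
  ident :: "'o \<Rightarrow> 'm"
  compo :: "'o \<Rightarrow> 'o \<Rightarrow> 'o \<Rightarrow> 'm \<Rightarrow> 'm \<Rightarrow> 'm"

definition category :: "('o, 'm) cat \<Rightarrow> bool" where
  "category C \<longleftrightarrow>
     (\<forall>U\<in>obj C. ident C U \<in> arr C U U) \<and>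
     (\<forall>U\<in>obj C. \<forall>V\<in>obj C. \<forall>W\<in>obj C. \<forall>f\<in>arr C U V. \<forall>g\<in>arr C V W. compo C U V W g f \<in> arr C U W) \<and>
     (\<forall>U\<in>obj C. \<forall>V\<in>obj C. \<forall>f\<in>arr C U V.
        compo C U U V f (ident C U) = f \<and> compo C U V V (ident C V) f = f) \<and>
     (\<forall>S\<in>obj C. \<forall>U\<in>obj C. \<forall>V\<in>obj C. \<forall>W\<in>obj C. \<forall>f\<in>arr C S U. \<forall>g\<in>arr C U V. \<forall>h\<in>arr C V W.
        compo C S V W h (compo C S U V g f) = compo C S U W (compo C U V W h g) f)"

definition iso_arrow :: "('o, 'm) cat \<Rightarrow> 'o \<Rightarrow> 'o \<Rightarrow> 'm \<Rightarrow> bool" where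
  "iso_arrow C U V f \<longleftrightarrow> f \<in> arr C U V \<and>
     (\<exists>g\<in>arr C V U. compo C U V U g f = ident C U \<and> compo C V U V f g = ident C V)"

definition is_functor ::
  "('o, 'm) cat \<Rightarrow> ('q, 'n) cat \<Rightarrow> ('o \<Rightarrow> 'q) \<Rightarrow> ('o \<Rightarrow> 'o \<Rightarrow> 'm \<Rightarrow> 'n) \<Rightarrow> bool" where
  "is_functor C D Fo Fm \<longleftrightarrow>
     (\<forall>U\<in>obj C. Fo U \<in> obj D) \<and>
     (\<forall>U\<in>obj C. \<forall>V\<in>obj C. \<forall>f\<in>arr C U V. Fm U V f \<in> arr D (Fo U) (Fo V)) \<and>
     (\<forall>U\<in>obj C. Fm U U (ident C U) = ident D (Fo U)) \<and>
     (\<forall>U\<in>obj C. \<forall>V\<in>obj C. \<forall>W\<in>obj C. \<forall>f\<in>arr C U V. \<forall>g\<in>arr C V W.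
        Fm U W (compo C U V W g f) = compo D (Fo U) (Fo V) (Fo W) (Fm V W g) (Fm U V f))"

definition natural_iso ::
  "('o, 'm) cat \<Rightarrow> ('q, 'n) cat \<Rightarrow> ('o \<Rightarrow> 'q) \<Rightarrow> ('o \<Rightarrow> 'o \<Rightarrow> 'm \<Rightarrow> 'n) \<Rightarrow>
   ('o \<Rightarrow> 'q) \<Rightarrow> ('o \<Rightarrow> 'o \<Rightarrow> 'm \<Rightarrow> 'n) \<Rightarrow> ('o \<Rightarrow> 'n) \<Rightarrow> bool" where
  "natural_iso C D Fo Fm Go Gm \<eta> \<longleftrightarrow>
     (\<forall>U\<in>obj C. iso_arrow D (Fo U) (Go U) (\<eta> U)) \<and>
     (\<forall>U\<in>obj C. \<forall>V\<in>obj C. \<forall>f\<in>arr C U V.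
        compo D (Fo U) (Fo V) (Go V) (\<eta> V) (Fm U V f) =
        compo D (Fo U) (Go U) (Go V) (Gm U V f) (\<eta> U))"

definition equivalent_categories :: "('o, 'm) cat \<Rightarrow> ('q, 'n) cat \<Rightarrow> bool" where
  "equivalent_categories C D \<longleftrightarrow> category C \<and> category D \<and>
     (\<exists>Fo Fm Go Gm \<eta> \<epsilon>. is_functor C D Fo Fm \<and> is_functor D C Go Gm \<and>
        natural_iso C C (\<lambda>U. U) (\<lambda>U V f. f) (\<lambda>U. Go (Fo U)) (\<lambda>U V f. Gm (Fo U) (Fo V) (Fm U V f)) \<eta> \<and>
        natural_iso D D (\<lambda>U. Fo (Go U)) (\<lambda>U V f. Fm (Go U) (Go V) (Gm U V f)) (\<lambda>U. U) (\<lambda>U V f. f) \<epsilon>)"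


section \<open>The Quillen category\<close>

definition elementary_abelian_subgroup :: "nat \<Rightarrow> ('a, 'b) monoid_scheme \<Rightarrow> 'a set \<Rightarrow> bool" where
  "elementary_abelian_subgroup p H E \<longleftrightarrow> subgroup E H \<and>
     (\<forall>x\<in>E. \<forall>y\<in>E. x \<otimes>\<^bsub>H\<^esub> y = y \<otimes>\<^bsub>H\<^esub> x) \<and> (\<forall>x\<in>E. x [^]\<^bsub>H\<^esub> p = \<one>\<^bsub>H\<^esub>)"

text \<open>A morphism from \<open>E\<close> to \<open>E'\<close> is a function with domain \<open>E\<close>, represented by its extension
  with the value \<^const>\<open>undefined\<close> outside \<open>E\<close>; two elements of \<open>H\<close> inducing the same map on
  \<open>E\<close> give the same morphism.\<close>

definition quillen_category :: "nat \<Rightarrow> ('a, 'b) monoid_scheme \<Rightarrow> ('a set, 'a \<Rightarrow> 'a) cat" where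
  "quillen_category p H =
     \<lparr>obj = {E. elementary_abelian_subgroup p H E},
      arr = (\<lambda>E E'. {f. f \<in> mon (H\<lparr>carrier := E\<rparr>) (H\<lparr>carrier := E'\<rparr>) \<and>
        (\<exists>h\<in>carrier H. f = (\<lambda>x\<in>E. h \<otimes>\<^bsub>H\<^esub> x \<otimes>\<^bsub>H\<^esub> inv\<^bsub>H\<^esub> h))}),
      ident = (\<lambda>E. (\<lambda>x\<in>E. x)),
      compo = (\<lambda>E E' E'' g f. compose E g f)\<rparr>"

lemma quillen_category_category:
  assumes "group H"
  shows "category (quillen_category p H)"
proof -
  interpret group H by fact
  have sub: "x \<in> carrier H" if "elementary_abelian_subgroup p H E" "x \<in> E" for E x
    using that by (auto simp: elementary_abelian_subgroup_def dest: subgroup.mem_carrier)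
  have ident: "(\<lambda>x\<in>E. x) \<in> arr (quillen_category p H) E E"
    if E: "elementary_abelian_subgroup p H E" for E
  proof -
    have "(\<lambda>x\<in>E. x) = (\<lambda>x\<in>E. \<one>\<^bsub>H\<^esub> \<otimes>\<^bsub>H\<^esub> x \<otimes>\<^bsub>H\<^esub> inv\<^bsub>H\<^esub> \<one>\<^bsub>H\<^esub>)"
      using sub[OF E] by (auto intro!: restrict_ext)
    moreover have "(\<lambda>x\<in>E. x) \<in> mon (H\<lparr>carrier := E\<rparr>) (H\<lparr>carrier := E\<rparr>)"
      using E by (auto simp: mon_def hom_def inj_on_def elementary_abelian_subgroup_def
          intro: subgroup.m_closed)
    ultimately show ?thesis
      by (auto simp: quillen_category_def intro!: bexI[of _ "\<one>\<^bsub>H\<^esub>"])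
  qed
  have comp: "compose E g f \<in> arr (quillen_category p H) E E''"
    if E: "elementary_abelian_subgroup p H E"
      and E': "elementary_abelian_subgroup p H E'"
      and f: "f \<in> arr (quillen_category p H) E E'"
      and g: "g \<in> arr (quillen_category p H) E' E''" for E E' E'' f g
  proof -
    obtain h where h: "h \<in> carrier H" "f = (\<lambda>x\<in>E. h \<otimes>\<^bsub>H\<^esub> x \<otimes>\<^bsub>H\<^esub> inv\<^bsub>H\<^esub> h)"
      using f by (auto simp: quillen_category_def)
    obtain k where k: "k \<in> carrier H" "g = (\<lambda>x\<in>E'. k \<otimes>\<^bsub>H\<^esub> x \<otimes>\<^bsub>H\<^esub> inv\<^bsub>H\<^esub> k)"
      using g by (auto simp: quillen_category_def)
    have fm: "f \<in> mon (H\<lparr>carrier := E\<rparr>) (H\<lparr>carrier := E'\<rparr>)"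
      and gm: "g \<in> mon (H\<lparr>carrier := E'\<rparr>) (H\<lparr>carrier := E''\<rparr>)"
      using f g by (auto simp: quillen_category_def)
    have fE: "f x \<in> E'" if "x \<in> E" for x
      using fm that by (auto simp: mon_def hom_def)
    have m: "x \<otimes>\<^bsub>H\<^esub> y \<in> E" if "x \<in> E" "y \<in> E" for x y
      using E that by (auto simp: elementary_abelian_subgroup_def intro: subgroup.m_closed)
    have "compose E g f = (\<lambda>x\<in>E. (k \<otimes>\<^bsub>H\<^esub> h) \<otimes>\<^bsub>H\<^esub> x \<otimes>\<^bsub>H\<^esub> inv\<^bsub>H\<^esub> (k \<otimes>\<^bsub>H\<^esub> h))"
      unfolding compose_def
    proof (rule restrict_ext)
      fix x assume x: "x \<in> E"
      have "g (f x) = k \<otimes>\<^bsub>H\<^esub> (h \<otimes>\<^bsub>H\<^esub> x \<otimes>\<^bsub>H\<^esub> inv\<^bsub>H\<^esub> h) \<otimes>\<^bsub>H\<^esub> inv\<^bsub>H\<^esub> k"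
        using fE[OF x] x by (simp add: k(2) h(2))
      then show "g (f x) = (k \<otimes>\<^bsub>H\<^esub> h) \<otimes>\<^bsub>H\<^esub> x \<otimes>\<^bsub>H\<^esub> inv\<^bsub>H\<^esub> (k \<otimes>\<^bsub>H\<^esub> h)"
        using h(1) k(1) sub[OF E x] by (simp add: inv_mult_group m_assoc)
    qed
    moreover have "compose E g f \<in> mon (H\<lparr>carrier := E\<rparr>) (H\<lparr>carrier := E''\<rparr>)"
      using fm gm fE m by (auto simp: mon_def hom_def inj_on_def compose_def Pi_iff)
    moreover have "k \<otimes>\<^bsub>H\<^esub> h \<in> carrier H" using h(1) k(1) by simp
    ultimately show ?thesis
      by (simp add: quillen_category_def) blast
  qed
  have ext: "f \<in> extensional E" "f \<in> E \<rightarrow> E'"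
    if "f \<in> arr (quillen_category p H) E E'" for E E' f
    using that by (auto simp: quillen_category_def mon_def hom_def)
  have obj: "obj (quillen_category p H) = {E. elementary_abelian_subgroup p H E}"
    and id: "ident (quillen_category p H) E = (\<lambda>x\<in>E. x)"
    and cm: "compo (quillen_category p H) E E' E'' g f = compose E g f" for E E' E'' g f
    by (simp_all add: quillen_category_def)
  have unit: "compose E f (\<lambda>x\<in>E. x) = f" "compose E (\<lambda>x\<in>E'. x) f = f"
    if f: "f \<in> arr (quillen_category p H) E E'" for E E' f
    using compose_Id[OF ext(2,1)[OF f]] Id_compose[OF ext(2,1)[OF f]] by simp_all
  have assoc: "compose D h (compose D g f) = compose D (compose E h g) f"
    if f: "f \<in> arr (quillen_category p H) D E" for D E f g h
    using compose_assoc[OF ext(2)[OF f]] .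
  show ?thesis
    unfolding category_def obj id cm using ident comp unit assoc by (simp; blast)
qed


section \<open>Coclass and main line groups\<close>

text \<open>\<open>lower_central G n\<close> is the term \<open>\<gamma>\<^bsub>n+1\<^esub>(G)\<close> of the lower central series. For the
  groups considered here these abstract subgroups are already closed in the pro-\<open>p\<close> topology.\<close>

fun lower_central :: "('a, 'b) monoid_scheme \<Rightarrow> nat \<Rightarrow> 'a set" where
  "lower_central G 0 = carrier G"
| "lower_central G (Suc n) = generate G
     {x \<otimes>\<^bsub>G\<^esub> y \<otimes>\<^bsub>G\<^esub> inv\<^bsub>G\<^esub> x \<otimes>\<^bsub>G\<^esub> inv\<^bsub>G\<^esub> y | x y. x \<in> lower_central G n \<and> y \<in> carrier G}"

definition has_nilpotency_class :: "('a, 'b) monoid_scheme \<Rightarrow> nat \<Rightarrow> bool" where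
  "has_nilpotency_class G c \<longleftrightarrow>
     lower_central G c = {\<one>\<^bsub>G\<^esub>} \<and> (\<forall>d<c. lower_central G d \<noteq> {\<one>\<^bsub>G\<^esub>})"

definition has_coclass :: "nat \<Rightarrow> ('a, 'b) monoid_scheme \<Rightarrow> nat \<Rightarrow> bool" where
  "has_coclass p H r \<longleftrightarrow> (\<exists>n c. order H = p ^ n \<and> has_nilpotency_class H c \<and> n = c + r)"

definition main_line_groups :: "nat \<Rightarrow> ('a, 'b) monoid_scheme \<Rightarrow> nat \<Rightarrow> 'a set monoid set" where
  "main_line_groups p G r =
     {G Mod lower_central G n | n. has_coclass p (G Mod lower_central G n) r}"


section \<open>The rings of integers \<open>\<int>\<^sub>p[\<theta>]\<close>\<close>

text \<open>\<open>\<int>\<^sub>p\<close> is the inverse limit of the rings \<open>\<int>/p\<^sup>n\<close>.\<close>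

definition padic_integers :: "nat \<Rightarrow> (nat \<Rightarrow> int) ring" where
  "padic_integers p =
     \<lparr>carrier = {x. \<forall>n. x n \<in> {0..<int p ^ n} \<and> x (Suc n) mod int p ^ n = x n},
      monoid.mult = (\<lambda>x y n. (x n * y n) mod int p ^ n),
      one = (\<lambda>n. 1 mod int p ^ n),
      ring.zero = (\<lambda>n. 0),
      add = (\<lambda>x y n. (x n + y n) mod int p ^ n)\<rparr>"

lemma padic_integers_cring:
  assumes "p > 0"
  shows "cring (padic_integers p)"
proof (intro cringI abelian_groupI comm_monoidI)
  have pos: "int p ^ n > 0" for n using assms by simp
  have red: "z mod (int p ^ n * int p) mod int p ^ n = z mod int p ^ n"
    "z mod (int p * int p ^ n) mod int p ^ n = z mod int p ^ n" for z n
    by (rule mod_mod_cancel; simp)+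
  note defs = padic_integers_def
  have coh: "x (Suc n) mod int p ^ n = x n" if "x \<in> carrier (padic_integers p)" for x n
    using that by (simp add: defs)
  fix x y z
  assume x: "x \<in> carrier (padic_integers p)"
  show "\<zero>\<^bsub>padic_integers p\<^esub> \<oplus>\<^bsub>padic_integers p\<^esub> x = x"
    using x by (auto simp: defs)
  show "\<one>\<^bsub>padic_integers p\<^esub> \<otimes>\<^bsub>padic_integers p\<^esub> x = x"
    using x by (auto simp: defs mod_simps)
  have "(\<lambda>n. (- x n) mod int p ^ n) \<in> carrier (padic_integers p)"
  proof -
    have "(- x (Suc n)) mod int p ^ n = (- x n) mod int p ^ n" for n
      using coh[OF x, of n] by (metis mod_minus_eq)
    then show ?thesis using pos by (simp add: defs red del: power_Suc)
  qed
  moreover have "(\<lambda>n. (- x n) mod int p ^ n) \<oplus>\<^bsub>padic_integers p\<^esub> x = \<zero>\<^bsub>padic_integers p\<^esub>"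
    by (simp add: defs mod_simps)
  ultimately show "\<exists>y\<in>carrier (padic_integers p). y \<oplus>\<^bsub>padic_integers p\<^esub> x = \<zero>\<^bsub>padic_integers p\<^esub>"
    by blast
  assume y: "y \<in> carrier (padic_integers p)"
  have "(x (Suc n) + y (Suc n)) mod int p ^ n = (x n + y n) mod int p ^ n" for n
    using coh[OF x, of n] coh[OF y, of n] by (metis mod_add_eq)
  then show "x \<oplus>\<^bsub>padic_integers p\<^esub> y \<in> carrier (padic_integers p)"
    using pos by (simp add: defs red del: power_Suc)
  have "(x (Suc n) * y (Suc n)) mod int p ^ n = (x n * y n) mod int p ^ n" for n
    using coh[OF x, of n] coh[OF y, of n] by (metis mod_mult_eq)
  then show "x \<otimes>\<^bsub>padic_integers p\<^esub> y \<in> carrier (padic_integers p)"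
    using pos by (simp add: defs red del: power_Suc)
qed (use assms in \<open>auto simp: padic_integers_def mod_simps algebra_simps mod_mod_cancel\<close>)

text \<open>The \<open>q\<close>-th cyclotomic polynomial for \<open>q = p\<^sup>l\<close>, \<open>l \<ge> 1\<close>. It is irreducible over \<open>\<rat>\<^sub>p\<close>, so
  that \<open>\<int>\<^sub>p[\<theta>]\<close> is obtained from \<open>\<int>\<^sub>p\<close> by adjoining a root of it.\<close>

definition cyclotomic_pol :: "nat \<Rightarrow> nat \<Rightarrow> nat \<Rightarrow> nat \<Rightarrow> int" where
  "cyclotomic_pol p l = (let P = UP (padic_integers p) in
     \<Oplus>\<^bsub>P\<^esub>i\<in>{..<p}. monom P \<one>\<^bsub>padic_integers p\<^esub> (i * p ^ (l - 1)))"

definition cyc_integers :: "nat \<Rightarrow> nat \<Rightarrow> (nat \<Rightarrow> nat \<Rightarrow> int) set ring" where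
  "cyc_integers p l = (let P = UP (padic_integers p) in P Quot (PIdl\<^bsub>P\<^esub> (cyclotomic_pol p l)))"

definition pol_class :: "nat \<Rightarrow> nat \<Rightarrow> (nat \<Rightarrow> nat \<Rightarrow> int) \<Rightarrow> (nat \<Rightarrow> nat \<Rightarrow> int) set" where
  "pol_class p l f = (let P = UP (padic_integers p) in (PIdl\<^bsub>P\<^esub> (cyclotomic_pol p l)) +>\<^bsub>P\<^esub> f)"

definition scalar :: "nat \<Rightarrow> nat \<Rightarrow> (nat \<Rightarrow> int) \<Rightarrow> (nat \<Rightarrow> nat \<Rightarrow> int) set" where
  "scalar p l a = pol_class p l (monom (UP (padic_integers p)) a 0)"

definition theta :: "nat \<Rightarrow> nat \<Rightarrow> (nat \<Rightarrow> nat \<Rightarrow> int) set" where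
  "theta p l = pol_class p l (monom (UP (padic_integers p)) \<one>\<^bsub>padic_integers p\<^esub> 1)"


section \<open>The pro-\<open>p\<close>-groups \<open>G\<^sub>q\<close>\<close>

definition semidirect ::
  "('a, 'm) monoid_scheme \<Rightarrow> ('c, 'n) monoid_scheme \<Rightarrow> ('c \<Rightarrow> 'a \<Rightarrow> 'a) \<Rightarrow> ('a \<times> 'c) monoid" where
  "semidirect N C \<phi> =
     \<lparr>carrier = carrier N \<times> carrier C,
      monoid.mult = (\<lambda>(x, c) (y, d). (x \<otimes>\<^bsub>N\<^esub> \<phi> c y, c \<otimes>\<^bsub>C\<^esub> d)),
      one = (\<one>\<^bsub>N\<^esub>, \<one>\<^bsub>C\<^esub>)\<rparr>"

text \<open>\<open>G_group p l\<close> is \<open>G\<^sub>q\<close> for \<open>q = p\<^sup>l\<close>; its coclass is \<open>l\<close>. The cyclic group is written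
  additively, with generator 1.\<close>

definition G_group :: "nat \<Rightarrow> nat \<Rightarrow> ((nat \<Rightarrow> nat \<Rightarrow> int) set \<times> int) monoid" where
  "G_group p l = (let R = cyc_integers p l in
     semidirect (add_monoid R) (integer_mod_group (p ^ l)) (\<lambda>i x. theta p l [^]\<^bsub>R\<^esub> i \<otimes>\<^bsub>R\<^esub> x))"


section \<open>Skeleton groups associated with \<open>G\<^sub>9\<close>\<close>

type_synonym cyc9 = "(nat \<Rightarrow> nat \<Rightarrow> int) set"

abbreviation O9 :: "cyc9 ring" where "O9 \<equiv> cyc_integers 3 2"
abbreviation \<theta>9 :: cyc9 where "\<theta>9 \<equiv> theta 3 2"

text \<open>The automorphism \<open>\<sigma>\<^sub>s\<close>, restricted to the ring of integers (which it preserves).\<close>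

definition sigma9 :: "int \<Rightarrow> cyc9 \<Rightarrow> cyc9" where
  "sigma9 s = (THE h. h \<in> extensional (carrier O9) \<and> h \<in> ring_iso O9 O9 \<and>
     (\<forall>a\<in>carrier (padic_integers 3). h (scalar 3 2 a) = scalar 3 2 a) \<and>
     h \<theta>9 = \<theta>9 [^]\<^bsub>O9\<^esub> s)"

definition ideal9 :: "nat \<Rightarrow> cyc9 set" where
  "ideal9 i = PIdl\<^bsub>O9\<^esub> ((\<theta>9 \<ominus>\<^bsub>O9\<^esub> \<one>\<^bsub>O9\<^esub>) [^]\<^bsub>O9\<^esub> i)"

text \<open>\<open>\<gamma>\<^sub>0\<close> as an alternating bilinear map.\<close>

definition gamma0 :: "cyc9 \<Rightarrow> cyc9 \<Rightarrow> cyc9" where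
  "gamma0 x y =
     (sigma9 2 x \<otimes>\<^bsub>O9\<^esub> sigma9 (-1) y) \<ominus>\<^bsub>O9\<^esub> (sigma9 (-1) x \<otimes>\<^bsub>O9\<^esub> sigma9 2 y)"

definition half9 :: cyc9 where
  "half9 = inv\<^bsub>O9\<^esub> (\<one>\<^bsub>O9\<^esub> \<oplus>\<^bsub>O9\<^esub> \<one>\<^bsub>O9\<^esub>)"

definition coset9 :: "nat \<Rightarrow> nat \<Rightarrow> cyc9 \<Rightarrow> cyc9 set" where
  "coset9 j m x = ideal9 (j - 3 + m) +>\<^bsub>O9\<^esub> x"

text \<open>The group \<open>T\<^bsub>j-3,\<gamma>,m\<^esub>\<close> with \<open>\<gamma> = c\<gamma>\<^sub>0\<close>. Operations on cosets are given, as for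
  \<^const>\<open>FactRing\<close>, as unions over all representatives of the (equal) resulting cosets.\<close>

definition T_group :: "nat \<Rightarrow> cyc9 \<Rightarrow> nat \<Rightarrow> cyc9 set monoid" where
  "T_group j c m =
     \<lparr>carrier = coset9 j m ` ideal9 (j - 3),
      monoid.mult = (\<lambda>A B. \<Union>x\<in>A. \<Union>y\<in>B.
        coset9 j m (x \<oplus>\<^bsub>O9\<^esub> y \<oplus>\<^bsub>O9\<^esub> half9 \<otimes>\<^bsub>O9\<^esub> (c \<otimes>\<^bsub>O9\<^esub> gamma0 x y))),
      one = coset9 j m \<zero>\<^bsub>O9\<^esub>\<rparr>"

definition skeleton_group :: "nat \<Rightarrow> cyc9 \<Rightarrow> nat \<Rightarrow> (cyc9 set \<times> int) monoid" where
  "skeleton_group j c m = semidirect (T_group j c m) (integer_mod_group 9)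
     (\<lambda>i A. \<Union>x\<in>A. coset9 j m (\<theta>9 [^]\<^bsub>O9\<^esub> i \<otimes>\<^bsub>O9\<^esub> x))"

definition skeleton_groups :: "(cyc9 set \<times> int) monoid set" where
  "skeleton_groups = {skeleton_group j c m | j c m.
     7 \<le> j \<and> c \<in> Units O9 \<and> j \<le> m \<and> m \<le> (if 3 dvd j then 2 * j else 2 * j - 1)}"

end

(* Let T be the translation lattice, with its filtration T_i by the powers of the maximal ideal
   of Z_p[theta], and let H = (T/T_m) x| C be one of the groups in question. For large m the
   elements of order p (or 1) of T/T_m form T_{m-e}/T_m, which is isomorphic to Z_p[theta]/(p)
   as a C-module and centralised by T/T_m. An elementary abelian subgroup that is not contained
   in it is generated by its intersection with T/T_m and one element (t, tau^w) with tau^w of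
   order p; all such elements have order p, and (t, tau^w), (t', tau^w) are conjugate under T/T_m
   if and only if t and t' agree modulo T_w. So the elements of both kinds carry labels in
   Z_p[theta]/(p) and in T/T_w = Z_p[theta]/(theta - 1)^w, and a monomorphism between elementary
   abelian subgroups is induced by conjugation if and only if it multiplies all labels by a common
   power of theta. None of this depends on m, on the starting term of the lattice, or on the
   commutator form gamma; hence the Quillen categories are equivalent. *)

theory Submission
  imports Defs "HOL-Computational_Algebra.Polynomial"
begin

section \<open>Equivalence of Quillen categories\<close>

text \<open>The calculations take place in the integer polynomials, read at theta, since modulo any
  power of theta - 1 every element of Z_p[theta] has such a representative. The cyclotomic
  polynomial is then not zero but lies in every term of the filtration, so relations between powers
  of theta hold up to arbitrarily deep terms. A label is defined only up to a congruence; hence it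
  is a relation and not a function. The delicate point is conjugacy over tau^w in the presence of
  gamma. The equation for the conjugating translation u is a perturbation of (1 - theta^w) u = t' -
  t, and successive approximation solves it because gamma raises the level by more than w. "Large"
  means m >= e + w, where e is the valuation of p. This bound is p for G_p, and 9 for G_9, where it
  follows from j >= 9. The bound k on m makes nested values of gamma vanish, so that the product is
  associative. For each of the finitely many (j, m) with j < 9 there are infinitely many units c,
  yet c counts only modulo (theta - 1)^(j-3+m), which leaves finitely many groups up to
  isomorphism.\<close>

abbreviation (input) "quillen \<equiv> quillen_category"
abbreviation (input) "elem_ab \<equiv> elementary_abelian_subgroup"

definition transport :: "'b set \<Rightarrow> ('a \<Rightarrow> 'b) \<Rightarrow> 'a set \<Rightarrow> ('c \<Rightarrow> 'd) \<Rightarrow> ('a \<Rightarrow> 'c) \<Rightarrow> 'b \<Rightarrow> 'd" where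
  "transport E' phi E psi f = (\<lambda>y\<in>E'. psi (f (inv_into E phi y)))"

lemma quillen_obj: "E \<in> obj (quillen p H) \<longleftrightarrow> elem_ab p H E"
  by (simp add: quillen_category_def)

lemma quillen_arrD:
  assumes "f \<in> arr (quillen p H) E D"
  shows "f \<in> extensional E" "x \<in> E \<Longrightarrow> f x \<in> D" "inj_on f E"
  using assms by (auto simp: quillen_category_def mon_def hom_def)

lemma quillen_ident: "ident (quillen p H) E = (\<lambda>x\<in>E. x)"
  by (simp add: quillen_category_def)

lemma quillen_compo: "compo (quillen p H) E D C g f = compose E g f"
  by (simp add: quillen_category_def)

text \<open>Identities and composites are preserved because the inverse of \<open>phi D\<close>
  cancels \<open>phi D\<close> in the middle. What remains as a hypothesis is that a transported
  arrow is again induced by conjugation.\<close>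

lemma is_functor_transport:
  assumes obj: "\<And>E. E \<in> obj (quillen p H) \<Longrightarrow> F E \<in> obj (quillen p K)"
    and bij: "\<And>E. E \<in> obj (quillen p H) \<Longrightarrow> bij_betw (phi E) E (F E)"
    and arr: "\<And>E D f. E \<in> obj (quillen p H) \<Longrightarrow> D \<in> obj (quillen p H) \<Longrightarrow>
      f \<in> arr (quillen p H) E D \<Longrightarrow>
      transport (F E) (phi E) E (phi D) f \<in> arr (quillen p K) (F E) (F D)"
  shows "is_functor (quillen p H) (quillen p K) F
    (\<lambda>E D f. transport (F E) (phi E) E (phi D) f)"
  unfolding is_functor_def
proof (intro conjI ballI)
  fix E assume E: "E \<in> obj (quillen p H)"
  show "F E \<in> obj (quillen p K)" by (rule obj[OF E])
  show "transport (F E) (phi E) E (phi E) (ident (quillen p H) E) =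
      ident (quillen p K) (F E)"
    using bij[OF E] unfolding transport_def quillen_ident
    by (intro restrict_ext) (auto simp: bij_betw_def f_inv_into_f inv_into_into)
  fix D assume D: "D \<in> obj (quillen p H)"
  {
    fix f assume f: "f \<in> arr (quillen p H) E D"
    show "transport (F E) (phi E) E (phi D) f \<in> arr (quillen p K) (F E) (F D)"
      by (rule arr[OF E D f])
  }
  fix C f g assume C: "C \<in> obj (quillen p H)"
    and f: "f \<in> arr (quillen p H) E D" and g: "g \<in> arr (quillen p H) D C"
  show "transport (F E) (phi E) E (phi C) (compo (quillen p H) E D C g f) =
      compo (quillen p K) (F E) (F D) (F C)
        (transport (F D) (phi D) D (phi C) g) (transport (F E) (phi E) E (phi D) f)"
    unfolding transport_def quillen_compo compose_def
  proof (rule restrict_ext)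
    fix y assume y: "y \<in> F E"
    have x: "inv_into E (phi E) y \<in> E"
      using bij[OF E] y by (auto simp: bij_betw_def intro: inv_into_into)
    have fx: "f (inv_into E (phi E) y) \<in> D" using quillen_arrD(2)[OF f x] .
    then have "phi D (f (inv_into E (phi E) y)) \<in> F D" using bij[OF D] by (auto simp: bij_betw_def)
    then show "phi C ((\<lambda>x\<in>E. g (f x)) (inv_into E (phi E) y)) =
        (\<lambda>y\<in>F D. phi C (g (inv_into D (phi D) y)))
         ((\<lambda>y\<in>F E. phi D (f (inv_into E (phi E) y))) y)"
      using x y fx bij[OF D] by (simp add: bij_betw_def)
  qed
qed

text \<open>The unit and the counit are built from the chosen bijections, and they are natural by
  cancellation since both functors act by transport. \<open>F\<close> and \<open>G\<close> may be
  chosen independently of each other. The group-theoretic content is confined to \<open>Fa\<close>,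
  \<open>Ga\<close> and to the four statements that the round trips and their inverses are
  arrows.\<close>

lemma quillen_equivalentI:
  assumes H: "group H" and K: "group K"
    and Fo: "\<And>E. E \<in> obj (quillen p H) \<Longrightarrow> F E \<in> obj (quillen p K)"
    and Go: "\<And>E. E \<in> obj (quillen p K) \<Longrightarrow> G E \<in> obj (quillen p H)"
    and Fb: "\<And>E. E \<in> obj (quillen p H) \<Longrightarrow> bij_betw (phi E) E (F E)"
    and Gb: "\<And>E. E \<in> obj (quillen p K) \<Longrightarrow> bij_betw (psi E) E (G E)"
    and Fa: "\<And>E D f. E \<in> obj (quillen p H) \<Longrightarrow> D \<in> obj (quillen p H) \<Longrightarrow>
      f \<in> arr (quillen p H) E D \<Longrightarrow>
      transport (F E) (phi E) E (phi D) f \<in> arr (quillen p K) (F E) (F D)"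
    and Ga: "\<And>E D f. E \<in> obj (quillen p K) \<Longrightarrow> D \<in> obj (quillen p K) \<Longrightarrow>
      f \<in> arr (quillen p K) E D \<Longrightarrow>
      transport (G E) (psi E) E (psi D) f \<in> arr (quillen p H) (G E) (G D)"
    and eta: "\<And>E. E \<in> obj (quillen p H) \<Longrightarrow>
      (\<lambda>x\<in>E. psi (F E) (phi E x)) \<in> arr (quillen p H) E (G (F E))"
    and eta': "\<And>E. E \<in> obj (quillen p H) \<Longrightarrow>
      (\<lambda>x\<in>G (F E). inv_into E (phi E) (inv_into (F E) (psi (F E)) x))
        \<in> arr (quillen p H) (G (F E)) E"
    and eps: "\<And>E. E \<in> obj (quillen p K) \<Longrightarrow>
      (\<lambda>x\<in>E. phi (G E) (psi E x)) \<in> arr (quillen p K) E (F (G E))"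
    and eps': "\<And>E. E \<in> obj (quillen p K) \<Longrightarrow>
      (\<lambda>x\<in>F (G E). inv_into E (psi E) (inv_into (G E) (phi (G E)) x))
        \<in> arr (quillen p K) (F (G E)) E"
  shows "equivalent_categories (quillen p H) (quillen p K)"
proof -
  let ?C = "quillen p H" and ?D = "quillen p K"
  let ?Fm = "\<lambda>E D f. transport (F E) (phi E) E (phi D) f"
  let ?Gm = "\<lambda>E D f. transport (G E) (psi E) E (psi D) f"
  have Fi: "phi E x \<in> F E" "inv_into E (phi E) (phi E x) = x"
    if "E \<in> obj ?C" "x \<in> E" for E x
    using Fb[OF that(1)] that(2) by (auto simp: bij_betw_def)
  have Gi: "psi E x \<in> G E" "inv_into E (psi E) (psi E x) = x"
    if "E \<in> obj ?D" "x \<in> E" for E x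
    using Gb[OF that(1)] that(2) by (auto simp: bij_betw_def)
  have Fj: "inv_into E (phi E) y \<in> E" "phi E (inv_into E (phi E) y) = y"
    if "E \<in> obj ?C" "y \<in> F E" for E y
    using Fb[OF that(1)] that(2) by (auto simp: bij_betw_def f_inv_into_f intro: inv_into_into)
  have Gj: "inv_into E (psi E) y \<in> E" "psi E (inv_into E (psi E) y) = y"
    if "E \<in> obj ?D" "y \<in> G E" for E y
    using Gb[OF that(1)] that(2) by (auto simp: bij_betw_def f_inv_into_f intro: inv_into_into)
  have "is_functor ?C ?D F ?Fm" using Fo Fb Fa by (rule is_functor_transport)
  moreover have "is_functor ?D ?C G ?Gm" using Go Gb Ga by (rule is_functor_transport)
  moreover have "natural_iso ?C ?C (\<lambda>U. U) (\<lambda>U V f. f) (\<lambda>U. G (F U))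
      (\<lambda>U V f. ?Gm (F U) (F V) (?Fm U V f)) (\<lambda>E. \<lambda>x\<in>E. psi (F E) (phi E x))"
    unfolding natural_iso_def iso_arrow_def
  proof (intro conjI ballI)
    fix E assume E: "E \<in> obj ?C"
    show "(\<lambda>x\<in>E. psi (F E) (phi E x)) \<in> arr ?C E (G (F E))" by (rule eta[OF E])
    show "\<exists>g\<in>arr ?C (G (F E)) E.
        compo ?C E (G (F E)) E g (\<lambda>x\<in>E. psi (F E) (phi E x)) = ident ?C E \<and>
        compo ?C (G (F E)) E (G (F E)) (\<lambda>x\<in>E. psi (F E) (phi E x)) g = ident ?C (G (F E))"
      unfolding quillen_compo quillen_ident compose_def
      by (rule bexI[OF _ eta'[OF E]]) (simp add: Fo E Fi Gi Fj Gj cong: restrict_cong)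
    fix D f assume D: "D \<in> obj ?C" and f: "f \<in> arr ?C E D"
    show "compo ?C E D (G (F D)) (\<lambda>x\<in>D. psi (F D) (phi D x)) f =
        compo ?C E (G (F E)) (G (F D)) (?Gm (F E) (F D) (?Fm E D f)) (\<lambda>x\<in>E. psi (F E) (phi E x))"
      unfolding quillen_compo compose_def transport_def
      using E D quillen_arrD(2)[OF f] by (simp add: Fo Fi Gi Fj Gj cong: restrict_cong)
  qed
  moreover have "natural_iso ?D ?D (\<lambda>U. F (G U)) (\<lambda>U V f. ?Fm (G U) (G V) (?Gm U V f)) (\<lambda>U. U)
      (\<lambda>U V f. f) (\<lambda>E. \<lambda>x\<in>F (G E). inv_into E (psi E) (inv_into (G E) (phi (G E)) x))"
    unfolding natural_iso_def iso_arrow_def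
  proof (intro conjI ballI)
    fix E assume E: "E \<in> obj ?D"
    show "(\<lambda>x\<in>F (G E). inv_into E (psi E) (inv_into (G E) (phi (G E)) x)) \<in> arr ?D (F (G E)) E"
      by (rule eps'[OF E])
    show "\<exists>g\<in>arr ?D E (F (G E)).
        compo ?D (F (G E)) E (F (G E)) g
          (\<lambda>x\<in>F (G E). inv_into E (psi E) (inv_into (G E) (phi (G E)) x)) = ident ?D (F (G E)) \<and>
        compo ?D E (F (G E)) E
          (\<lambda>x\<in>F (G E). inv_into E (psi E) (inv_into (G E) (phi (G E)) x)) g = ident ?D E"
      unfolding quillen_compo quillen_ident compose_def
      by (rule bexI[OF _ eps[OF E]]) (simp add: Go E Fi Gi Fj Gj cong: restrict_cong)
    fix D f assume D: "D \<in> obj ?D" and f: "f \<in> arr ?D E D"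
    show "compo ?D (F (G E)) (F (G D)) D
          (\<lambda>x\<in>F (G D). inv_into D (psi D) (inv_into (G D) (phi (G D)) x))
          (?Fm (G E) (G D) (?Gm E D f)) =
        compo ?D (F (G E)) E D f
          (\<lambda>x\<in>F (G E). inv_into E (psi E) (inv_into (G E) (phi (G E)) x))"
      unfolding quillen_compo compose_def transport_def
      using E D quillen_arrD(2)[OF f] by (simp add: Go Fi Gi Fj Gj cong: restrict_cong)
  qed
  ultimately show ?thesis
    unfolding equivalent_categories_def
    using quillen_category_category[OF H] quillen_category_category[OF K] by blast
qed


section \<open>Labelled groups\<close>

text \<open>A label is an element of the ring \<open>'r\<close>, up to a congruence; the boolean distinguishes the
  labels of the elements of order \<open>p\<close> in the kernel of the projection \<open>\<pi>\<close> to the cyclic group from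
  those of the elements \<open>g\<close> with \<open>\<pi> g = w\<close>.\<close>

definition label_map ::
  "(bool \<Rightarrow> 'a \<Rightarrow> 'r::comm_ring_1 \<Rightarrow> bool) \<Rightarrow> (bool \<Rightarrow> 'b \<Rightarrow> 'r \<Rightarrow> bool) \<Rightarrow> 'r \<Rightarrow> 'a set \<Rightarrow> ('a \<Rightarrow> 'b) \<Rightarrow> bool"
  where "label_map L L' t E f \<longleftrightarrow> (\<forall>x\<in>E. \<forall>b r. L b x r \<longrightarrow> L' b (f x) (t * r))"


text \<open>The inverse of x is its (p-1)-st power, so closure under products suffices. The case p =
  1 is separate because only positive powers are known to stay in \<open>E\<close>.\<close>

lemma elementary_abelian_subgroupI:
  assumes "group K" "E \<noteq> {}" "E \<subseteq> carrier K" "p > 0"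
    and m: "\<And>x y. x \<in> E \<Longrightarrow> y \<in> E \<Longrightarrow> x \<otimes>\<^bsub>K\<^esub> y \<in> E"
    and c: "\<And>x y. x \<in> E \<Longrightarrow> y \<in> E \<Longrightarrow> x \<otimes>\<^bsub>K\<^esub> y = y \<otimes>\<^bsub>K\<^esub> x"
    and pw: "\<And>x. x \<in> E \<Longrightarrow> x [^]\<^bsub>K\<^esub> p = \<one>\<^bsub>K\<^esub>"
  shows "elem_ab p K E"
proof -
  interpret group K by fact
  have E: "x \<in> carrier K" if "x \<in> E" for x using assms(3) that by auto
  have pow: "x [^]\<^bsub>K\<^esub> Suc n \<in> E" if "x \<in> E" for x n
    by (induction n) (use that m E in auto)
  have one: "\<one>\<^bsub>K\<^esub> \<in> E"
    using assms(2) pow[of _ "p - 1"] pw \<open>p > 0\<close> by (metis Suc_diff_1 ex_in_conv)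
  have inv: "inv\<^bsub>K\<^esub> x \<in> E" if x: "x \<in> E" for x
  proof (cases "p = 1")
    case True
    then show ?thesis using pw[OF x] E[OF x] one by simp
  next
    case False
    define n where "n = p - 2"
    have p: "p = Suc (Suc n)" using False \<open>p > 0\<close> by (simp add: n_def)
    have "x [^]\<^bsub>K\<^esub> Suc n \<otimes>\<^bsub>K\<^esub> x = \<one>\<^bsub>K\<^esub>" using pw[OF x] by (simp add: p)
    then have "inv\<^bsub>K\<^esub> x = x [^]\<^bsub>K\<^esub> Suc n" using E[OF x] by (intro inv_equality) auto
    then show ?thesis using pow[OF x] by simp
  qed
  show ?thesis
    unfolding elementary_abelian_subgroup_def
    using assms m c pw inv one by (auto intro!: subgroupI)
qed

text \<open>\<open>E\<close> and its copy in \<open>K\<close> are parametrised by the same index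
  set: \<open>a\<close> and \<open>b\<close> have the same fibres and carry \<open>mul\<close> to
  the two products, so sending \<open>a i\<close> to \<open>b i\<close> is a well-defined injective
  homomorphism. Only a binary operation on \<open>I\<close> is asked for, since below
  \<open>I\<close> contains exponents in the natural numbers.\<close>

lemma matching_subgroup:
  assumes E: "elem_ab p H E" and H: "group H" and K: "group K" and p: "p > 0"
    and aE: "a ` I = E" and bK: "b ` I \<subseteq> carrier K"
    and mI: "\<And>i j. i \<in> I \<Longrightarrow> j \<in> I \<Longrightarrow> mul i j \<in> I"
    and am: "\<And>i j. i \<in> I \<Longrightarrow> j \<in> I \<Longrightarrow> a (mul i j) = a i \<otimes>\<^bsub>H\<^esub> a j"
    and bm: "\<And>i j. i \<in> I \<Longrightarrow> j \<in> I \<Longrightarrow> b (mul i j) = b i \<otimes>\<^bsub>K\<^esub> b j"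
    and ab: "\<And>i j. i \<in> I \<Longrightarrow> j \<in> I \<Longrightarrow> a i = a j \<longleftrightarrow> b i = b j"
    and L: "\<And>i c r. i \<in> I \<Longrightarrow> L c (a i) r \<longleftrightarrow> L' c (b i) r"
  shows "\<exists>E' phi. elem_ab p K E' \<and> bij_betw phi E E' \<and>
    (\<forall>x\<in>E. \<forall>y\<in>E. phi (x \<otimes>\<^bsub>H\<^esub> y) = phi x \<otimes>\<^bsub>K\<^esub> phi y) \<and> (\<forall>x\<in>E. \<forall>c r. L c x r \<longleftrightarrow> L' c (phi x) r)"
proof -
  interpret H: group H by fact
  interpret K: group K by fact
  define phi where "phi x = b (inv_into I a x)" for x
  have phia: "phi (a i) = b i" if "i \<in> I" for i
    unfolding phi_def using ab[of "inv_into I a (a i)" i] that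
    by (metis f_inv_into_f image_eqI inv_into_into)
  have phim: "phi (x \<otimes>\<^bsub>H\<^esub> y) = phi x \<otimes>\<^bsub>K\<^esub> phi y" if xy: "x \<in> E" "y \<in> E" for x y
  proof -
    obtain i j where "i \<in> I" "j \<in> I" "x = a i" "y = a j" using xy aE by auto
    then show ?thesis using phia mI bm by (simp flip: am)
  qed
  have Em: "x \<otimes>\<^bsub>H\<^esub> y \<in> E" "x \<in> carrier H" if "x \<in> E" "y \<in> E" for x y
    using E that unfolding elementary_abelian_subgroup_def
    by (auto intro: subgroup.m_closed subgroup.mem_carrier)
  have one: "\<one>\<^bsub>H\<^esub> \<in> E" using E by (auto simp: elementary_abelian_subgroup_def subgroup.one_closed)
  have phiK: "phi x \<in> carrier K" if "x \<in> E" for x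
  proof -
    obtain i where "i \<in> I" "x = a i" using \<open>x \<in> E\<close> aE by auto
    then show ?thesis using phia bK by auto
  qed
  have phi1: "phi \<one>\<^bsub>H\<^esub> = \<one>\<^bsub>K\<^esub>"
    using phim[OF one one] phiK[OF one] by (simp add: K.l_cancel_one')
  have pw: "x [^]\<^bsub>H\<^esub> n \<in> E \<and> phi (x [^]\<^bsub>H\<^esub> n) = phi x [^]\<^bsub>K\<^esub> n" if "x \<in> E" for x and n :: nat
    by (induction n) (use one phi1 phim Em that in auto)
  have bij: "bij_betw phi E (phi ` E)"
    unfolding bij_betw_def
  proof (intro conjI inj_onI)
    fix x y assume "x \<in> E" "y \<in> E" "phi x = phi y"
    moreover from this obtain i j where "i \<in> I" "j \<in> I" "x = a i" "y = a j" using aE by auto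
    ultimately show "x = y" using ab phia by auto
  qed simp
  have "elem_ab p K (phi ` E)"
  proof (rule elementary_abelian_subgroupI[OF K _ _ p])
    show "phi ` E \<noteq> {}" using one by auto
    show "phi ` E \<subseteq> carrier K" using phiK by auto
    fix x y assume "x \<in> phi ` E" "y \<in> phi ` E"
    then obtain u v where uv: "u \<in> E" "v \<in> E" "x = phi u" "y = phi v" by auto
    show "x \<otimes>\<^bsub>K\<^esub> y \<in> phi ` E" using uv Em by (auto simp flip: phim)
    have "u \<otimes>\<^bsub>H\<^esub> v = v \<otimes>\<^bsub>H\<^esub> u" using E uv by (auto simp: elementary_abelian_subgroup_def)
    then show "x \<otimes>\<^bsub>K\<^esub> y = y \<otimes>\<^bsub>K\<^esub> x" using uv by (simp flip: phim)
    have "u [^]\<^bsub>H\<^esub> p = \<one>\<^bsub>H\<^esub>" using E uv by (auto simp: elementary_abelian_subgroup_def)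
    then show "x [^]\<^bsub>K\<^esub> p = \<one>\<^bsub>K\<^esub>" using pw[of u p] uv phi1 by auto
  qed
  moreover have "L c x r \<longleftrightarrow> L' c (phi x) r" if "x \<in> E" for x c r
  proof -
    obtain i where "i \<in> I" "x = a i" using \<open>x \<in> E\<close> aE by auto
    then show ?thesis using phia L by auto
  qed
  ultimately show ?thesis using bij phim by blast
qed

text \<open>The axioms are what a group must satisfy for its Quillen category to be read off from
  labels. \<pi> is the projection to the cyclic group of order pw, in which w has order p, and
  \<open>bt r\<close> is the element with label r in the kernel of \<pi>. \<open>K1\<close> is the
  kernel of \<open>bt\<close>, \<open>K2\<close> is the congruence for the labels of elements over
  w, and \<open>K0\<close> consists of the r for which \<open>bt r\<close> commutes with the
  elements over w. Two groups will be compared when they share \<open>p\<close>, \<open>w\<close>,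
  \<open>th\<close> and the three sets.\<close>

locale labelled_group = group H for H (structure) +
  fixes p :: nat and w :: int and th :: "'r::comm_ring_1" and K0 K1 K2 :: "'r set"
    and \<pi> :: "'a \<Rightarrow> int" and bt :: "'r \<Rightarrow> 'a" and lab :: "'a \<Rightarrow> 'r \<Rightarrow> bool"
  assumes prime_p: "Factorial_Ring.prime p" and w_pos: "w > 0"
    and pi_range: "x \<in> carrier H \<Longrightarrow> \<pi> x \<in> {0..<int p * w}"
    and pi_mult: "x \<in> carrier H \<Longrightarrow> y \<in> carrier H \<Longrightarrow> \<pi> (x \<otimes> y) = (\<pi> x + \<pi> y) mod (int p * w)"
    and beta_closed: "bt r \<in> carrier H" and pi_beta: "\<pi> (bt r) = 0"
    and beta_add: "bt (r + s) = bt r \<otimes> bt s" and beta_one: "bt r = \<one> \<longleftrightarrow> r \<in> K1"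
    and beta_surj: "x \<in> carrier H \<Longrightarrow> \<pi> x = 0 \<Longrightarrow> x [^] p = \<one> \<Longrightarrow> \<exists>r. x = bt r"
    and omega_pow: "x \<in> carrier H \<Longrightarrow> \<pi> x = w \<Longrightarrow> x [^] p = \<one>"
    and lab_ex: "x \<in> carrier H \<Longrightarrow> \<pi> x = w \<Longrightarrow> \<exists>r. lab x r"
    and lab_eq: "x \<in> carrier H \<Longrightarrow> \<pi> x = w \<Longrightarrow> lab x r \<Longrightarrow> lab x s \<longleftrightarrow> s - r \<in> K2"
    and lab_surj: "\<exists>x\<in>carrier H. \<pi> x = w \<and> lab x r"
    and lab_beta: "x \<in> carrier H \<Longrightarrow> \<pi> x = w \<Longrightarrow> lab (bt s \<otimes> x) r \<longleftrightarrow> lab x r"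
    and beta_comm: "x \<in> carrier H \<Longrightarrow> \<pi> x = w \<Longrightarrow> bt r \<otimes> x = x \<otimes> bt r \<longleftrightarrow> r \<in> K0"
    and conj_label: "h \<in> carrier H \<Longrightarrow> \<exists>i::nat. (\<forall>r. h \<otimes> bt r \<otimes> inv h = bt (th ^ i * r)) \<and>
      (\<forall>x r. x \<in> carrier H \<longrightarrow> \<pi> x = w \<longrightarrow> lab x r \<longrightarrow> lab (h \<otimes> x \<otimes> inv h) (th ^ i * r))"
    and conj_label_ex: "\<exists>h\<in>carrier H. (\<forall>r. h \<otimes> bt r \<otimes> inv h = bt (th ^ i * r)) \<and>
      (\<forall>x r. x \<in> carrier H \<longrightarrow> \<pi> x = w \<longrightarrow> lab x r \<longrightarrow> lab (h \<otimes> x \<otimes> inv h) (th ^ i * r))"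
    and lab_conj: "x \<in> carrier H \<Longrightarrow> y \<in> carrier H \<Longrightarrow> \<pi> x = w \<Longrightarrow> \<pi> y = w \<Longrightarrow> lab x r \<Longrightarrow> lab y r \<Longrightarrow>
      \<exists>h\<in>carrier H. (\<forall>s. h \<otimes> bt s \<otimes> inv h = bt s) \<and> h \<otimes> x \<otimes> inv h = y"
begin

text \<open>Elements over kw with 1 < k < p receive no label: in an elementary abelian subgroup they
  are products of a \<open>bt r\<close> and a power of an element over w.\<close>

definition label :: "bool \<Rightarrow> 'a \<Rightarrow> 'r \<Rightarrow> bool" where
  "label b x r \<longleftrightarrow> (if b then x = bt r else x \<in> carrier H \<and> \<pi> x = w \<and> lab x r)"

lemma p_gt_1: "p > 1" using prime_gt_1_nat[OF prime_p] .

lemma pi_one: "\<pi> \<one> = 0"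
proof -
  have "0 < p * w" using p_gt_1 w_pos by simp
  have "\<pi> \<one> = (\<pi> \<one> + \<pi> \<one>) mod (int p * w)" using pi_mult[of \<one> \<one>] by simp
  then have "(\<pi> \<one> + \<pi> \<one>) mod (int p * w) = \<pi> \<one> mod (int p * w)"
    using pi_range[of \<one>] by simp
  then have "(int p * w) dvd \<pi> \<one>" by (simp add: mod_eq_dvd_iff)
  then show ?thesis using pi_range[of \<one>] zdvd_not_zless[of "\<pi> \<one>" "int p * w"] by force
qed

lemma pi_pow: "x \<in> carrier H \<Longrightarrow> \<pi> (x [^] (n::nat)) = (int n * \<pi> x) mod (int p * w)"
  by (induction n) (auto simp: pi_one pi_mult algebra_simps mod_simps)

lemma pi_conj:
  assumes "h \<in> carrier H" "x \<in> carrier H"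
  shows "\<pi> (h \<otimes> x \<otimes> inv h) = \<pi> x"
proof -
  have "(\<pi> h + \<pi> (inv h)) mod (int p * w) = 0"
    using assms pi_mult[of h "inv h"] pi_one by simp
  then have "(\<pi> h + \<pi> (inv h) + \<pi> x) mod (int p * w) = \<pi> x mod (int p * w)"
    by (metis add_0 mod_add_left_eq)
  then show ?thesis using assms pi_range[of x] by (simp add: pi_mult mod_simps add.commute add.left_commute)
qed

lemma pi_beta_pow:
  assumes "g \<in> carrier H" "\<pi> g = w"
  shows "\<pi> (bt r \<otimes> g [^] (k::nat)) = int (k mod p) * w"
proof -
  have "(int k * w) mod (int p * w) = int (k mod p) * w"
    by (simp add: mod_mult_mult2 zmod_int)
  then show ?thesis
    using assms by (simp add: pi_mult beta_closed pi_beta pi_pow)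
qed

lemma beta_eq: "bt r = bt s \<longleftrightarrow> r - s \<in> K1"
proof -
  have "bt r = bt (r - s) \<otimes> bt s" by (simp flip: beta_add)
  then show ?thesis
    using beta_closed r_cancel_one' by (metis beta_one r_cancel_one)
qed

lemma pow_mod: "g \<in> carrier H \<Longrightarrow> \<pi> g = w \<Longrightarrow> g [^] (k::nat) = g [^] (k mod p)"
proof -
  assume g: "g \<in> carrier H" "\<pi> g = w"
  have "g [^] k = g [^] (p * (k div p) + k mod p)" by simp
  also have "\<dots> = (g [^] p) [^] (k div p) \<otimes> g [^] (k mod p)"
    using g by (simp only: nat_pow_mult nat_pow_pow)
  finally show ?thesis using g omega_pow by simp
qed

lemma beta_pow_eq:
  assumes g: "g \<in> carrier H" "\<pi> g = w"
  shows "bt r \<otimes> g [^] (k::nat) = bt s \<otimes> g [^] (l::nat) \<longleftrightarrow> r - s \<in> K1 \<and> k mod p = l mod p"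
proof
  assume eq: "bt r \<otimes> g [^] k = bt s \<otimes> g [^] l"
  then have "\<pi> (bt r \<otimes> g [^] k) = \<pi> (bt s \<otimes> g [^] l)" by simp
  then have "int (k mod p) * w = int (l mod p) * w" unfolding pi_beta_pow[OF g] .
  then have kl: "k mod p = l mod p" using w_pos by (metis mult_right_cancel of_nat_eq_iff order_less_irrefl)
  then have "g [^] k = g [^] l" using pow_mod[OF g] by metis
  then have "bt r = bt s" using eq g beta_closed by simp
  then show "r - s \<in> K1 \<and> k mod p = l mod p" using kl beta_eq by blast
next
  assume "r - s \<in> K1 \<and> k mod p = l mod p"
  then show "bt r \<otimes> g [^] k = bt s \<otimes> g [^] l" using pow_mod[OF g] beta_eq by metis
qed

text \<open>The product lies over (k mod p) w, so it can have a label of the first kind only for k =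
  0 and one of the second kind only for k = 1 modulo p. In the latter case the factor
  \<open>bt s\<close> leaves the label of g unchanged by \<open>lab_beta\<close>.\<close>

lemma label_beta_pow:
  assumes g: "g \<in> carrier H" "\<pi> g = w" "lab g r0"
  shows "label c (bt s \<otimes> g [^] (k::nat)) r \<longleftrightarrow>
    (if c then s - r \<in> K1 \<and> k mod p = 0 else k mod p = 1 \<and> r - r0 \<in> K2)"
proof (cases c)
  case True
  have "bt s \<otimes> g [^] k = bt r \<longleftrightarrow> bt s \<otimes> g [^] k = bt r \<otimes> g [^] (0::nat)"
    using beta_closed by simp
  then show ?thesis using True beta_pow_eq[OF g(1,2), of s k r 0] by (simp add: label_def)
next
  case False
  show ?thesis
  proof (cases "k mod p = 1")
    case True
    then have "g [^] k = g" using pow_mod[OF g(1,2), of k] g by simp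
    then show ?thesis
      using False g pi_beta_pow[OF g(1,2), of s 1] lab_beta lab_eq beta_closed p_gt_1 True
      by (simp add: label_def)
  next
    case ne: False
    then have "int (k mod p) * w \<noteq> w" using w_pos
      by (metis mult_cancel_right1 of_nat_1_eq_iff order_less_irrefl)
    then show ?thesis
      using False ne pi_beta_pow[OF g(1,2), of s k] by (simp add: label_def)
  qed
qed

lemma label_beta: "label c (bt s) r \<longleftrightarrow> c \<and> s - r \<in> K1"
  using w_pos by (simp add: label_def pi_beta beta_eq)

section \<open>Structure of the elementary abelian subgroups\<close>

lemma elementaryD:
  assumes "elem_ab p H E"
  shows "subgroup E H" "x \<in> E \<Longrightarrow> x \<in> carrier H" "x \<in> E \<Longrightarrow> y \<in> E \<Longrightarrow> x \<otimes> y = y \<otimes> x"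
    "x \<in> E \<Longrightarrow> x [^] p = \<one>" "x \<in> E \<Longrightarrow> y \<in> E \<Longrightarrow> x \<otimes> y \<in> E" "x \<in> E \<Longrightarrow> inv x \<in> E" "\<one> \<in> E"
    "x \<in> E \<Longrightarrow> x [^] (n::nat) \<in> E"
proof -
  show E: "subgroup E H" using assms by (simp add: elementary_abelian_subgroup_def)
  show 1: "x \<in> E \<Longrightarrow> y \<in> E \<Longrightarrow> x \<otimes> y \<in> E" for x y using subgroup.m_closed[OF E] .
  show 2: "\<one> \<in> E" using subgroup.one_closed[OF E] .
  show "x \<in> E \<Longrightarrow> x [^] (n::nat) \<in> E" by (induction n) (auto simp: 1 2)
qed (use assms in \<open>auto simp: elementary_abelian_subgroup_def subgroup.m_inv_closed
    dest: subgroup.mem_carrier\<close>)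

text \<open>Since x^p = 1, the modulus pw divides p times \<pi> x, so w divides \<pi> x.\<close>

lemma elementary_pi:
  assumes E: "elem_ab p H E" and x: "x \<in> E"
  obtains k where "k < p" "\<pi> x = int k * w"
proof -
  have xc: "x \<in> carrier H" using elementaryD(2)[OF E x] .
  have "(int p * \<pi> x) mod (int p * w) = 0"
    using pi_pow[OF xc, of p] elementaryD(4)[OF E x] pi_one by simp
  then have "w dvd \<pi> x" using p_gt_1 by (simp add: mod_eq_0_iff_dvd)
  then obtain k where k: "\<pi> x = w * k" by blast
  have "0 \<le> k" "k < p" using pi_range[OF xc] w_pos unfolding k
    by (auto simp: zero_le_mult_iff mult.commute)
  then show ?thesis using that[of "nat k"] k by (simp add: mult.commute)
qed

text \<open>If \<pi> x = kw with 0 < k < p, then k is invertible modulo p, and raising x to the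
  inverse of k gives an element over w.\<close>

lemma elementary_generator:
  assumes E: "elem_ab p H E" and x: "x \<in> E" and ne: "\<pi> x \<noteq> 0"
  shows "\<exists>g\<in>E. \<pi> g = w"
proof -
  obtain k where k: "k < p" "\<pi> x = int k * w" using elementary_pi[OF E x] .
  have "k \<noteq> 0" using ne k by auto
  then have "coprime k p" using k prime_p
    by (metis coprime_commute gcd_nat.order_iff_strict nat_dvd_not_less not_gr_zero prime_imp_coprime)
  moreover obtain d l y where "d dvd k" "d dvd p" "k * l = p * y + d"
    using bezout_add_strong_nat[OF \<open>k \<noteq> 0\<close>, of p] by blast
  ultimately have l: "(k * l) mod p = 1"
    using p_gt_1 by (metis coprime_common_divisor_nat mod_less mod_mult_self4)
  have xc: "x \<in> carrier H" using elementaryD(2)[OF E x] .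
  have "\<pi> (x [^] l) = int ((k * l) mod p) * w"
    by (simp add: pi_pow[OF xc] k(2) mult.assoc[symmetric] mod_mult_mult2 zmod_int mult.commute[of "int l"])
  also have "\<dots> = w" using l by simp
  finally show ?thesis using elementaryD(8)[OF E x] by blast
qed

text \<open>If x lies over kw, then multiplying it by g^(p-k) gives an element of \<open>E\<close>
  over 0 with trivial p-th power, which is some \<open>bt r\<close> by \<open>beta_surj\<close>;
  multiplying back by g^k recovers x because g^p = 1.\<close>

lemma elementary_decompose:
  assumes E: "elem_ab p H E" and g: "g \<in> E" "\<pi> g = w" and x: "x \<in> E"
  obtains r k where "bt r \<in> E" "x = bt r \<otimes> g [^] (k::nat)"
proof -
  note D = elementaryD[OF E]
  obtain k where k: "k < p" "\<pi> x = int k * w" using elementary_pi[OF E x] .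
  let ?y = "x \<otimes> g [^] (p - k)"
  have y: "?y \<in> E" using D(5)[OF x D(8)[OF g(1)]] .
  have "(int k * w + int (p - k) * w) mod (int p * w) = 0"
    using k(1) by (simp flip: distrib_right)
  then have "\<pi> ?y = 0" using D(2)[OF g(1)] D(2)[OF x]
    by (simp only: pi_mult pi_pow nat_pow_closed mod_add_right_eq k(2) g(2))
  then obtain r where r: "?y = bt r" using beta_surj[OF D(2)[OF y]] D(4)[OF y] by blast
  have "bt r \<otimes> g [^] k = x \<otimes> (g [^] (p - k) \<otimes> g [^] k)"
    using D(2)[OF g(1)] D(2)[OF x] by (simp flip: r add: m_assoc)
  also have "\<dots> = x" using D(2)[OF g(1)] D(2)[OF x] D(4)[OF g(1)] k by (simp add: nat_pow_mult)
  finally show ?thesis using that[of r k] y r by simp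
qed

section \<open>Morphisms of the Quillen category as label maps\<close>

lemma arrow_label_map:
  assumes E: "elem_ab p H E" and D: "elem_ab p H D"
    and f: "f \<in> arr (quillen p H) E D"
  shows "\<exists>i::nat. label_map label label (th ^ i) E f"
proof -
  obtain h where h: "h \<in> carrier H" "f = (\<lambda>x\<in>E. h \<otimes> x \<otimes> inv h)"
    using f by (auto simp: quillen_category_def)
  obtain i where i: "\<forall>r. h \<otimes> bt r \<otimes> inv h = bt (th ^ i * r)"
    "\<forall>x r. x \<in> carrier H \<longrightarrow> \<pi> x = w \<longrightarrow> lab x r \<longrightarrow> lab (h \<otimes> x \<otimes> inv h) (th ^ i * r)"
    using conj_label[OF h(1)] by blast
  have "label_map label label (th ^ i) E f"
    unfolding label_map_def label_def using h i by (auto simp: pi_conj)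
  then show ?thesis by blast
qed

text \<open>On the elements \<open>bt r\<close> the map f agrees with conjugation by any t that
  multiplies all labels by \<open>th ^ i\<close>. If \<open>E\<close> also contains g over w, then f
  g and the conjugate of g by t have equal labels, so a further conjugation that fixes every
  \<open>bt s\<close> carries one to the other. The product of the two conjugating elements then
  induces f on generators of \<open>E\<close>.\<close>

lemma label_map_arrow:
  assumes E: "elem_ab p H E" and D: "elem_ab p H D"
    and f: "f \<in> extensional E" "f \<in> E \<rightarrow> D" "inj_on f E"
    and fm: "\<And>x y. x \<in> E \<Longrightarrow> y \<in> E \<Longrightarrow> f (x \<otimes> y) = f x \<otimes> f y"
    and lm: "label_map label label (th ^ i) E f"
  shows "f \<in> arr (quillen p H) E D"
proof -
  note ED = elementaryD[OF E] and DD = elementaryD[OF D]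
  have fD: "f x \<in> D" if "x \<in> E" for x using f that by auto
  have fH: "f x \<in> carrier H" if "x \<in> E" for x using fD DD(2) that by blast
  have fbt: "f (bt r) = bt (th ^ i * r)" if "bt r \<in> E" for r
    using lm that by (auto simp: label_map_def label_def split: if_splits)
  obtain t where t: "t \<in> carrier H" "\<forall>r. t \<otimes> bt r \<otimes> inv t = bt (th ^ i * r)"
    "\<forall>x r. x \<in> carrier H \<longrightarrow> \<pi> x = w \<longrightarrow> lab x r \<longrightarrow> lab (t \<otimes> x \<otimes> inv t) (th ^ i * r)"
    using conj_label_ex[of i] by blast
  have "\<exists>h\<in>carrier H. \<forall>x\<in>E. f x = h \<otimes> x \<otimes> inv h"
  proof (cases "\<forall>x\<in>E. \<pi> x = 0")
    case True
    have "f x = t \<otimes> x \<otimes> inv t" if x: "x \<in> E" for x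
    proof -
      obtain r where "x = bt r" using beta_surj[OF ED(2)[OF x]] ED(4)[OF x] x True by blast
      then show ?thesis using fbt x t by auto
    qed
    then show ?thesis using t by blast
  next
    case False
    then obtain g where g: "g \<in> E" "\<pi> g = w" using elementary_generator[OF E] by blast
    have gc: "g \<in> carrier H" using ED(2)[OF g(1)] .
    obtain r where r: "lab g r" using lab_ex[OF gc g(2)] by blast
    have "label False g r" using g gc r by (simp add: label_def)
    then have "label False (f g) (th ^ i * r)"
      using lm g(1) by (simp add: label_map_def)
    then have fg: "\<pi> (f g) = w" "lab (f g) (th ^ i * r)" by (auto simp: label_def)
    \<comment> \<open>This n corrects t on the single generator g without disturbing what t does on
      the kernel of \<pi>.\<close>
    obtain n where n: "n \<in> carrier H" "\<forall>s. n \<otimes> bt s \<otimes> inv n = bt s"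
      "n \<otimes> (t \<otimes> g \<otimes> inv t) \<otimes> inv n = f g"
    proof -
      have "t \<otimes> g \<otimes> inv t \<in> carrier H" "lab (t \<otimes> g \<otimes> inv t) (th ^ i * r)" "\<pi> (t \<otimes> g \<otimes> inv t) = w"
        using t gc g r pi_conj[OF t(1) gc] by simp_all
      then show ?thesis
        using lab_conj[OF _ fH[OF g(1)] _ fg(1) _ fg(2)] that by blast
    qed
    define h where "h = n \<otimes> t"
    have h: "h \<in> carrier H" using n t by (simp add: h_def)
    have hc: "h \<otimes> x \<otimes> inv h = n \<otimes> (t \<otimes> x \<otimes> inv t) \<otimes> inv n" if "x \<in> carrier H" for x
      using n(1) t(1) that by (simp add: h_def inv_mult_group m_assoc)
    have hm: "h \<otimes> (x \<otimes> y) \<otimes> inv h = (h \<otimes> x \<otimes> inv h) \<otimes> (h \<otimes> y \<otimes> inv h)"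
      if "x \<in> carrier H" "y \<in> carrier H" for x y
    proof -
      have "(h \<otimes> x \<otimes> inv h) \<otimes> (h \<otimes> y \<otimes> inv h) = h \<otimes> x \<otimes> (inv h \<otimes> h) \<otimes> y \<otimes> inv h"
        using that h by (simp only: m_assoc m_closed inv_closed)
      then show ?thesis using that h by (simp add: m_assoc)
    qed
    have hg: "h \<otimes> g \<otimes> inv h = f g" using hc[OF gc] n by simp
    have gk: "f (g [^] k) = h \<otimes> g [^] k \<otimes> inv h" for k :: nat
    proof (induction k)
      case 0
      have "f \<one> \<otimes> f \<one> = f \<one>" using fm[OF ED(7) ED(7)] by simp
      then have "f \<one> = \<one>" using fH[OF ED(7)] by (simp add: l_cancel_one')
      then show ?case using h by simp
    next
      case (Suc k)
      then show ?case using fm[of "g [^] k" g] ED(8)[OF g(1)] g gc hg hm by simp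
    qed
    have "f x = h \<otimes> x \<otimes> inv h" if x: "x \<in> E" for x
    proof -
      obtain r k where rk: "bt r \<in> E" "x = bt r \<otimes> g [^] (k::nat)"
        using elementary_decompose[OF E g x] .
      have "f x = f (bt r) \<otimes> f (g [^] k)" using rk fm ED(8)[OF g(1)] by simp
      also have "f (bt r) = h \<otimes> bt r \<otimes> inv h"
        using fbt[OF rk(1)] hc[OF beta_closed] t n by simp
      finally show ?thesis using gk rk(2) hm gc beta_closed by simp
    qed
    then show ?thesis using h by blast
  qed
  then obtain h where h: "h \<in> carrier H" "\<forall>x\<in>E. f x = h \<otimes> x \<otimes> inv h" by blast
  have "f = (\<lambda>x\<in>E. h \<otimes> x \<otimes> inv h)" using f(1) h(2) by (auto intro!: extensionalityI)
  moreover have "f \<in> mon (H\<lparr>carrier := E\<rparr>) (H\<lparr>carrier := D\<rparr>)"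
    using f fm by (auto simp: mon_def hom_def)
  ultimately show ?thesis using h(1) by (simp add: quillen_category_def) blast
qed

lemma arrow_hom:
  assumes "f \<in> arr (quillen p H) E D" "x \<in> E" "y \<in> E"
  shows "f (x \<otimes> y) = f x \<otimes> f y"
proof -
  have "f \<in> hom (H\<lparr>carrier := E\<rparr>) (H\<lparr>carrier := D\<rparr>)"
    using assms(1) by (simp add: quillen_category_def mon_def)
  then show ?thesis using hom_mult[of f "H\<lparr>carrier := E\<rparr>" "H\<lparr>carrier := D\<rparr>" x y] assms(2,3) by simp
qed

lemma beta_pow_mult:
  assumes g: "g \<in> carrier H" and comm: "bt s \<otimes> g = g \<otimes> bt s"
  shows "bt (r + s) \<otimes> g [^] (k + l :: nat) = (bt r \<otimes> g [^] k) \<otimes> (bt s \<otimes> g [^] l)"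
proof -
  have "bt s \<otimes> g [^] k = g [^] k \<otimes> bt s" for k :: nat
  proof (induction k)
    case (Suc k)
    have "bt s \<otimes> g [^] Suc k = g [^] k \<otimes> (bt s \<otimes> g)"
      using g Suc beta_closed by (simp flip: m_assoc)
    then show ?case using g comm beta_closed by (simp add: m_assoc)
  qed (use beta_closed in simp)
  then have "(bt r \<otimes> g [^] k) \<otimes> (bt s \<otimes> g [^] l) = bt r \<otimes> (bt s \<otimes> g [^] k) \<otimes> g [^] l"
    using g beta_closed by (simp add: m_assoc)
  then show ?thesis using g beta_closed by (simp add: beta_add m_assoc flip: nat_pow_mult)
qed

end

section \<open>Comparison of two groups with the same label data\<close>

locale labelled_group_pair =
  H: labelled_group H p w th K0 K1 K2 \<pi> bt lab + K: labelled_group K p w th K0 K1 K2 \<pi>' bt' lab'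
  for H :: "('a, 'm) monoid_scheme" (structure) and K :: "('b, 'n) monoid_scheme"
    and p w and th :: "'r::comm_ring_1" and K0 K1 K2 \<pi> bt lab \<pi>' bt' lab'
begin

text \<open>A copy of \<open>E\<close> in \<open>K\<close> is written down with the same labels.
  Inside the kernel of \<pi> the parameter is r alone; otherwise it is a pair (r, k) standing for
  \<open>bt r\<close> times the k-th power of a generator over w. The two parametrisations have the
  same fibres because these are governed by \<open>K1\<close> and p, and \<open>K0\<close>
  guarantees that the parts commute in \<open>K\<close> as they do in \<open>H\<close>.\<close>

lemma match_ex:
  assumes E: "elem_ab p H E"
  shows "\<exists>E' phi. elem_ab p K E' \<and> bij_betw phi E E' \<and>
    (\<forall>x\<in>E. \<forall>y\<in>E. phi (x \<otimes>\<^bsub>H\<^esub> y) = phi x \<otimes>\<^bsub>K\<^esub> phi y) \<and>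
    (\<forall>x\<in>E. \<forall>c r. H.label c x r \<longleftrightarrow> K.label c (phi x) r)"
proof (cases "\<forall>x\<in>E. \<pi> x = 0")
  case True
  note D = H.elementaryD[OF E]
  show ?thesis
  proof (rule matching_subgroup[OF E H.is_group K.is_group, where I = "{r. bt r \<in> E}" and mul = "(+)"
        and a = bt and b = bt'])
    have "x \<in> bt ` {r. bt r \<in> E}" if "x \<in> E" for x
      using H.beta_surj[OF D(2)[OF that]] True D(4)[OF that] that by blast
    then show "bt ` {r. bt r \<in> E} = E" by auto
  qed (use D H.beta_add K.beta_add K.beta_closed H.beta_eq K.beta_eq H.label_beta K.label_beta H.p_gt_1
        in auto)
next
  case False
  note D = H.elementaryD[OF E]
  obtain g where g: "g \<in> E" "\<pi> g = w" using H.elementary_generator[OF E] False by blast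
  have gc: "g \<in> carrier H" using D(2)[OF g(1)] .
  obtain r0 where r0: "lab g r0" using H.lab_ex[OF gc g(2)] by blast
  \<comment> \<open>Choosing g' with the same label r0 as g is what makes the labels of
    \<open>E\<close> and of its copy agree.\<close>
  obtain g' where g': "g' \<in> carrier K" "\<pi>' g' = w" "lab' g' r0" using K.lab_surj by blast
  let ?I = "{r. bt r \<in> E} \<times> (UNIV :: nat set)"
  let ?a = "\<lambda>(r, k). bt r \<otimes>\<^bsub>H\<^esub> g [^]\<^bsub>H\<^esub> (k::nat)"
  let ?b = "\<lambda>(r, k). bt' r \<otimes>\<^bsub>K\<^esub> g' [^]\<^bsub>K\<^esub> (k::nat)"
  have comm: "bt s \<otimes>\<^bsub>H\<^esub> g = g \<otimes>\<^bsub>H\<^esub> bt s" if "bt s \<in> E" for s using D(3)[OF that g(1)] .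
  have comm': "bt' s \<otimes>\<^bsub>K\<^esub> g' = g' \<otimes>\<^bsub>K\<^esub> bt' s" if "bt s \<in> E" for s
    using H.beta_comm[OF gc g(2)] K.beta_comm[OF g'(1,2)] comm[OF that] by blast
  show ?thesis
  proof (rule matching_subgroup[OF E H.is_group K.is_group, where I = ?I and a = ?a and b = ?b
        and mul = "\<lambda>(r, k) (s, l). (r + s, k + l)"])
    show "?a ` ?I = E"
    proof (intro equalityI subsetI)
      fix x assume "x \<in> ?a ` ?I"
      then show "x \<in> E" using D(5,8) g by auto
    next
      fix x assume "x \<in> E"
      then obtain r k where "bt r \<in> E" "x = bt r \<otimes>\<^bsub>H\<^esub> g [^]\<^bsub>H\<^esub> (k::nat)"
        using H.elementary_decompose[OF E g] by blast
      then show "x \<in> ?a ` ?I" by (intro image_eqI[of _ _ "(r, k)"]) auto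
    qed
    show "?b ` ?I \<subseteq> carrier K" using g' K.beta_closed by auto
    show "p > 0" using H.p_gt_1 by simp
    fix i j assume ij: "i \<in> ?I" "j \<in> ?I"
    obtain r k s l where i: "i = (r, k)" and j: "j = (s, l)" by (cases i, cases j) auto
    show "(case i of (r, k) \<Rightarrow> \<lambda>(s, l). (r + s, k + l)) j \<in> ?I"
      using ij D(5) by (simp add: i j H.beta_add)
    show "?a ((case i of (r, k) \<Rightarrow> \<lambda>(s, l). (r + s, k + l)) j) = ?a i \<otimes>\<^bsub>H\<^esub> ?a j"
      using ij H.beta_pow_mult[OF gc comm] by (simp add: i j)
    show "?b ((case i of (r, k) \<Rightarrow> \<lambda>(s, l). (r + s, k + l)) j) = ?b i \<otimes>\<^bsub>K\<^esub> ?b j"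
      using ij K.beta_pow_mult[OF g'(1) comm'] by (simp add: i j)
    show "?a i = ?a j \<longleftrightarrow> ?b i = ?b j"
      by (simp add: i j H.beta_pow_eq[OF gc g(2)] K.beta_pow_eq[OF g'(1,2)])
    show "H.label c (?a i) t \<longleftrightarrow> K.label c (?b i) t" for c t
      by (simp add: i H.label_beta_pow[OF gc g(2) r0] K.label_beta_pow[OF g'])
  qed
qed

lemma match_choice:
  "\<exists>F phi. \<forall>E. elem_ab p H E \<longrightarrow>
    elem_ab p K (F E) \<and> bij_betw (phi E) E (F E) \<and>
    (\<forall>x\<in>E. \<forall>y\<in>E. phi E (x \<otimes>\<^bsub>H\<^esub> y) = phi E x \<otimes>\<^bsub>K\<^esub> phi E y) \<and>
    (\<forall>x\<in>E. \<forall>c r. H.label c x r \<longleftrightarrow> K.label c (phi E x) r)"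
  using match_ex by metis

text \<open>f multiplies all labels by some \<open>th ^ i\<close>, and phi and psi preserve labels,
  so the transported map multiplies by the same \<open>th ^ i\<close> and is therefore induced by
  conjugation in \<open>K\<close>.\<close>

lemma transport_arrow:
  assumes E: "elem_ab p H E" and D: "elem_ab p H D"
    and E': "elem_ab p K E'" and D': "elem_ab p K D'"
    and phi: "bij_betw phi E E'" "\<forall>x\<in>E. \<forall>y\<in>E. phi (x \<otimes>\<^bsub>H\<^esub> y) = phi x \<otimes>\<^bsub>K\<^esub> phi y"
      "\<forall>x\<in>E. \<forall>c r. H.label c x r \<longleftrightarrow> K.label c (phi x) r"
    and psi: "bij_betw psi D D'" "\<forall>x\<in>D. \<forall>y\<in>D. psi (x \<otimes>\<^bsub>H\<^esub> y) = psi x \<otimes>\<^bsub>K\<^esub> psi y"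
      "\<forall>x\<in>D. \<forall>c r. H.label c x r \<longleftrightarrow> K.label c (psi x) r"
    and f: "f \<in> arr (quillen p H) E D"
  shows "transport E' phi E psi f \<in> arr (quillen p K) E' D'"
proof -
  obtain i where i: "label_map H.label H.label (th ^ i) E f"
    using H.arrow_label_map[OF E D f] by blast
  let ?g = "inv_into E phi"
  have g: "?g y \<in> E" "phi (?g y) = y" if "y \<in> E'" for y
    using phi(1) that by (auto simp: bij_betw_def f_inv_into_f intro: inv_into_into)
  have gm: "?g (x \<otimes>\<^bsub>K\<^esub> y) = ?g x \<otimes>\<^bsub>H\<^esub> ?g y" if xy: "x \<in> E'" "y \<in> E'" for x y
  proof -
    have "phi (?g x \<otimes>\<^bsub>H\<^esub> ?g y) = x \<otimes>\<^bsub>K\<^esub> y" using phi(2) g xy by simp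
    moreover have "?g x \<otimes>\<^bsub>H\<^esub> ?g y \<in> E" using H.elementaryD(5)[OF E] g(1) xy by simp
    ultimately show ?thesis using phi(1) by (metis bij_betw_def inv_into_f_f)
  qed
  note fD = quillen_arrD[OF f]
  have D'm: "psi x \<in> D'" if "x \<in> D" for x using psi(1) that by (auto simp: bij_betw_def)
  show ?thesis
  proof (rule K.label_map_arrow[OF E' D', where i = i])
    show "transport E' phi E psi f \<in> extensional E'" by (simp add: transport_def)
    show "transport E' phi E psi f \<in> E' \<rightarrow> D'"
      using g(1) fD(2) D'm by (simp add: transport_def)
    show "inj_on (transport E' phi E psi f) E'"
    proof (rule inj_onI)
      fix x y assume xy: "x \<in> E'" "y \<in> E'" and "transport E' phi E psi f x = transport E' phi E psi f y"
      then have "psi (f (?g x)) = psi (f (?g y))" by (simp add: transport_def)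
      then have "f (?g x) = f (?g y)"
        using psi(1) fD(2) g(1) xy by (auto simp: bij_betw_def dest: inj_onD)
      then have "?g x = ?g y" using fD(3) g(1) xy by (auto dest: inj_onD)
      then show "x = y" using g(2) xy by metis
    qed
    show "transport E' phi E psi f (x \<otimes>\<^bsub>K\<^esub> y) = transport E' phi E psi f x \<otimes>\<^bsub>K\<^esub> transport E' phi E psi f y"
      if xy: "x \<in> E'" "y \<in> E'" for x y
      using K.elementaryD(5)[OF E' xy] xy gm[OF xy] H.arrow_hom[OF f, of "?g x" "?g y"] g fD(2) psi(2)
      by (simp add: transport_def)
    show "label_map K.label K.label (th ^ i) E' (transport E' phi E psi f)"
      unfolding label_map_def
    proof (intro ballI allI impI)
      fix x b r assume x: "x \<in> E'" and l: "K.label b x r"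
      have "H.label b (?g x) r" using phi(3) g x l by auto
      then have "H.label b (f (?g x)) (th ^ i * r)" using i g x by (auto simp: label_map_def)
      then show "K.label b (transport E' phi E psi f x) (th ^ i * r)"
        using psi(3) fD(2) g x by (simp add: transport_def)
    qed
  qed
qed

end

text \<open>A label-preserving isomorphism multiplies labels by \<open>th ^ 0\<close>, so it and its
  inverse are induced by conjugation.\<close>

lemma (in labelled_group) roundtrip_arrow:
  assumes E: "elem_ab p H E" and D: "elem_ab p H D"
    and b: "bij_betw phi E D" "\<And>x y. x \<in> E \<Longrightarrow> y \<in> E \<Longrightarrow> phi (x \<otimes> y) = phi x \<otimes> phi y"
    and l: "\<And>x c r. x \<in> E \<Longrightarrow> label c x r \<longleftrightarrow> label c (phi x) r"
  shows "(\<lambda>x\<in>E. phi x) \<in> arr (quillen p H) E D"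
    "(\<lambda>x\<in>D. inv_into E phi x) \<in> arr (quillen p H) D E"
proof -
  show "(\<lambda>x\<in>E. phi x) \<in> arr (quillen p H) E D"
  proof (rule label_map_arrow[OF E D, where i = 0])
    show "inj_on (\<lambda>x\<in>E. phi x) E" using b(1) by (auto simp: bij_betw_def inj_on_def)
  qed (use b l elementaryD(5)[OF E] in \<open>auto simp: bij_betw_def label_map_def\<close>)
  have g: "inv_into E phi y \<in> E" "phi (inv_into E phi y) = y" if "y \<in> D" for y
    using b(1) that by (auto simp: bij_betw_def f_inv_into_f intro: inv_into_into)
  have gm: "inv_into E phi (x \<otimes> y) = inv_into E phi x \<otimes> inv_into E phi y" if xy: "x \<in> D" "y \<in> D" for x y
  proof -
    have "phi (inv_into E phi x \<otimes> inv_into E phi y) = x \<otimes> y" using b(2) g xy by simp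
    moreover have "inv_into E phi x \<otimes> inv_into E phi y \<in> E" using elementaryD(5)[OF E] g(1) xy by simp
    ultimately show ?thesis using b(1) by (metis bij_betw_def inv_into_f_f)
  qed
  show "(\<lambda>x\<in>D. inv_into E phi x) \<in> arr (quillen p H) D E"
  proof (rule label_map_arrow[OF D E, where i = 0])
    show "inj_on (\<lambda>x\<in>D. inv_into E phi x) D"
    proof (rule inj_onI)
      fix x y assume xy: "x \<in> D" "y \<in> D" "(\<lambda>x\<in>D. inv_into E phi x) x = (\<lambda>x\<in>D. inv_into E phi x) y"
      then have "phi (inv_into E phi x) = phi (inv_into E phi y)" by simp
      then show "x = y" using g(2) xy by simp
    qed
    show "(\<lambda>x\<in>D. inv_into E phi x) \<in> D \<rightarrow> E" using g by simp
    show "(\<lambda>x\<in>D. inv_into E phi x) (x \<otimes> y) = (\<lambda>x\<in>D. inv_into E phi x) x \<otimes> (\<lambda>x\<in>D. inv_into E phi x) y"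
      if "x \<in> D" "y \<in> D" for x y
      using gm[OF that] elementaryD(5)[OF D that] that by simp
    show "label_map label label (th ^ 0) D (\<lambda>x\<in>D. inv_into E phi x)"
      using g l by (simp add: label_map_def)
  qed simp
qed

lemma (in labelled_group_pair) roundtrip:
  assumes E: "elem_ab p H E" and D: "elem_ab p K D"
    and C: "elem_ab p H C"
    and phi: "bij_betw phi E D" "\<forall>x\<in>E. \<forall>y\<in>E. phi (x \<otimes>\<^bsub>H\<^esub> y) = phi x \<otimes>\<^bsub>K\<^esub> phi y"
      "\<forall>x\<in>E. \<forall>c r. H.label c x r \<longleftrightarrow> K.label c (phi x) r"
    and psi: "bij_betw psi D C" "\<forall>x\<in>D. \<forall>y\<in>D. psi (x \<otimes>\<^bsub>K\<^esub> y) = psi x \<otimes>\<^bsub>H\<^esub> psi y"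
      "\<forall>x\<in>D. \<forall>c r. K.label c x r \<longleftrightarrow> H.label c (psi x) r"
  shows "(\<lambda>x\<in>E. psi (phi x)) \<in> arr (quillen p H) E C"
    "(\<lambda>x\<in>C. inv_into E phi (inv_into D psi x)) \<in> arr (quillen p H) C E"
proof -
  have b: "bij_betw (\<lambda>x. psi (phi x)) E C"
    using bij_betw_trans[OF phi(1) psi(1)] by (simp add: comp_def)
  have phiD: "phi x \<in> D" if "x \<in> E" for x using bij_betwE[OF phi(1)] that by blast
  have "(\<lambda>x\<in>C. inv_into E phi (inv_into D psi x)) = (\<lambda>x\<in>C. inv_into E (\<lambda>x. psi (phi x)) x)"
    using inv_into_comp[of psi phi E] phi(1) psi(1)
    by (intro restrict_ext) (simp add: bij_betw_def comp_def)
  then show "(\<lambda>x\<in>E. psi (phi x)) \<in> arr (quillen p H) E C"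
    "(\<lambda>x\<in>C. inv_into E phi (inv_into D psi x)) \<in> arr (quillen p H) C E"
    using H.roundtrip_arrow[OF E C b] phi(2,3) psi(2,3) phiD by simp_all
qed

text \<open>Both functors choose label-preserving copies. Going there and back yields another
  label-preserving copy in the same group, which is isomorphic to the original one within the
  Quillen category by \<open>roundtrip\<close>.\<close>

theorem labelled_groups_equivalent:
  assumes "labelled_group H p w th K0 K1 K2 \<pi> bt lab" "labelled_group K p w th K0 K1 K2 \<pi>' bt' lab'"
  shows "equivalent_categories (quillen p H) (quillen p K)"
proof -
  interpret H: labelled_group H p w th K0 K1 K2 \<pi> bt lab by fact
  interpret K: labelled_group K p w th K0 K1 K2 \<pi>' bt' lab' by fact
  interpret HK: labelled_group_pair H K p w th K0 K1 K2 \<pi> bt lab \<pi>' bt' lab' ..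
  interpret KH: labelled_group_pair K H p w th K0 K1 K2 \<pi>' bt' lab' \<pi> bt lab ..
  obtain F phi where F: "\<forall>E. elem_ab p H E \<longrightarrow>
    elem_ab p K (F E) \<and> bij_betw (phi E) E (F E) \<and>
    (\<forall>x\<in>E. \<forall>y\<in>E. phi E (x \<otimes>\<^bsub>H\<^esub> y) = phi E x \<otimes>\<^bsub>K\<^esub> phi E y) \<and>
    (\<forall>x\<in>E. \<forall>c r. H.label c x r \<longleftrightarrow> K.label c (phi E x) r)"
    using HK.match_choice by blast
  obtain G psi where G: "\<forall>E. elem_ab p K E \<longrightarrow>
    elem_ab p H (G E) \<and> bij_betw (psi E) E (G E) \<and>
    (\<forall>x\<in>E. \<forall>y\<in>E. psi E (x \<otimes>\<^bsub>K\<^esub> y) = psi E x \<otimes>\<^bsub>H\<^esub> psi E y) \<and>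
    (\<forall>x\<in>E. \<forall>c r. K.label c x r \<longleftrightarrow> H.label c (psi E x) r)"
    using KH.match_choice by blast
  have F': "elem_ab p K (F E)" "bij_betw (phi E) E (F E)"
    "\<forall>x\<in>E. \<forall>y\<in>E. phi E (x \<otimes>\<^bsub>H\<^esub> y) = phi E x \<otimes>\<^bsub>K\<^esub> phi E y"
    "\<forall>x\<in>E. \<forall>c r. H.label c x r \<longleftrightarrow> K.label c (phi E x) r"
    if "elem_ab p H E" for E
    using F[rule_format, OF that] by blast+
  have G': "elem_ab p H (G E)" "bij_betw (psi E) E (G E)"
    "\<forall>x\<in>E. \<forall>y\<in>E. psi E (x \<otimes>\<^bsub>K\<^esub> y) = psi E x \<otimes>\<^bsub>H\<^esub> psi E y"
    "\<forall>x\<in>E. \<forall>c r. K.label c x r \<longleftrightarrow> H.label c (psi E x) r"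
    if "elem_ab p K E" for E
    using G[rule_format, OF that] by blast+
  show ?thesis
  proof (rule quillen_equivalentI[of H K p F G phi psi, OF H.is_group K.is_group], unfold quillen_obj)
    show "transport (F E) (phi E) E (phi D) f \<in> arr (quillen p K) (F E) (F D)"
      if "elem_ab p H E" "elem_ab p H D"
        "f \<in> arr (quillen p H) E D" for E D f
      using that(3)
      by (rule HK.transport_arrow[OF that(1,2) F'(1)[OF that(1)] F'(1)[OF that(2)]
            F'(2-4)[OF that(1)] F'(2-4)[OF that(2)]])
    show "transport (G E) (psi E) E (psi D) f \<in> arr (quillen p H) (G E) (G D)"
      if "elem_ab p K E" "elem_ab p K D"
        "f \<in> arr (quillen p K) E D" for E D f
      using that(3)
      by (rule KH.transport_arrow[OF that(1,2) G'(1)[OF that(1)] G'(1)[OF that(2)]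
            G'(2-4)[OF that(1)] G'(2-4)[OF that(2)]])
  next
    fix E assume E: "elem_ab p H E"
    note rt = HK.roundtrip[OF E F'(1)[OF E] G'(1)[OF F'(1)[OF E]] F'(2-4)[OF E] G'(2-4)[OF F'(1)[OF E]]]
    show "(\<lambda>x\<in>E. psi (F E) (phi E x)) \<in> arr (quillen p H) E (G (F E))"
      "(\<lambda>x\<in>G (F E). inv_into E (phi E) (inv_into (F E) (psi (F E)) x))
        \<in> arr (quillen p H) (G (F E)) E" by (fact rt)+
  next
    fix E assume E: "elem_ab p K E"
    note rt = KH.roundtrip[OF E G'(1)[OF E] F'(1)[OF G'(1)[OF E]] G'(2-4)[OF E] F'(2-4)[OF G'(1)[OF E]]]
    show "(\<lambda>x\<in>E. phi (G E) (psi E x)) \<in> arr (quillen p K) E (F (G E))"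
      "(\<lambda>x\<in>F (G E). inv_into E (psi E) (inv_into (G E) (phi (G E)) x))
        \<in> arr (quillen p K) (F (G E)) E" by (fact rt)+
  qed (fact F'(1) G'(1) F'(2) G'(2))+
qed


section \<open>Groups presented by a filtered ring\<close>

text \<open>This models Z_p[theta] with its ideals \<open>J n\<close>, the powers of the maximal
  ideal, and the uniformiser \<open>kp\<close> = theta - 1. The intersection of the
  \<open>J n\<close> may be nonzero, which admits a polynomial ring as an instance.
  \<open>theta_w\<close> and \<open>p_kappa\<close> record the leading terms of theta^w - 1 and of
  p. The sign in \<open>p_kappa\<close> arises because the cyclotomic polynomial, congruent to
  \<open>kp ^ e\<close> + p up to higher order, vanishes at theta.\<close>

locale filtered_ring =
  fixes J :: "nat \<Rightarrow> 'r::comm_ring_1 set" and kp th :: 'r and p w e :: nat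
  assumes prime_p: "Factorial_Ring.prime p" and w_pos: "w > 0" and e_def: "e = (p - 1) * w"
    and J_0: "x \<in> J 0"
    and J_zero: "0 \<in> J n"
    and J_diff: "x \<in> J n \<Longrightarrow> y \<in> J n \<Longrightarrow> x - y \<in> J n"
    and J_prod: "x \<in> J m \<Longrightarrow> y \<in> J n \<Longrightarrow> x * y \<in> J (m + n)"
    and J_Suc: "x \<in> J (Suc n) \<Longrightarrow> x \<in> J n"
    and J_lift: "x \<in> J n \<Longrightarrow> \<exists>r. x - kp ^ n * r \<in> J N"
    and kappa_J: "kp \<in> J 1"
    and kappa_cancel: "kp * x \<in> J (Suc n) \<Longrightarrow> x \<in> J n"
    and theta_w: "th ^ w - 1 - kp ^ w \<in> J (Suc w)"
    and p_kappa: "of_nat p + kp ^ e \<in> J (Suc e)"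
    and trace: "(\<Sum>i<p. th ^ (w * i)) \<in> J n"
begin

lemma J_minus: "x \<in> J n \<Longrightarrow> - x \<in> J n"
  using J_diff[OF J_zero] by fastforce

lemma J_add: "x \<in> J n \<Longrightarrow> y \<in> J n \<Longrightarrow> x + y \<in> J n"
  using J_diff[of x n "- y"] J_minus by auto

lemma J_mono: "x \<in> J n \<Longrightarrow> m \<le> n \<Longrightarrow> x \<in> J m"
  by (induction n) (auto simp: le_Suc_eq dest: J_Suc)

lemma J_mult: "x \<in> J n \<Longrightarrow> r * x \<in> J n"
  using J_prod[of r 0 x n] J_0 by simp

lemma J_mult_right: "x \<in> J n \<Longrightarrow> x * r \<in> J n"
  using J_mult[of x n r] by (simp add: mult.commute[of x])

lemma J_add_iff: "y \<in> J n \<Longrightarrow> x + y \<in> J n \<longleftrightarrow> x \<in> J n"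
  using J_add J_diff by fastforce

lemma kappa_power_J: "kp ^ n \<in> J n"
  by (induction n) (use J_0 J_prod[OF kappa_J] in auto)

lemma kappa_power_iff: "kp ^ k * x \<in> J (k + n) \<longleftrightarrow> x \<in> J n"
proof
  show "kp ^ k * x \<in> J (k + n) \<Longrightarrow> x \<in> J n"
    by (induction k) (auto simp: mult.assoc dest: kappa_cancel)
qed (rule J_prod[OF kappa_power_J])

text \<open>u agrees with \<open>kp ^ k\<close> one level deeper than k. So if x is known to lie in
  \<open>J l\<close>, replacing u by \<open>kp ^ k\<close> costs a term in
  \<open>J (k + Suc l)\<close>, and cancelling \<open>kp ^ k\<close> puts x into
  \<open>J (Suc l)\<close>.\<close>

lemma unit_multiple_iff:
  assumes u: "u - kp ^ k \<in> J (Suc k)"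
  shows "u * x \<in> J (k + n) \<longleftrightarrow> x \<in> J n"
proof
  have uk: "u \<in> J k" using J_add[OF J_Suc[OF u] kappa_power_J[of k]] by simp
  show "u * x \<in> J (k + n)" if "x \<in> J n" using J_prod[OF uk that] .
  assume ux: "u * x \<in> J (k + n)"
  have "x \<in> J l" if "l \<le> n" for l
    using that
  proof (induction l)
    case (Suc l)
    have "u * x \<in> J (k + Suc l)" using J_mono[OF ux] Suc by simp
    moreover have "(u - kp ^ k) * x \<in> J (k + Suc l)" using J_prod[OF u] Suc by simp
    ultimately have "u * x - (u - kp ^ k) * x \<in> J (k + Suc l)" by (rule J_diff)
    then show ?case using kappa_power_iff[of k x "Suc l"] by (simp add: left_diff_distrib)
  qed (rule J_0)
  then show "x \<in> J n" by simp
qed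

lemma theta_w_iff: "(th ^ w - 1) * x \<in> J (w + n) \<longleftrightarrow> x \<in> J n"
  by (rule unit_multiple_iff[OF theta_w])

lemma p_multiple_iff: "of_nat p * x \<in> J (e + n) \<longleftrightarrow> x \<in> J n"
proof -
  have "- of_nat p - kp ^ e \<in> J (Suc e)" using J_minus[OF p_kappa] by simp
  from unit_multiple_iff[OF this, of x n] show ?thesis
    using J_minus[of "of_nat p * x" "e + n"] J_minus[of "- (of_nat p * x)" "e + n"] by auto
qed

lemma p_gt_1: "p > 1" using prime_gt_1_nat[OF prime_p] .

lemma w_le_e: "w \<le> e"
proof -
  have "1 * w \<le> (p - 1) * w" using p_gt_1 by (intro mult_right_mono) auto
  then show ?thesis by (simp add: e_def)
qed

lemma theta_q: "th ^ (p * w) - 1 \<in> J n"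
proof -
  have "th ^ (p * w) - 1 = (th ^ w - 1) * (\<Sum>i<p. th ^ (w * i))"
    using power_diff_1_eq[of "th ^ w" p] by (simp add: mult.commute flip: power_mult)
  then show ?thesis using J_mult[OF trace] by simp
qed

lemma theta_power_mod: "th ^ (i mod (p * w)) - th ^ i \<in> J n"
proof -
  have "th ^ (p * w * k + j) - th ^ j \<in> J n" for k j
  proof (induction k)
    case (Suc k)
    have eq: "th ^ (p * w * Suc k + j) - th ^ j =
        th ^ (p * w * k + j) * (th ^ (p * w) - 1) + (th ^ (p * w * k + j) - th ^ j)"
      by (simp add: algebra_simps power_add)
    show ?case unfolding eq by (rule J_add[OF J_mult[OF theta_q] Suc])
  qed (simp add: J_zero)
  from this[of "i div (p * w)" "i mod (p * w)"] J_minus show ?thesis by fastforce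
qed

end

text \<open>\<open>el x i\<close> stands for the pair of the class of \<open>x\<close> in \<open>J a / J (a + m)\<close> and the \<open>i\<close>-th power of a
  generator of the cyclic group of order \<open>q\<close>; the cocycle \<open>g\<close> is \<open>\<gamma>/2\<close> for the skeleton groups and 0
  for the main line groups.\<close>

locale presented_group = filtered_ring J kp th p w e
  for J :: "nat \<Rightarrow> 'r::comm_ring_1 set" and kp th p w e +
  fixes H :: "('a, 'm) monoid_scheme" (structure) and el :: "'r \<Rightarrow> nat \<Rightarrow> 'a" and a m q :: nat
    and g :: "'r \<Rightarrow> 'r \<Rightarrow> 'r"
  assumes q_def: "q = p * w" and m_ge: "e + w \<le> m"
    and carrier_eq: "carrier H = {el x i | x i. x \<in> J a \<and> i < q}"
    and el_eq: "x \<in> J a \<Longrightarrow> y \<in> J a \<Longrightarrow> i < q \<Longrightarrow> j < q \<Longrightarrow>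
      el x i = el y j \<longleftrightarrow> x - y \<in> J (a + m) \<and> i = j"
    and el_mult: "x \<in> J a \<Longrightarrow> y \<in> J a \<Longrightarrow> i < q \<Longrightarrow> j < q \<Longrightarrow>
      el x i \<otimes> el y j = el (x + th ^ i * y + g x (th ^ i * y)) ((i + j) mod q)"
    and el_one: "\<one> = el 0 0"
    and g_add_left: "g (x + y) z = g x z + g y z"
    and g_add_right: "g x (y + z) = g x y + g x z"
    and g_theta: "x \<in> J a \<Longrightarrow> y \<in> J a \<Longrightarrow> th * g x y - g (th * x) (th * y) \<in> J (a + m)"
    and g_assoc_left: "x \<in> J a \<Longrightarrow> y \<in> J a \<Longrightarrow> z \<in> J a \<Longrightarrow> g (g x y) z \<in> J (a + m)"
    and g_assoc_right: "x \<in> J a \<Longrightarrow> y \<in> J a \<Longrightarrow> z \<in> J a \<Longrightarrow> g x (g y z) \<in> J (a + m)"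
    and g_small_left: "x \<in> J (a + n) \<Longrightarrow> y \<in> J a \<Longrightarrow> g x y \<in> J (a + n + w + 1)"
    and g_small_right: "x \<in> J a \<Longrightarrow> y \<in> J (a + n) \<Longrightarrow> g x y \<in> J (a + n + w + 1)"
    and g_central_left: "x \<in> J (a + m - e) \<Longrightarrow> y \<in> J a \<Longrightarrow> g x y \<in> J (a + m)"
    and g_central_right: "x \<in> J a \<Longrightarrow> y \<in> J (a + m - e) \<Longrightarrow> g x y \<in> J (a + m)"
    and g_omega: "x \<in> J a \<Longrightarrow> g (th ^ (w * i) * x) (th ^ (w * j) * x) \<in> J (a + m)"
begin

lemma q_pos: "q > 0" using p_gt_1 w_pos by (simp add: q_def)

lemma w_lt_q: "w < q" using p_gt_1 w_pos by (simp add: q_def)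

lemma g_zero: "g 0 x = 0" "g x 0 = 0"
  using g_add_left[of 0 0 x] g_add_right[of x 0 0] by auto

lemma g_minus_left: "g (- x) y = - g x y"
  using g_add_left[of x "- x" y] by (simp add: g_zero eq_neg_iff_add_eq_0 add.commute)

lemma g_minus_right: "g x (- y) = - g x y"
  using g_add_right[of x y "- y"] by (simp add: g_zero eq_neg_iff_add_eq_0 add.commute)


lemma g_diff_right: "g x (y - z) = g x y - g x z"
  using g_add_right[of x y "- z"] by (simp add: g_minus_right)

lemma g_closed: "x \<in> J a \<Longrightarrow> y \<in> J a \<Longrightarrow> g x y \<in> J a"
  using g_small_left[of x 0 y] J_mono by simp


lemma g_null_right: "x \<in> J a \<Longrightarrow> y \<in> J (a + m) \<Longrightarrow> g x y \<in> J (a + m)"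
  by (rule g_central_right[OF _ J_mono]) auto

lemma g_theta_power:
  assumes "x \<in> J a" "y \<in> J a"
  shows "th ^ i * g x y - g (th ^ i * x) (th ^ i * y) \<in> J (a + m)"
proof (induction i)
  case (Suc i)
  have "th ^ Suc i * g x y - g (th ^ Suc i * x) (th ^ Suc i * y) =
      th * (th ^ i * g x y - g (th ^ i * x) (th ^ i * y)) +
      (th * g (th ^ i * x) (th ^ i * y) - g (th * (th ^ i * x)) (th * (th ^ i * y)))"
    by (simp add: algebra_simps)
  then show ?case
    using J_add[OF J_mult[OF Suc] g_theta[OF J_mult J_mult]] assms by simp
qed (simp add: J_zero)

lemma el_closed: "x \<in> J a \<Longrightarrow> i < q \<Longrightarrow> el x i \<in> carrier H"
  by (auto simp: carrier_eq)

lemma el_eqI: "x \<in> J a \<Longrightarrow> y \<in> J a \<Longrightarrow> i = j \<Longrightarrow> j < q \<Longrightarrow> x - y \<in> J (a + m) \<Longrightarrow> el x i = el y j"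
  by (simp add: el_eq)

text \<open>The two bracketings differ by the nested terms g (g x y') z and g x (g y' z'), which are
  trivial modulo \<open>J (a + m)\<close>, and by two kinds of error: d comes from reducing
  exponents modulo q, and h from the fact that g commutes with theta only modulo
  \<open>J (a + m)\<close>.\<close>

lemma el_assoc:
  assumes x: "x \<in> J a" and y: "y \<in> J a" and z: "z \<in> J a" and i: "i < q" and j: "j < q" and k: "k < q"
  shows "el x i \<otimes> el y j \<otimes> el z k = el x i \<otimes> (el y j \<otimes> el z k)"
proof -
  define s where "s = (i + j) mod q"
  define d where "d = th ^ s - th ^ (i + j)"
  define y' z' where "y' = th ^ i * y" and "z' = th ^ (i + j) * z"
  define u v where "u = x + y' + g x y'" and "v = y + th ^ j * z + g y (th ^ j * z)"
  have d: "d \<in> J n" for n unfolding d_def s_def q_def by (rule theta_power_mod)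
  have y': "y' \<in> J a" and z': "z' \<in> J a" unfolding y'_def z'_def using y z J_mult by auto
  have u: "u \<in> J a" and v: "v \<in> J a" unfolding u_def v_def
    using x y z y' J_mult[OF z] by (auto intro: J_add g_closed)
  have ts: "th ^ s * z = z' + d * z" by (simp add: d_def z'_def algebra_simps)
  have iv: "th ^ i * v = y' + z' + th ^ i * g y (th ^ j * z)"
    by (simp add: v_def y'_def z'_def algebra_simps power_add)
  define h where "h = th ^ i * g y (th ^ j * z) - g y' z'"
  have h: "h \<in> J (a + m)"
    using g_theta_power[OF y J_mult[OF z], of i "th ^ j"]
    by (simp add: h_def y'_def z'_def algebra_simps power_add)
  have ih: "th ^ i * g y (th ^ j * z) = g y' z' + h" by (simp add: h_def)
  have "u + th ^ s * z + g u (th ^ s * z) - (x + th ^ i * v + g x (th ^ i * v)) =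
      (d * z + g x (d * z)) + (g y' (d * z) + g (g x y') (th ^ s * z)) - (h + (g x (g y' z') + g x h))"
    unfolding ts iv ih u_def by (simp add: g_add_left g_add_right algebra_simps)
  moreover have "\<dots> \<in> J (a + m)"
    using x y' z z' h d
    by (intro J_diff J_add J_mult_right[OF d] g_null_right g_assoc_left g_assoc_right J_mult)
  ultimately have eq: "u + th ^ s * z + g u (th ^ s * z) - (x + th ^ i * v + g x (th ^ i * v)) \<in> J (a + m)"
    by simp
  have sq: "s < q" using q_pos by (simp add: s_def)
  have L: "el x i \<otimes> el y j \<otimes> el z k = el (u + th ^ s * z + g u (th ^ s * z)) ((s + k) mod q)"
    using x y i j el_mult[OF u z sq k] by (simp add: el_mult s_def u_def y'_def)
  have "el x i \<otimes> (el y j \<otimes> el z k) = el x i \<otimes> el v ((j + k) mod q)"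
    using y z j k by (simp add: el_mult v_def)
  also have "\<dots> = el (x + th ^ i * v + g x (th ^ i * v)) ((i + (j + k) mod q) mod q)"
    using x v i q_pos by (simp add: el_mult)
  finally have R: "el x i \<otimes> (el y j \<otimes> el z k) =
      el (x + th ^ i * v + g x (th ^ i * v)) ((i + (j + k) mod q) mod q)" .
  show ?thesis
    unfolding L R
  proof (rule el_eqI[OF _ _ _ _ eq])
    show "(s + k) mod q = (i + (j + k) mod q) mod q" by (simp add: s_def mod_simps add.assoc)
  qed (use u v x z q_pos in \<open>auto intro!: J_add J_mult g_closed\<close>)
qed

lemma group_H: "group H"
proof (rule groupI)
  show "\<one> \<in> carrier H" using el_closed[OF J_zero q_pos] by (simp add: el_one)
  fix h assume "h \<in> carrier H"
  then obtain x i where h: "h = el x i" "x \<in> J a" "i < q" by (auto simp: carrier_eq)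
  have "0 + th ^ 0 * x + g 0 (th ^ 0 * x) = x" "(0 + i) mod q = i" using h by (simp_all add: g_zero)
  then show "\<one> \<otimes> h = h" using el_mult[OF J_zero h(2) q_pos h(3)] by (simp add: h(1) el_one)
  show "\<exists>k\<in>carrier H. k \<otimes> h = \<one>"
  proof (rule bexI)
    \<comment> \<open>The left inverse has exponent -i modulo q, and its translation part cancels x
      up to the value of g on (z, z), which is trivial by \<open>g_omega\<close> with both exponents
      0.\<close>
    define j where "j = (q - i) mod q"
    define z where "z = th ^ j * x"
    have z: "z \<in> J a" unfolding z_def by (rule J_mult[OF h(2)])
    have j: "j < q" using q_pos by (simp add: j_def)
    show "el (- z) j \<in> carrier H" using J_minus[OF z] j by (rule el_closed)
    have "(j + i) mod q = 0" using h(3) by (simp add: j_def mod_simps)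
    then have "el (- z) j \<otimes> h = el (- g z z) 0"
      using el_mult[OF J_minus[OF z] h(2) j h(3)] by (simp add: h(1) z_def g_minus_left)
    also have "\<dots> = \<one>" unfolding el_one
      using g_omega[OF z, of 0 0] J_minus J_minus[OF g_closed[OF z z]] J_zero q_pos
      by (intro el_eqI) auto
    finally show "el (- z) j \<otimes> h = \<one>" .
  qed
  fix h' assume "h' \<in> carrier H"
  then obtain y j where h': "h' = el y j" "y \<in> J a" "j < q" by (auto simp: carrier_eq)
  show "h \<otimes> h' \<in> carrier H"
    using h h' q_pos by (auto simp: el_mult intro!: el_closed J_add J_mult g_closed)
  fix h'' assume "h'' \<in> carrier H"
  then obtain z k where h'': "h'' = el z k" "z \<in> J a" "k < q" by (auto simp: carrier_eq)
  show "h \<otimes> h' \<otimes> h'' = h \<otimes> (h' \<otimes> h'')"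
    using h h' h'' el_assoc by simp
qed

sublocale group H by (rule group_H)

section \<open>Labels in a presented group\<close>

definition proj :: "'a \<Rightarrow> int" where
  "proj h = int (SOME i. \<exists>x\<in>J a. i < q \<and> h = el x i)"

definition beta :: "'r \<Rightarrow> 'a" where
  "beta r = el (kp ^ (a + m - e) * r) 0"

text \<open>The label is x divided by \<open>kp ^ a\<close>. It is taken modulo \<open>J w\<close>,
  since conjugation by translations changes x within its class modulo
  \<open>J (a + w)\<close>.\<close>

definition lab :: "'a \<Rightarrow> 'r \<Rightarrow> bool" where
  "lab h r \<longleftrightarrow> (\<exists>x\<in>J a. h = el x w \<and> x - kp ^ a * r \<in> J (a + w))"

lemma proj_el:
  assumes "x \<in> J a" "i < q"
  shows "proj (el x i) = int i"
proof -
  have "(SOME j. \<exists>y\<in>J a. j < q \<and> el x i = el y j) = i"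
    using assms J_zero by (intro some_equality) (auto simp: el_eq intro!: bexI[of _ x])
  then show ?thesis by (simp add: proj_def)
qed

lemma elE:
  assumes "h \<in> carrier H"
  obtains x i where "x \<in> J a" "i < q" "h = el x i" "proj h = int i"
  using assms proj_el by (auto simp: carrier_eq)

lemma el_w_E:
  assumes "h \<in> carrier H" "proj h = int i"
  obtains x where "x \<in> J a" "h = el x i"
  using assms by (metis elE of_nat_eq_iff)

text \<open>p has valuation e, so the translations of order dividing p are the classes of
  \<open>J (a + m - e)\<close>. The bound \<open>m_ge\<close> puts this ideal inside
  \<open>J (a + w)\<close>, which makes the labels over w insensitive to factors from it.\<close>

abbreviation "socle_exp \<equiv> a + m - e"

lemma socle_exp: "socle_exp + e = a + m" "a \<le> socle_exp" "a + w \<le> socle_exp"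
  "socle_exp + (e - w) + w = a + m"
  using m_ge w_le_e by auto

lemma socle_J: "kp ^ socle_exp * r \<in> J socle_exp" "kp ^ socle_exp * r \<in> J a" "kp ^ socle_exp * r \<in> J (a + w)"
  using J_mult_right[OF kappa_power_J] J_mono socle_exp by blast+

lemma beta_closed: "beta r \<in> carrier H"
  unfolding beta_def by (rule el_closed[OF socle_J(2) q_pos])

lemma el_mult_beta:
  assumes x: "x \<in> J a" and i: "i < q"
  shows "el x i \<otimes> beta r = el (x + th ^ i * (kp ^ socle_exp * r)) i"
proof -
  have "g x (th ^ i * (kp ^ socle_exp * r)) \<in> J (a + m)"
    by (rule g_central_right[OF x J_mult[OF socle_J(1)]])
  then show ?thesis
    unfolding beta_def el_mult[OF x socle_J(2) i q_pos]
    using x i J_mono[of _ "a + m" a]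
    by (intro el_eqI) (simp_all add: J_add J_mult socle_J(2))
qed

lemma beta_mult_el:
  assumes x: "x \<in> J a" and i: "i < q"
  shows "beta r \<otimes> el x i = el (x + kp ^ socle_exp * r) i"
proof -
  have "g (kp ^ socle_exp * r) x \<in> J (a + m)"
    by (rule g_central_left[OF socle_J(1) x])
  then show ?thesis
    unfolding beta_def el_mult[OF socle_J(2) x q_pos i]
    using x i J_mono[of _ "a + m" a]
    by (intro el_eqI) (simp_all add: J_add J_mult socle_J(2) add.commute[of x])
qed


lemma beta_add: "beta (r + s) = beta r \<otimes> beta s"
  using beta_mult_el[OF socle_J(2) q_pos, of r s] by (simp add: beta_def algebra_simps)

lemma beta_one: "beta r = \<one> \<longleftrightarrow> r \<in> J e"
  using kappa_power_iff[of socle_exp r e] socle_J(2) q_pos J_zero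
  by (simp add: beta_def el_one el_eq socle_exp)

lemma g_sum_left: "(\<And>i. i < n \<Longrightarrow> g (f i) y \<in> J (a + m)) \<Longrightarrow> g (\<Sum>i<(n::nat). f i) y \<in> J (a + m)"
  by (induction n) (auto simp: g_zero J_zero g_add_left intro: J_add)

lemma J_sum: "(\<And>i. i < n \<Longrightarrow> f i \<in> J k) \<Longrightarrow> (\<Sum>i<(n::nat). f i) \<in> J k"
  by (induction n) (auto simp: J_zero intro: J_add)

text \<open>The cases c = 0 and c = 1 treat the translations and the elements over w together. All
  contributions of g are sums of its values on two multiples of the same x by powers of theta^w, and
  these are trivial by \<open>g_omega\<close>.\<close>

lemma el_power:
  assumes x: "x \<in> J a" and c: "c = 0 \<or> c = 1"
  shows "el x (w * c) [^] (n::nat) = el (\<Sum>i<n. th ^ (w * (c * i)) * x) ((w * c * n) mod q)"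
proof (induction n)
  case (Suc n)
  let ?X = "\<Sum>i<n. th ^ (w * (c * i)) * x" and ?s = "(w * c * n) mod q"
  have X: "?X \<in> J a" using x by (intro J_sum J_mult)
  have s: "?s < q" "w * c < q" using q_pos w_lt_q c by auto
  have d: "(th ^ ?s - th ^ (w * c * n)) * x \<in> J (a + m)"
    unfolding q_def by (rule J_mult_right[OF theta_power_mod])
  have "g ?X (th ^ (w * c * n) * x) \<in> J (a + m)"
    using g_omega[OF x] by (intro g_sum_left) (simp add: mult.assoc)
  moreover have "g ?X ((th ^ ?s - th ^ (w * c * n)) * x) \<in> J (a + m)" by (rule g_null_right[OF X d])
  ultimately have "g ?X (th ^ (w * c * n) * x) + g ?X ((th ^ ?s - th ^ (w * c * n)) * x) \<in> J (a + m)"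
    by (rule J_add)
  then have gs: "g ?X (th ^ ?s * x) \<in> J (a + m)"
    by (simp add: left_diff_distrib g_diff_right)
  have "el x (w * c) [^] Suc n = el ?X ?s \<otimes> el x (w * c)" using Suc by simp
  also have "\<dots> = el (?X + th ^ ?s * x + g ?X (th ^ ?s * x)) ((?s + w * c) mod q)"
    by (rule el_mult[OF X x s])
  also have "\<dots> = el (\<Sum>i<Suc n. th ^ (w * (c * i)) * x) ((w * c * Suc n) mod q)"
  proof (rule el_eqI)
    have eq: "?X + th ^ ?s * x + g ?X (th ^ ?s * x) - (\<Sum>i<Suc n. th ^ (w * (c * i)) * x) =
      (th ^ ?s - th ^ (w * c * n)) * x + g ?X (th ^ ?s * x)"
      by (simp add: algebra_simps)
    show "?X + th ^ ?s * x + g ?X (th ^ ?s * x) - (\<Sum>i<Suc n. th ^ (w * (c * i)) * x) \<in> J (a + m)"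
      unfolding eq by (rule J_add[OF d gs])
    show "?X + th ^ ?s * x + g ?X (th ^ ?s * x) \<in> J a"
      using X x J_mono[OF gs] by (auto intro!: J_add J_mult)
    show "(\<Sum>i<Suc n. th ^ (w * (c * i)) * x) \<in> J a" using x by (intro J_sum J_mult)
    show "(?s + w * c) mod q = (w * c * Suc n) mod q" by (simp add: mod_simps algebra_simps)
  qed (use q_pos in simp)
  finally show ?case .
qed (simp add: el_one)

text \<open>The translation part of the p-th power is x times the sum of the powers of theta^w,
  which \<open>trace\<close> places in every \<open>J n\<close>.\<close>

lemma el_w_power_p:
  assumes x: "x \<in> J a"
  shows "el x w [^] p = \<one>"
proof -
  have "(\<Sum>i<p. th ^ (w * i) * x) \<in> J (a + m)"
    using J_mult_right[OF trace, of "x"] by (simp add: sum_distrib_right)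
  then show ?thesis
    using el_power[OF x, of 1 p] J_mono[of _ "a + m" a] J_zero q_pos
    by (auto simp: el_one q_def mult.commute intro!: el_eqI)
qed

lemma el_0_power_p:
  assumes x: "x \<in> J a"
  shows "el x 0 [^] p = \<one> \<longleftrightarrow> x \<in> J socle_exp"
proof -
  have "el x 0 [^] p = el (of_nat p * x) 0" using el_power[OF x, of 0 p] by simp
  then show ?thesis
    using x J_zero q_pos p_multiple_iff[of x socle_exp] socle_exp
    by (simp add: el_one el_eq J_mult add.commute)
qed

lemma beta_surj:
  assumes "h \<in> carrier H" "proj h = 0" "h [^] p = \<one>"
  shows "\<exists>r. h = beta r"
proof -
  obtain x where x: "x \<in> J a" "h = el x 0" using assms el_w_E[of h 0] by auto
  then have "x \<in> J socle_exp" using assms(3) el_0_power_p by simp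
  then obtain r where "x - kp ^ socle_exp * r \<in> J (a + m)" using J_lift by blast
  then have "h = beta r"
    unfolding x(2) beta_def using x(1) socle_J(2) q_pos by (intro el_eqI) auto
  then show ?thesis ..
qed

lemma lab_el:
  assumes "x \<in> J a"
  shows "lab (el x w) r \<longleftrightarrow> x - kp ^ a * r \<in> J (a + w)"
proof
  assume "lab (el x w) r"
  then obtain y where y: "y \<in> J a" "el x w = el y w" "y - kp ^ a * r \<in> J (a + w)"
    by (auto simp: lab_def)
  then have "x - y \<in> J (a + w)"
    using assms w_lt_q m_ge by (auto simp: el_eq intro: J_mono)
  from J_add[OF this y(3)] show "x - kp ^ a * r \<in> J (a + w)" by simp
qed (use assms in \<open>auto simp: lab_def\<close>)

text \<open>Translations centralise the elements \<open>beta r\<close>, so only the exponent i acts.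
  Allowing any j congruent to i modulo q provides every power of theta as a multiplier, although
  exponents in the group are reduced.\<close>

lemma conj_beta:
  assumes y: "y \<in> J a" and i: "i < q" and ij: "j mod q = i"
  shows "el y i \<otimes> beta r \<otimes> inv (el y i) = beta (th ^ j * r)"
proof -
  have d: "(th ^ i - th ^ j) * (kp ^ socle_exp * r) \<in> J (a + m)"
    using J_mult_right[OF theta_power_mod[of j]] ij by (simp add: q_def)
  have "el y i \<otimes> beta r = beta (th ^ j * r) \<otimes> el y i"
    unfolding el_mult_beta[OF y i] beta_mult_el[OF y i]
    using y i d by (intro el_eqI J_add J_mult socle_J) (auto simp: algebra_simps)
  then show ?thesis
    using el_closed[OF y i] beta_closed by (simp add: m_assoc)
qed

text \<open>Inverses are avoided by writing the conjugate as \<open>el t' k\<close> and comparing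
  both sides of h x = (h x h^-1) h. The exponents give k = w. In the translation parts y contributes
  (theta^w - 1) y, which lies in \<open>J (a + w)\<close>, as do both values of g; hence t' is
  congruent to theta^i t.\<close>

lemma conj_lab:
  assumes y: "y \<in> J a" and i: "i < q" and ij: "j mod q = i"
    and x: "x \<in> carrier H" "proj x = w" "lab x r"
  shows "lab (el y i \<otimes> x \<otimes> inv (el y i)) (th ^ j * r)"
proof -
  obtain t where t: "t \<in> J a" "x = el t w" using el_w_E[OF x(1,2)] .
  have tr: "t - kp ^ a * r \<in> J (a + w)" using x(3) t lab_el by simp
  let ?h = "el y i"
  have h: "?h \<in> carrier H" by (rule el_closed[OF y i])
  have "?h \<otimes> x \<otimes> inv ?h \<in> carrier H" using h x by simp
  then obtain t' k where t': "t' \<in> J a" "k < q" "?h \<otimes> x \<otimes> inv ?h = el t' k" using elE by metis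
  have "?h \<otimes> x = el t' k \<otimes> ?h" using h x(1) by (simp add: m_assoc flip: t'(3))
  then have eq: "el (y + th ^ i * t + g y (th ^ i * t)) ((i + w) mod q) =
      el (t' + th ^ k * y + g t' (th ^ k * y)) ((k + i) mod q)"
    using y i t t' w_lt_q by (simp add: el_mult)
  have c: "y + th ^ i * t + g y (th ^ i * t) \<in> J a" "t' + th ^ k * y + g t' (th ^ k * y) \<in> J a"
    using y t(1) t'(1) by (auto intro!: J_add J_mult g_closed)
  have D: "y + th ^ i * t + g y (th ^ i * t) - (t' + th ^ k * y + g t' (th ^ k * y)) \<in> J (a + m)"
    and m: "(i + w) mod q = (k + i) mod q"
    using eq el_eq[OF c] q_pos by auto
  have sum_mod: "(i + l) mod q = (if i + l < q then i + l else i + l - q)" if "l < q" for l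
    using that i by (simp add: mod_if[of "i + l"])
  have k: "k = w"
    using m t'(2) w_lt_q i sum_mod[of w] sum_mod[of k] by (auto simp: add.commute split: if_splits)
  have 1: "th ^ i * (t - kp ^ a * r) \<in> J (a + w)" by (rule J_mult[OF tr])
  have 2: "(th ^ i - th ^ j) * (kp ^ a * r) \<in> J (a + w)"
    using J_mult_right[OF theta_power_mod[of j]] ij by (simp add: q_def)
  have 3: "g y (th ^ i * t) \<in> J (a + w)"
    using g_small_left[of y 0 "th ^ i * t"] y t J_mult by (auto intro: J_mono)
  have 4: "g t' (th ^ w * y) \<in> J (a + w)"
    using g_small_left[of t' 0 "th ^ w * y"] y t' J_mult by (auto intro: J_mono)
  have 5: "(th ^ w - 1) * y \<in> J (a + w)" using theta_w_iff[of y a] y by (simp add: add.commute)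
  have 6: "y + th ^ i * t + g y (th ^ i * t) - (t' + th ^ k * y + g t' (th ^ k * y)) \<in> J (a + w)"
    using J_mono[OF D] m_ge by simp
  have "t' - th ^ j * (kp ^ a * r) =
     th ^ i * (t - kp ^ a * r) + (th ^ i - th ^ j) * (kp ^ a * r) + (g y (th ^ i * t) - g t' (th ^ w * y))
     - (th ^ w - 1) * y - (y + th ^ i * t + g y (th ^ i * t) - (t' + th ^ k * y + g t' (th ^ k * y)))"
    by (simp add: k algebra_simps)
  moreover note J_diff[OF J_diff[OF J_add[OF J_add[OF 1 2] J_diff[OF 3 4]] 5] 6]
  ultimately have "t' - kp ^ a * (th ^ j * r) \<in> J (a + w)" by (simp only: mult.left_commute)
  then show ?thesis using lab_el[OF t'(1)] t'(3) k by simp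
qed

text \<open>Successive approximation of an element \<open>u\<close> that conjugates \<open>el t w\<close> to \<open>el t' w\<close>: the map
  to be inverted is additive in \<open>u\<close> with leading term \<open>(1 - \<theta>\<^sup>w) u\<close>.\<close>

lemma conjugate_approximation:
  assumes t: "t \<in> J a" and t': "t' \<in> J a" and tt': "t' - t \<in> J (a + w)"
  shows "\<exists>u\<in>J a. t' - t - ((1 - th ^ w) * u + g u t - g t' (th ^ w * u)) \<in> J (a + w + n)"
proof (induction n)
  case 0
  show ?case using tt' by (intro bexI[of _ 0] J_zero) (simp add: g_zero)
next
  case (Suc n)
  then obtain u where u: "u \<in> J a"
    and z: "t' - t - ((1 - th ^ w) * u + g u t - g t' (th ^ w * u)) \<in> J (a + w + n)" by blast
  define z where "z = t' - t - ((1 - th ^ w) * u + g u t - g t' (th ^ w * u))"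
  obtain r where r: "z - kp ^ (a + w + n) * r \<in> J (Suc (a + w + n))"
    using J_lift z unfolding z_def by blast
  \<comment> \<open>With this v the leading term of (1 - theta^w) v, namely -\<open>kp ^ w\<close>
    times v, cancels the leading term of the error z. The values of g at v already lie one level
    deeper, by \<open>g_small_left\<close> and \<open>g_small_right\<close>.\<close>
  define v where "v = - (kp ^ (a + n) * r)"
  have v: "v \<in> J (a + n)" unfolding v_def by (intro J_minus J_mult_right kappa_power_J)
  have va: "v \<in> J a" using J_mono[OF v] by simp
  have kv: "kp ^ (a + w + n) * r = - (kp ^ w * v)" by (simp add: v_def power_add ac_simps)
  have gv: "g t' (th ^ w * (u + v)) = g t' (th ^ w * u) + g t' (th ^ w * v)"
    by (simp only: distrib_left g_add_right)
  have 1: "z - kp ^ (a + w + n) * r \<in> J (a + w + Suc n)" using r by simp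
  have 2: "(th ^ w - 1 - kp ^ w) * v \<in> J (a + w + Suc n)"
    using J_prod[OF theta_w v] by (simp add: algebra_simps)
  have 3: "g v t \<in> J (a + w + Suc n)" using g_small_left[OF v t] by (simp add: algebra_simps)
  have 4: "g t' (th ^ w * v) \<in> J (a + w + Suc n)"
    using g_small_right[OF t' J_mult[OF v, of "th ^ w"]] by (simp add: algebra_simps)
  have "t' - t - ((1 - th ^ w) * (u + v) + g (u + v) t - g t' (th ^ w * (u + v))) =
      (z - kp ^ (a + w + n) * r) + (th ^ w - 1 - kp ^ w) * v - g v t + g t' (th ^ w * v)"
    unfolding kv gv g_add_left z_def by (simp add: algebra_simps)
  moreover note J_add[OF J_diff[OF J_add[OF 1 2] 3] 4]
  ultimately show ?case by (intro bexI[OF _ J_add[OF u va]]) (simp only:)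
qed

text \<open>Equal labels mean that t' - t lies in \<open>J (a + w)\<close>, where the approximation
  applies; m rounds of it give an exact solution modulo \<open>J (a + m)\<close>. The resulting
  conjugating element is a translation, so it fixes every \<open>beta s\<close>.\<close>

lemma lab_conj:
  assumes x: "x \<in> carrier H" "proj x = w" "lab x r" and y: "y \<in> carrier H" "proj y = w" "lab y r"
  shows "\<exists>h\<in>carrier H. (\<forall>s. h \<otimes> beta s \<otimes> inv h = beta s) \<and> h \<otimes> x \<otimes> inv h = y"
proof -
  obtain t where t: "t \<in> J a" "x = el t w" using el_w_E[OF x(1,2)] .
  obtain t' where t': "t' \<in> J a" "y = el t' w" using el_w_E[OF y(1,2)] .
  have "(t' - kp ^ a * r) - (t - kp ^ a * r) \<in> J (a + w)"
    by (rule J_diff) (use x(3) y(3) t t' in \<open>simp_all add: lab_el\<close>)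
  then have tt': "t' - t \<in> J (a + w)" by simp
  obtain u where u: "u \<in> J a"
    and F: "t' - t - ((1 - th ^ w) * u + g u t - g t' (th ^ w * u)) \<in> J (a + w + m)"
    using conjugate_approximation[OF t(1) t'(1) tt'] by blast
  have "el u 0 \<otimes> x = y \<otimes> el u 0"
    unfolding t(2) t'(2) el_mult[OF u t(1) q_pos w_lt_q] el_mult[OF t'(1) u w_lt_q q_pos]
  proof (rule el_eqI)
    have eq: "u + th ^ 0 * t + g u (th ^ 0 * t) - (t' + th ^ w * u + g t' (th ^ w * u)) =
       - (t' - t - ((1 - th ^ w) * u + g u t - g t' (th ^ w * u)))"
      by (simp add: algebra_simps)
    show "u + th ^ 0 * t + g u (th ^ 0 * t) - (t' + th ^ w * u + g t' (th ^ w * u)) \<in> J (a + m)"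
      unfolding eq by (rule J_mono[OF J_minus[OF F]]) simp
  qed (use u t t' q_pos in \<open>auto intro!: J_add J_mult g_closed\<close>)
  then have "el u 0 \<otimes> x \<otimes> inv (el u 0) = y"
    using x y el_closed[OF u q_pos] by (simp add: m_assoc)
  moreover have "\<forall>s. el u 0 \<otimes> beta s \<otimes> inv (el u 0) = beta s"
    using conj_beta[OF u q_pos, of 0] by simp
  ultimately show ?thesis using el_closed[OF u q_pos] by blast
qed

text \<open>The set \<open>J (e - w)\<close> arises as follows: \<open>beta r\<close> commutes with
  an element over w if and only if theta^w - 1 maps the translation part of \<open>beta r\<close>
  into \<open>J (a + m)\<close>; this part has depth a + m - e, and theta^w - 1 raises the level by
  exactly w.\<close>

theorem labelled: "labelled_group H p (int w) th (J (e - w)) (J e) (J w) proj beta lab"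
proof
  show "Factorial_Ring.prime p" by (rule prime_p)
  show "int w > 0" using w_pos by simp
  show "proj x \<in> {0..<int p * int w}" if x: "x \<in> carrier H" for x
  proof -
    obtain s i where "i < q" "proj x = int i" using elE[OF x] by metis
    then show ?thesis by (simp add: q_def flip: of_nat_mult)
  qed
  show "proj (x \<otimes> y) = (proj x + proj y) mod (int p * int w)" if xy: "x \<in> carrier H" "y \<in> carrier H" for x y
  proof -
    obtain s i where s: "s \<in> J a" "i < q" "x = el s i" using elE[OF xy(1)] .
    obtain t j where t: "t \<in> J a" "j < q" "y = el t j" using elE[OF xy(2)] .
    have "s + th ^ i * t + g s (th ^ i * t) \<in> J a" using s t by (auto intro!: J_add J_mult g_closed)
    moreover have "int p * int w = int q" by (simp add: q_def)
    ultimately show ?thesis using s t q_pos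
      by (simp add: el_mult proj_el zmod_int)
  qed
  show "beta r \<in> carrier H" for r by (rule beta_closed)
  show "proj (beta r) = 0" for r using proj_el[OF socle_J(2) q_pos] by (simp add: beta_def)
  show "beta (r + s) = beta r \<otimes> beta s" for r s by (rule beta_add)
  show "beta r = \<one> \<longleftrightarrow> r \<in> J e" for r by (rule beta_one)
  show "\<exists>r. x = beta r" if "x \<in> carrier H" "proj x = 0" "x [^] p = \<one>" for x
    using that by (rule beta_surj)
  show "\<exists>x\<in>carrier H. proj x = int w \<and> lab x r" for r
  proof -
    have "kp ^ a * r \<in> J a" by (intro J_mult_right kappa_power_J)
    then show ?thesis using w_lt_q J_zero
      by (intro bexI[of _ "el (kp ^ a * r) w"]) (auto simp: proj_el lab_el el_closed)
  qed
  show "\<exists>h\<in>carrier H. (\<forall>r. h \<otimes> beta r \<otimes> inv h = beta (th ^ i * r)) \<and>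
      (\<forall>x r. x \<in> carrier H \<longrightarrow> proj x = int w \<longrightarrow> lab x r \<longrightarrow> lab (h \<otimes> x \<otimes> inv h) (th ^ i * r))" for i
    using conj_beta[OF J_zero, of "i mod q" i] conj_lab[OF J_zero, of "i mod q" i] q_pos
      el_closed[OF J_zero, of "i mod q"] by auto
  show "\<exists>i::nat. (\<forall>r. h \<otimes> beta r \<otimes> inv h = beta (th ^ i * r)) \<and>
      (\<forall>x r. x \<in> carrier H \<longrightarrow> proj x = int w \<longrightarrow> lab x r \<longrightarrow> lab (h \<otimes> x \<otimes> inv h) (th ^ i * r))"
    if h: "h \<in> carrier H" for h
  proof -
    obtain y i where y: "y \<in> J a" "i < q" "h = el y i" using elE[OF h] .
    then show ?thesis using conj_beta[OF y(1,2), of i] conj_lab[OF y(1,2), of i] by auto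
  qed
  fix x assume x: "x \<in> carrier H" "proj x = int w"
  obtain t where t: "t \<in> J a" "x = el t w" using el_w_E[OF x] .
  show "x [^] p = \<one>" using el_w_power_p t by simp
  show "\<exists>r. lab x r" using J_lift[OF t(1)] lab_el[OF t(1)] t(2) by simp
  show "lab (beta s \<otimes> x) r \<longleftrightarrow> lab x r" for s r
  proof -
    have "t + kp ^ socle_exp * s \<in> J a" using t(1) socle_J(2) by (rule J_add)
    then show ?thesis
      using J_add_iff[OF socle_J(3)[of s], of "t - kp ^ a * r"] t w_lt_q
      by (simp add: beta_mult_el lab_el algebra_simps)
  qed
  show "beta r \<otimes> x = x \<otimes> beta r \<longleftrightarrow> r \<in> J (e - w)" for r
  proof -
    have c: "t + kp ^ socle_exp * r \<in> J a" "t + th ^ w * (kp ^ socle_exp * r) \<in> J a"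
      using t(1) by (simp_all add: J_add J_mult socle_J(2))
    have "beta r \<otimes> x = x \<otimes> beta r \<longleftrightarrow> (th ^ w - 1) * (kp ^ socle_exp * r) \<in> J (a + m)"
      unfolding t(2) beta_mult_el[OF t(1) w_lt_q] el_mult_beta[OF t(1) w_lt_q] el_eq[OF c w_lt_q w_lt_q]
      using J_minus[of "(th ^ w - 1) * (kp ^ socle_exp * r)" "a + m"]
        J_minus[of "- ((th ^ w - 1) * (kp ^ socle_exp * r))" "a + m"]
      by (auto simp: algebra_simps)
    then show ?thesis
      using theta_w_iff[of "kp ^ socle_exp * r" "socle_exp + (e - w)"] kappa_power_iff[of socle_exp r "e - w"]
        socle_exp(4) by (simp add: add.commute)
  qed
  show "lab x r \<Longrightarrow> lab x s \<longleftrightarrow> s - r \<in> J w" for r s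
  proof -
    assume "lab x r"
    then have "t - kp ^ a * r \<in> J (a + w)" using t lab_el by simp
    then have "(t - kp ^ a * r) - kp ^ a * (s - r) \<in> J (a + w) \<longleftrightarrow> kp ^ a * (s - r) \<in> J (a + w)"
      using J_diff by fastforce
    moreover have "(t - kp ^ a * r) - kp ^ a * (s - r) = t - kp ^ a * s" by (simp add: right_diff_distrib)
    ultimately show ?thesis unfolding t(2) lab_el[OF t(1)] kappa_power_iff by simp
  qed
  fix y r assume "y \<in> carrier H" "proj y = int w" "lab x r" "lab y r"
  then show "\<exists>h\<in>carrier H. (\<forall>s. h \<otimes> beta s \<otimes> inv h = beta s) \<and> h \<otimes> x \<otimes> inv h = y"
    using x by (intro lab_conj)
qed

end

theorem presented_groups_equivalent:
  assumes "presented_group J kp th p w e H el a m q g" "presented_group J kp th p w e K el' a' m' q' g'"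
  shows "equivalent_categories (quillen p H) (quillen p K)"
  using labelled_groups_equivalent[OF presented_group.labelled[OF assms(1)]
    presented_group.labelled[OF assms(2)]] .


section \<open>The filtration of \<open>\<int>[\<theta>]\<close>\<close>

text \<open>Integer polynomials stand for their values at \<open>\<theta>\<close>; \<open>cyc_filt p w n\<close> is the
  preimage in \<open>\<int>[X]\<close> of the \<open>n\<close>-th power of the ideal generated by \<open>\<theta> - 1\<close>.\<close>

abbreviation polyX :: "int poly" where "polyX \<equiv> [:0, 1:]"

definition kap :: "int poly" where "kap = polyX - 1"

text \<open>When w is a power of the prime p, this is the cyclotomic polynomial of level pw.\<close>

definition cyc_poly :: "nat \<Rightarrow> nat \<Rightarrow> int poly" where
  "cyc_poly p w = (\<Sum>i<p. polyX ^ (w * i))"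

definition cyc_filt :: "nat \<Rightarrow> nat \<Rightarrow> nat \<Rightarrow> int poly set" where
  "cyc_filt p w n = {f. \<exists>a b. f = a * kap ^ n + b * cyc_poly p w}"

lemma cyc_filtI: "f = a * kap ^ n + b * cyc_poly p w \<Longrightarrow> f \<in> cyc_filt p w n"
  by (auto simp: cyc_filt_def)

lemma poly_cyc_poly_1: "poly (cyc_poly p w) 1 = int p"
  by (simp add: cyc_poly_def poly_sum)

lemma poly_kap_1: "poly kap 1 = 0"
  by (simp add: kap_def)

lemma kap_dvd_iff: "kap dvd f \<longleftrightarrow> poly f 1 = 0"
proof -
  have "kap = [:- 1, 1:]" by (simp add: kap_def one_pCons)
  then show ?thesis by (simp add: poly_eq_0_iff_dvd)
qed

lemma cyc_filt_diff:
  assumes "x \<in> cyc_filt p w n" "y \<in> cyc_filt p w n"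
  shows "x - y \<in> cyc_filt p w n"
proof -
  obtain a b c d where "x = a * kap ^ n + b * cyc_poly p w" "y = c * kap ^ n + d * cyc_poly p w"
    using assms by (auto simp: cyc_filt_def)
  then have "x - y = (a - c) * kap ^ n + (b - d) * cyc_poly p w" by (simp add: algebra_simps)
  then show ?thesis by (rule cyc_filtI)
qed

lemma cyc_filt_zero: "0 \<in> cyc_filt p w n"
  by (rule cyc_filtI[of _ 0 _ 0]) simp


lemma cyc_filt_mult:
  assumes "x \<in> cyc_filt p w m" "y \<in> cyc_filt p w n"
  shows "x * y \<in> cyc_filt p w (m + n)"
proof -
  obtain a b c d where "x = a * kap ^ m + b * cyc_poly p w" "y = c * kap ^ n + d * cyc_poly p w"
    using assms by (auto simp: cyc_filt_def)
  then have "x * y = (a * c) * kap ^ (m + n) +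
      (b * c * kap ^ n + a * kap ^ m * d + b * d * cyc_poly p w) * cyc_poly p w"
    by (simp add: algebra_simps power_add)
  then show ?thesis by (rule cyc_filtI)
qed

lemma cyc_filt_0: "x \<in> cyc_filt p w 0"
  by (rule cyc_filtI[of _ x _ 0]) simp

lemma cyc_filt_scale: "y \<in> cyc_filt p w n \<Longrightarrow> x * y \<in> cyc_filt p w n"
  using cyc_filt_mult[OF cyc_filt_0, of y p w n x] by simp

lemma cyc_poly_filtration: "cyc_poly p w \<in> cyc_filt p w n"
  by (rule cyc_filtI[of _ 0 _ 1]) simp

lemma kap_power_filtration: "kap ^ n \<in> cyc_filt p w n"
  by (rule cyc_filtI[of _ 1 _ 0]) simp

lemma cyc_filt_Suc:
  assumes "x \<in> cyc_filt p w (Suc n)"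
  shows "x \<in> cyc_filt p w n"
proof -
  obtain a b where "x = a * kap ^ Suc n + b * cyc_poly p w"
    using assms by (auto simp: cyc_filt_def)
  then have "x = (a * kap) * kap ^ n + b * cyc_poly p w" by (simp add: algebra_simps)
  then show ?thesis by (rule cyc_filtI)
qed

lemma cyc_filt_mono: "x \<in> cyc_filt p w n \<Longrightarrow> m \<le> n \<Longrightarrow> x \<in> cyc_filt p w m"
  by (induction n) (auto simp: le_Suc_eq dest: cyc_filt_Suc)

text \<open>Multiplication by \<open>\<theta> - 1\<close> is injective because the cyclotomic polynomial does not vanish
  at 1.\<close>

lemma kap_cancel:
  assumes "kap * x \<in> cyc_filt p w (Suc n)" and p: "p > 0"
  shows "x \<in> cyc_filt p w n"
proof -
  obtain a b where ab: "kap * x = a * kap ^ Suc n + b * cyc_poly p w"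
    using assms by (auto simp: cyc_filt_def)
  from arg_cong[OF this, of "\<lambda>f. poly f 1"] have "poly b 1 = 0"
    using p by (simp add: poly_kap_1 poly_cyc_poly_1)
  then obtain b' where b': "b = kap * b'" using kap_dvd_iff by (metis dvdE)
  have "kap * x = kap * (a * kap ^ n + b' * cyc_poly p w)"
    by (simp add: ab b' algebra_simps)
  moreover have "kap \<noteq> 0" by (simp add: kap_def one_pCons)
  ultimately have "x = a * kap ^ n + b' * cyc_poly p w" by (metis mult_left_cancel)
  then show ?thesis by (rule cyc_filtI)
qed

text \<open>Both equations are Frobenius congruences modulo p with explicit quotients s and t. The
  additional factor \<open>kap\<close> in \<open>X_w_eq\<close> pushes the error into level e + 1,
  which exceeds w even when e = w.\<close>

locale prime_power_cyc =
  fixes p w e :: nat and s t :: "int poly"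
  assumes prime_p: "Factorial_Ring.prime p" and w_pos: "w > 0" and e_def: "e = (p - 1) * w"
    and cyc_poly_eq: "cyc_poly p w = kap ^ e + of_nat p * s"
    and X_w_eq: "polyX ^ w - 1 = kap ^ w + of_nat p * kap * t"
begin

lemma p_gt_1: "p > 1" using prime_gt_1_nat[OF prime_p] .

lemma e_pos: "e > 0" and w_le_e: "w \<le> e"
proof -
  have "1 * w \<le> (p - 1) * w" using p_gt_1 by (intro mult_right_mono) auto
  then show "w \<le> e" by (simp add: e_def)
  then show "e > 0" using w_pos by simp
qed

text \<open>At 1 the polynomial \<open>cyc_poly p w\<close> takes the value p and \<open>kap\<close>
  vanishes, so s takes the value 1.\<close>

lemma s_decompose: obtains s' where "s = 1 + kap * s'"
proof -
  have "int p = int p * poly s 1"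
    using arg_cong[OF cyc_poly_eq, of "\<lambda>f. poly f 1"] e_pos
    by (simp add: poly_cyc_poly_1 poly_kap_1 zero_power)
  then have "poly (s - 1) 1 = 0" using p_gt_1 by simp
  then obtain s' where "s - 1 = kap * s'" using kap_dvd_iff by (metis dvdE)
  then show ?thesis using that[of s'] by (simp add: algebra_simps)
qed

text \<open>The equation \<open>eq\<close> expresses p through the cyclotomic polynomial,
  \<open>kap ^ e\<close> and a multiple of \<open>kap\<close> times p itself. Each substitution
  improves the known level of p by one, until the term \<open>kap ^ e\<close> limits it.\<close>

lemma p_filtration: "of_nat p \<in> cyc_filt p w e"
proof -
  obtain s' where s': "s = 1 + kap * s'" using s_decompose .
  have eq: "of_nat p = cyc_poly p w - kap ^ e - (s' * kap ^ 1) * of_nat p"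
    using cyc_poly_eq s' by (simp add: algebra_simps)
  have "of_nat p \<in> cyc_filt p w k" if "k \<le> e" for k
    using that
  proof (induction k)
    case (Suc k)
    have "(s' * kap ^ 1) * of_nat p \<in> cyc_filt p w (1 + k)"
      using Suc by (intro cyc_filt_mult cyc_filt_scale kap_power_filtration) auto
    then show ?case
      using Suc.prems cyc_poly_filtration cyc_filt_mono[OF kap_power_filtration, of "Suc k" e]
      by (subst eq) (intro cyc_filt_diff, auto)
  qed (rule cyc_filt_0)
  then show ?thesis by simp
qed

lemma p_power_filtration: "of_nat p ^ n \<in> cyc_filt p w n"
proof (induction n)
  case (Suc n)
  have "of_nat p \<in> cyc_filt p w 1" using cyc_filt_mono[OF p_filtration] e_pos by simp
  from cyc_filt_mult[OF this Suc] show ?case by simp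
qed (rule cyc_filt_0)

lemma kap_p_filtration: "of_nat p * kap * x \<in> cyc_filt p w (Suc e)"
  using cyc_filt_scale[OF cyc_filt_mult[OF p_filtration kap_power_filtration[of 1]], of x]
  by (simp add: mult.commute)

sublocale filtered_ring "cyc_filt p w" kap polyX p w e
proof
  show "\<exists>r. x - kap ^ n * r \<in> cyc_filt p w N" if x: "x \<in> cyc_filt p w n" for x n N
  proof -
    obtain a b where "x = a * kap ^ n + b * cyc_poly p w" using x by (auto simp: cyc_filt_def)
    then have "x - kap ^ n * a = b * cyc_poly p w" by (simp add: algebra_simps)
    then show ?thesis using cyc_filt_scale[OF cyc_poly_filtration] by metis
  qed
  show "polyX ^ w - 1 - kap ^ w \<in> cyc_filt p w (Suc w)"
    using cyc_filt_mono[OF kap_p_filtration, of "Suc w" t] w_le_e by (simp add: X_w_eq)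
  show "of_nat p + kap ^ e \<in> cyc_filt p w (Suc e)"
  proof -
    obtain s' where s': "s = 1 + kap * s'" using s_decompose .
    have eq: "of_nat p + kap ^ e = cyc_poly p w - of_nat p * kap * s'"
      by (simp add: cyc_poly_eq s' algebra_simps)
    show ?thesis unfolding eq by (intro cyc_filt_diff cyc_poly_filtration kap_p_filtration)
  qed
  show "(\<Sum>i<p. polyX ^ (w * i)) \<in> cyc_filt p w n" for n
    using cyc_poly_filtration by (simp add: cyc_poly_def)
  show "kap \<in> cyc_filt p w 1" using kap_power_filtration[of 1] by simp
  show "kap * x \<in> cyc_filt p w (Suc n) \<Longrightarrow> x \<in> cyc_filt p w n" for x n
    using kap_cancel p_gt_1 by simp
qed (simp_all add: prime_p w_pos e_def cyc_filt_0 cyc_filt_zero cyc_filt_diff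
    cyc_filt_mult cyc_filt_Suc)

end

text \<open>Expand ((kap + 1)^p - 1) / kap: the leading term is kap^(p-1), and the remaining
  binomial coefficients are divisible by p. With w = 1 the second equation is exact, hence t =
  0.\<close>

lemma prime_power_cyc_prime:
  assumes p: "Factorial_Ring.prime p"
  shows "\<exists>s. prime_power_cyc p 1 (p - 1) s 0"
proof -
  have p1: "p > 1" using prime_gt_1_nat[OF p] .
  have K: "kap \<noteq> 0" by (simp add: kap_def one_pCons)
  have X: "polyX = kap + 1" by (simp add: kap_def)
  have "kap * cyc_poly p 1 = polyX ^ p - 1"
    using power_diff_1_eq[of polyX p] by (simp add: cyc_poly_def kap_def)
  also have "\<dots> = (\<Sum>k\<le>p. of_nat (p choose k) * kap ^ k) - 1"
    unfolding X binomial_ring by simp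
  also have "\<dots> = (\<Sum>k=1..p. of_nat (p choose k) * kap ^ k)"
    by (simp add: atMost_atLeast0 sum.atLeast_Suc_atMost)
  also have "\<dots> = (\<Sum>k=1..p-1. of_nat (p choose k) * kap ^ k) + kap ^ p"
    using p1 by (cases p) auto
  also have "(\<Sum>k=1..p-1. of_nat (p choose k) * kap ^ k) =
      (\<Sum>k=1..p-1. kap * (of_nat p * (of_nat ((p choose k) div p) * kap ^ (k - 1))))"
  proof (rule sum.cong)
    fix k assume k: "k \<in> {1..p-1}"
    then have "k * (p choose k) = p * (p - 1 choose (k - 1))"
      by (intro times_binomial_minus1_eq) auto
    then have "p dvd k * (p choose k)" by simp
    moreover have "\<not> p dvd k" using k p1 by (intro nat_dvd_not_less) auto
    ultimately have "p dvd (p choose k)" using p by (simp add: prime_dvd_mult_iff)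
    then have "(of_nat (p choose k) :: int poly) = of_nat p * of_nat ((p choose k) div p)"
      by (metis dvd_mult_div_cancel of_nat_mult)
    moreover have "kap ^ k = kap * kap ^ (k - 1)" using k by (cases k) auto
    ultimately show "of_nat (p choose k) * kap ^ k =
        kap * (of_nat p * (of_nat ((p choose k) div p) * kap ^ (k - 1)))"
      by (simp add: algebra_simps)
  qed simp
  also have "\<dots> = kap * (of_nat p * (\<Sum>k=1..p-1. of_nat ((p choose k) div p) * kap ^ (k - 1)))"
    by (simp add: sum_distrib_left)
  also have "kap ^ p = kap * kap ^ (p - 1)" using p1 by (cases p) auto
  finally have "kap * cyc_poly p 1 = kap * (kap ^ (p - 1) +
      of_nat p * (\<Sum>k=1..p-1. of_nat ((p choose k) div p) * kap ^ (k - 1)))"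
    by (simp only: distrib_left add.commute)
  then have "cyc_poly p 1 = kap ^ (p - 1) +
      of_nat p * (\<Sum>k=1..p-1. of_nat ((p choose k) div p) * kap ^ (k - 1))"
    using mult_left_cancel[OF K] by blast
  then have "prime_power_cyc p 1 (p - 1) (\<Sum>k=1..p-1. of_nat ((p choose k) div p) * kap ^ (k - 1)) 0"
    using p by unfold_locales (auto simp: kap_def)
  then show ?thesis ..
qed

text \<open>In terms of K = X - 1, the polynomial 1 + X^3 + X^6 is K^6 + 6 K^5 + 15 K^4 + 21 K^3 +
  18 K^2 + 9 K + 3, and X^3 - 1 is K^3 + 3 K^2 + 3 K.\<close>

lemma prime_power_cyc_9:
  "\<exists>s t. prime_power_cyc 3 3 6 s t"
proof -
  define K where "K = kap"
  have X: "polyX = K + 1" by (simp add: K_def kap_def)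
  have "(\<Sum>i<3::nat. Y ^ (3 * i)) = 1 + Y ^ 3 + Y ^ 6" for Y :: "int poly"
    by (simp add: lessThan_nat_numeral lessThan_Suc)
  then have "cyc_poly 3 3 = 1 + polyX ^ 3 + polyX ^ 6" unfolding cyc_poly_def .
  also have "\<dots> = K ^ 6 + of_nat 3 * (2 * K ^ 5 + 5 * K ^ 4 + 7 * K ^ 3 + 6 * K ^ 2 + 3 * K + 1)"
    unfolding X by (simp add: eval_nat_numeral algebra_simps)
  finally have 1: "cyc_poly 3 3 = \<dots>" .
  have 2: "polyX ^ 3 - 1 = K ^ 3 + of_nat 3 * K * (K + 1)"
    unfolding X by (simp add: eval_nat_numeral algebra_simps)
  have "prime_power_cyc 3 3 6 (2 * K ^ 5 + 5 * K ^ 4 + 7 * K ^ 3 + 6 * K ^ 2 + 3 * K + 1) (K + 1)"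
    using 1 2 by unfold_locales (simp_all add: K_def)
  then show ?thesis by blast
qed


section \<open>Integer polynomials in \<open>\<int>\<^sub>p[\<theta>]\<close>\<close>

abbreviation (input) "Zp \<equiv> padic_integers"

definition padic_of_int :: "nat \<Rightarrow> int \<Rightarrow> nat \<Rightarrow> int" where
  "padic_of_int p z = (\<lambda>n. z mod int p ^ n)"

definition lift_poly :: "nat \<Rightarrow> int poly \<Rightarrow> nat \<Rightarrow> nat \<Rightarrow> int" where
  "lift_poly p f = (\<lambda>i. padic_of_int p (coeff f i))"

text \<open>\<open>F i N\<close> is the residue modulo p^N of the i-th coefficient, so truncation
  respects sums and products only modulo p^N.\<close>

definition truncate_poly :: "nat \<Rightarrow> (nat \<Rightarrow> nat \<Rightarrow> int) \<Rightarrow> int poly" where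
  "truncate_poly N F = Abs_poly (\<lambda>i. F i N)"

lemma padic_of_int_closed: "p > 0 \<Longrightarrow> padic_of_int p z \<in> carrier (Zp p)"
  by (simp add: padic_integers_def padic_of_int_def mod_mod_cancel)

lemma padic_of_int_add:
  "padic_of_int p (x + y) = padic_of_int p x \<oplus>\<^bsub>Zp p\<^esub> padic_of_int p y"
  by (simp add: padic_integers_def padic_of_int_def mod_simps)

lemma padic_of_int_mult:
  "padic_of_int p (x * y) = padic_of_int p x \<otimes>\<^bsub>Zp p\<^esub> padic_of_int p y"
  by (simp add: padic_integers_def padic_of_int_def mod_simps)

lemma padic_of_int_one: "padic_of_int p 1 = \<one>\<^bsub>Zp p\<^esub>"
  by (simp add: padic_integers_def padic_of_int_def)

lemma padic_of_int_zero: "padic_of_int p 0 = \<zero>\<^bsub>Zp p\<^esub>"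
  by (simp add: padic_integers_def padic_of_int_def)

lemma padic_add_apply: "(x \<oplus>\<^bsub>Zp p\<^esub> y) N = (x N + y N) mod int p ^ N"
  by (simp add: padic_integers_def)

lemma padic_mult_apply: "(x \<otimes>\<^bsub>Zp p\<^esub> y) N = (x N * y N) mod int p ^ N"
  by (simp add: padic_integers_def)

lemma padic_finsum_apply:
  assumes "p > 0" "finite A" "\<And>k. k \<in> A \<Longrightarrow> x k \<in> carrier (Zp p)"
  shows "(\<Oplus>\<^bsub>Zp p\<^esub>k\<in>A. x k) N = (\<Sum>k\<in>A. x k N) mod int p ^ N"
proof -
  interpret cring "Zp p" using assms(1) by (rule padic_integers_cring)
  have "x \<in> A \<rightarrow> carrier (Zp p)" using assms(3) by blast
  with assms(2) show ?thesis
  proof (induction A)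
    case empty
    have "\<zero>\<^bsub>Zp p\<^esub> N = 0" by (simp add: padic_integers_def)
    then show ?case by simp
  next
    case (insert a A)
    then have "x a \<in> carrier (Zp p)" "x \<in> A \<rightarrow> carrier (Zp p)" by auto
    then show ?case using insert by (simp add: padic_add_apply mod_simps)
  qed
qed

lemma padic_mod:
  assumes x: "x \<in> carrier (Zp p)"
  shows "x (n + N) mod int p ^ n = x n"
proof (induction N)
  case 0
  show ?case using x by (simp add: padic_integers_def)
next
  case (Suc N)
  have "x (n + N) = x (Suc (n + N)) mod int p ^ (n + N)" using x by (simp add: padic_integers_def)
  then have "x (n + N) mod int p ^ n = x (n + Suc N) mod int p ^ n"
    by (simp add: mod_mod_cancel le_imp_power_dvd)
  then show ?case using Suc by simp
qed

lemma padic_range: "x \<in> carrier (Zp p) \<Longrightarrow> 0 \<le> x n \<and> x n < int p ^ n"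
  by (simp add: padic_integers_def)

text \<open>Division with remainder by p^N in the p-adic integers: the quotient modulo p^n is read
  off from x at level n + N.\<close>

lemma padic_divide:
  fixes N :: nat
  assumes p: "p > 0" and x: "x \<in> carrier (Zp p)"
  defines "y \<equiv> (\<lambda>n. (x (n + N) - x N) div int p ^ N)"
  shows "y \<in> carrier (Zp p)"
    "x = padic_of_int p (x N) \<oplus>\<^bsub>Zp p\<^esub> (padic_of_int p (int p ^ N) \<otimes>\<^bsub>Zp p\<^esub> y)"
proof -
  have pos: "int p ^ n > 0" for n using p by simp
  have dv: "int p ^ N * y n = x (n + N) - x N" for n
  proof -
    have "x (n + N) mod int p ^ N = x N mod int p ^ N"
      using padic_mod[OF x, of N n] padic_mod[OF x, of N 0] by (simp add: add.commute)
    then have "int p ^ N dvd x (n + N) - x N" by (simp add: mod_eq_dvd_iff)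
    then show ?thesis by (simp add: y_def)
  qed
  have ge: "x N \<le> x (n + N)" for n
    using padic_mod[OF x, of N n] padic_range[OF x, of "n + N"] zmod_le_nonneg_dividend
    by (metis add.commute)
  have range: "0 \<le> y n \<and> y n < int p ^ n" for n
  proof -
    have "0 \<le> int p ^ N * y n" using ge dv by simp
    moreover have "int p ^ N * y n < int p ^ N * int p ^ n"
      using dv[of n] padic_range[OF x, of "n + N"] padic_range[OF x, of N]
      by (simp add: power_add mult.commute)
    ultimately show ?thesis using pos[of N] by (simp add: zero_le_mult_iff)
  qed
  have "y (Suc n) mod int p ^ n = y n" for n
  proof -
    have "x (Suc (n + N)) mod int p ^ (n + N) = x (n + N) mod int p ^ (n + N)"
      using padic_mod[OF x, of "n + N" 1] padic_mod[OF x, of "n + N" 0] by simp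
    then have "int p ^ (n + N) dvd x (Suc n + N) - x (n + N)" by (simp add: mod_eq_dvd_iff)
    then have "int p ^ N * int p ^ n dvd int p ^ N * (y (Suc n) - y n)"
      using dv[of n] dv[of "Suc n"] by (simp add: right_diff_distrib power_add mult.commute)
    then have "int p ^ n dvd y (Suc n) - y n" using p by simp
    then have "y (Suc n) mod int p ^ n = y n mod int p ^ n" by (simp add: mod_eq_dvd_iff)
    then show ?thesis using range by simp
  qed
  then show "y \<in> carrier (Zp p)" using range by (simp add: padic_integers_def)
  show "x = padic_of_int p (x N) \<oplus>\<^bsub>Zp p\<^esub> (padic_of_int p (int p ^ N) \<otimes>\<^bsub>Zp p\<^esub> y)"
  proof
    fix n
    have "(x N + int p ^ N * y n) mod int p ^ n = x n"
      using dv[of n] padic_mod[OF x, of n N] by simp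
    then show "x n = (padic_of_int p (x N) \<oplus>\<^bsub>Zp p\<^esub>
        (padic_of_int p (int p ^ N) \<otimes>\<^bsub>Zp p\<^esub> y)) n"
      by (simp add: padic_add_apply padic_mult_apply padic_of_int_def mod_simps)
  qed
qed

lemma UP_padic_cring: "p > 0 \<Longrightarrow> UP_cring (Zp p)"
  using padic_integers_cring by (simp add: UP_cring_def)

lemma lift_poly_up: "p > 0 \<Longrightarrow> lift_poly p f \<in> up (Zp p)"
proof (rule mem_upI)
  show "\<exists>n. bound \<zero>\<^bsub>Zp p\<^esub> n (lift_poly p f)"
    by (rule exI[of _ "degree f"]) (auto simp: bound_def lift_poly_def coeff_eq_0 padic_of_int_zero)
qed (simp add: lift_poly_def padic_of_int_closed)

lemma lift_poly_add:
  "p > 0 \<Longrightarrow> lift_poly p (f + g) = lift_poly p f \<oplus>\<^bsub>UP (Zp p)\<^esub> lift_poly p g"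
  using lift_poly_up[of p f] lift_poly_up[of p g] by (simp add: UP_def) (simp add: lift_poly_def padic_of_int_add)

lemma lift_poly_mult:
  assumes "p > 0"
  shows "lift_poly p (f * g) = lift_poly p f \<otimes>\<^bsub>UP (Zp p)\<^esub> lift_poly p g"
proof -
  have "lift_poly p (f * g) i N = (\<Oplus>\<^bsub>Zp p\<^esub>k\<in>{..i}.
      lift_poly p f k \<otimes>\<^bsub>Zp p\<^esub> lift_poly p g (i - k)) N" for i N
    unfolding lift_poly_def padic_of_int_mult[symmetric]
    using padic_finsum_apply[OF assms, of "{..i}"
        "\<lambda>k. padic_of_int p (coeff f k * coeff g (i - k))" N] padic_of_int_closed[OF assms]
    by (simp add: padic_of_int_def coeff_mult mod_sum_eq)
  then have "lift_poly p (f * g) = (\<lambda>i. \<Oplus>\<^bsub>Zp p\<^esub>k\<in>{..i}.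
      lift_poly p f k \<otimes>\<^bsub>Zp p\<^esub> lift_poly p g (i - k))" by (intro ext)
  then show ?thesis using lift_poly_up[OF assms, of f] lift_poly_up[OF assms, of g] by (simp add: UP_def)
qed

lemma lift_poly_one: "lift_poly p 1 = \<one>\<^bsub>UP (Zp p)\<^esub>"
  by (auto simp: UP_def lift_poly_def padic_of_int_one padic_of_int_zero)

lemma lift_poly_zero: "lift_poly p 0 = \<zero>\<^bsub>UP (Zp p)\<^esub>"
  by (auto simp: UP_def lift_poly_def padic_of_int_zero)

lemma lift_poly_X_power:
  assumes "p > 0"
  shows "lift_poly p (polyX ^ k) = up_ring.monom (UP (Zp p)) \<one>\<^bsub>Zp p\<^esub> k"
proof -
  interpret cring "Zp p" using assms by (rule padic_integers_cring)
  have "polyX ^ k = Polynomial.monom 1 k" by (simp add: monom_altdef)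
  then show ?thesis
    by (auto simp: UP_def lift_poly_def padic_of_int_one padic_of_int_zero)
qed

lemma lift_cyc_poly:
  assumes "p > 0"
  shows "lift_poly p (cyc_poly p (p ^ (l - 1))) = cyclotomic_pol p l"
proof -
  interpret UP_cring "Zp p" "UP (Zp p)"
    using assms by (simp_all add: UP_padic_cring)
  have "lift_poly p (\<Sum>i\<in>A. polyX ^ (p ^ (l - 1) * i)) = (\<Oplus>\<^bsub>UP (Zp p)\<^esub>i\<in>A.
      up_ring.monom (UP (Zp p)) \<one>\<^bsub>Zp p\<^esub> (i * p ^ (l - 1)))"
    if "finite A" for A
    using that by (induction A)
      (auto simp: lift_poly_zero lift_poly_add assms lift_poly_X_power mult.commute)
  then show ?thesis by (simp add: cyc_poly_def cyclotomic_pol_def Let_def)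
qed

lemma coeff_truncate_poly:
  assumes "p > 0" "F \<in> up (Zp p)"
  shows "coeff (truncate_poly N F) i = F i N"
proof -
  obtain n where "\<And>i. i > n \<Longrightarrow> F i = \<zero>\<^bsub>Zp p\<^esub>"
    using assms by (auto simp: up_def bound_def)
  then have "F i N = 0" if "i > n" for i using that by (simp add: padic_integers_def)
  from coeff_Abs_poly[OF this] show ?thesis by (simp add: truncate_poly_def)
qed

lemma truncate_add:
  assumes "p > 0" "F \<in> up (Zp p)" "G \<in> up (Zp p)"
  shows "coeff (truncate_poly N (F \<oplus>\<^bsub>UP (Zp p)\<^esub> G)) i =
    coeff (truncate_poly N F + truncate_poly N G) i mod int p ^ N"
proof -
  interpret cring "Zp p" using assms(1) by (rule padic_integers_cring)
  have "F \<oplus>\<^bsub>UP (Zp p)\<^esub> G = (\<lambda>i. F i \<oplus>\<^bsub>Zp p\<^esub> G i)"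
    using assms by (simp add: UP_def)
  moreover have "(\<lambda>i. F i \<oplus>\<^bsub>Zp p\<^esub> G i) \<in> up (Zp p)"
    using assms by (intro up_add_closed)
  ultimately show ?thesis
    using assms by (simp add: coeff_truncate_poly padic_add_apply)
qed

lemma truncate_mult:
  assumes "p > 0" "F \<in> up (Zp p)" "G \<in> up (Zp p)"
  shows "coeff (truncate_poly N (F \<otimes>\<^bsub>UP (Zp p)\<^esub> G)) i =
    coeff (truncate_poly N F * truncate_poly N G) i mod int p ^ N"
proof -
  interpret cring "Zp p" using assms(1) by (rule padic_integers_cring)
  have c: "F i \<in> carrier (Zp p)" "G i \<in> carrier (Zp p)" for i
    using assms by auto
  have eq: "F \<otimes>\<^bsub>UP (Zp p)\<^esub> G =
      (\<lambda>n. \<Oplus>\<^bsub>Zp p\<^esub>i\<in>{..n}. F i \<otimes>\<^bsub>Zp p\<^esub> G (n - i))"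
    using assms by (simp add: UP_def)
  have "F \<otimes>\<^bsub>UP (Zp p)\<^esub> G \<in> up (Zp p)"
    unfolding eq using assms by (intro up_mult_closed)
  then show ?thesis
    using assms c
    by (simp add: coeff_truncate_poly coeff_mult) (simp add: eq padic_finsum_apply padic_mult_apply mod_sum_eq)
qed

lemma truncate_lift: "p > 0 \<Longrightarrow> coeff (truncate_poly N (lift_poly p f)) i = coeff f i mod int p ^ N"
  using coeff_truncate_poly[OF _ lift_poly_up] by (simp add: lift_poly_def padic_of_int_def)

lemma UP_carrier: "carrier (UP R) = up R"
  by (simp add: UP_def)

lemma UP_add_eq: "F \<in> up R \<Longrightarrow> G \<in> up R \<Longrightarrow> F \<oplus>\<^bsub>UP R\<^esub> G = (\<lambda>i. F i \<oplus>\<^bsub>R\<^esub> G i)"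
  by (simp add: UP_def)

lemma UP_smult_eq: "a \<in> carrier R \<Longrightarrow> F \<in> up R \<Longrightarrow> a \<odot>\<^bsub>UP R\<^esub> F = (\<lambda>i. a \<otimes>\<^bsub>R\<^esub> F i)"
  by (simp add: UP_def)

lemma lift_const_poly:
  "p > 0 \<Longrightarrow> lift_poly p [:z:] = up_ring.monom (UP (Zp p)) (padic_of_int p z) 0"
  by (auto simp: UP_def lift_poly_def padic_of_int_zero padic_of_int_closed coeff_pCons split: nat.splits)

lemma lift_const_mult:
  assumes p: "p > 0" and G: "G \<in> up (Zp p)"
  shows "lift_poly p (of_nat p ^ N) \<otimes>\<^bsub>UP (Zp p)\<^esub> G =
    (\<lambda>i. padic_of_int p (int p ^ N) \<otimes>\<^bsub>Zp p\<^esub> G i)"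
proof -
  have "(of_nat p ^ N :: int poly) = [:int p ^ N:]" by (simp add: of_nat_poly poly_const_pow)
  then show ?thesis
    using UP_ring.monom_mult_is_smult[of "Zp p" "padic_of_int p (int p ^ N)" G]
      UP_smult_eq[OF padic_of_int_closed[OF p] G] UP_padic_cring[OF p] padic_of_int_closed[OF p] G p
    by (simp only: lift_const_poly UP_carrier UP_ring_def UP_cring_def cring_def)
qed

text \<open>Dividing every coefficient by p^N with remainder shows that integer polynomials are
  dense among the p-adic ones.\<close>

lemma lift_truncate:
  assumes p: "p > 0" and F: "F \<in> up (Zp p)"
  obtains G where "G \<in> up (Zp p)"
    "F = lift_poly p (truncate_poly N F) \<oplus>\<^bsub>UP (Zp p)\<^esub>
      (lift_poly p (of_nat p ^ N) \<otimes>\<^bsub>UP (Zp p)\<^esub> G)"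
proof -
  interpret cring "Zp p" using p by (rule padic_integers_cring)
  define G where "G = (\<lambda>i n. (F i (n + N) - F i N) div int p ^ N)"
  have Fc: "F i \<in> carrier (Zp p)" for i using F by auto
  have Gc: "G i \<in> carrier (Zp p)" for i
    unfolding G_def by (rule padic_divide(1)[OF p Fc])
  obtain n where n: "\<And>i. i > n \<Longrightarrow> F i = \<zero>\<^bsub>Zp p\<^esub>"
    using F by (auto simp: up_def bound_def)
  have G: "G \<in> up (Zp p)"
  proof (rule mem_upI[OF Gc], rule exI[of _ n], unfold bound_def, intro allI impI)
    fix i assume "n < i"
    then show "G i = \<zero>\<^bsub>Zp p\<^esub>" using n[of i] by (simp add: G_def padic_integers_def)
  qed
  have up: "(\<lambda>i. padic_of_int p (int p ^ N) \<otimes>\<^bsub>Zp p\<^esub> G i) \<in> up (Zp p)"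
    using padic_of_int_closed[OF p] G by (rule up_smult_closed)
  have "F i = lift_poly p (truncate_poly N F) i \<oplus>\<^bsub>Zp p\<^esub>
      (padic_of_int p (int p ^ N) \<otimes>\<^bsub>Zp p\<^esub> G i)" for i
    using padic_divide(2)[OF p Fc[of i], of N] p F
    by (simp add: lift_poly_def coeff_truncate_poly G_def)
  then have "F = lift_poly p (truncate_poly N F) \<oplus>\<^bsub>UP (Zp p)\<^esub>
      (lift_poly p (of_nat p ^ N) \<otimes>\<^bsub>UP (Zp p)\<^esub> G)"
    unfolding lift_const_mult[OF p G] UP_add_eq[OF lift_poly_up[OF p] up] by (rule ext)
  then show ?thesis using that G by blast
qed


text \<open>The value of an integer polynomial at theta, as an element of Z_p[theta].\<close>

definition at_theta :: "nat \<Rightarrow> nat \<Rightarrow> int poly \<Rightarrow> (nat \<Rightarrow> nat \<Rightarrow> int) set" where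
  "at_theta p l f = pol_class p l (lift_poly p f)"

definition theta_ideal :: "nat \<Rightarrow> nat \<Rightarrow> nat \<Rightarrow> (nat \<Rightarrow> nat \<Rightarrow> int) set set" where
  "theta_ideal p l n = PIdl\<^bsub>cyc_integers p l\<^esub>
    ((theta p l \<ominus>\<^bsub>cyc_integers p l\<^esub> \<one>\<^bsub>cyc_integers p l\<^esub>) [^]\<^bsub>cyc_integers p l\<^esub> n)"

section \<open>Evaluation at theta and the powers of the maximal ideal\<close>

locale cyc_ring = prime_power_cyc p w e s t for p w e s t +
  fixes l :: nat
  assumes w_eq: "w = p ^ (l - 1)"
begin

abbreviation "ZP \<equiv> Zp p"
abbreviation "PP \<equiv> UP (Zp p)"
abbreviation "RR \<equiv> cyc_integers p l"
abbreviation "ev \<equiv> at_theta p l"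
abbreviation "K \<equiv> theta_ideal p l"
abbreviation "kpow n \<equiv> ev kap [^]\<^bsub>RR\<^esub> (n::nat)"
abbreviation "zR \<equiv> \<zero>\<^bsub>RR\<^esub>"
abbreviation "oneR \<equiv> \<one>\<^bsub>RR\<^esub>"
abbreviation "J \<equiv> cyc_filt p w"

lemma p_pos: "p > 0" using p_gt_1 by simp

lemma ZP_cring: "cring ZP" using padic_integers_cring[OF p_pos] .

lemma PP_cring: "cring PP" using UP_cring.UP_cring[OF UP_padic_cring[OF p_pos]] .

lemma lift_carrier: "lift_poly p f \<in> carrier PP"
  using lift_poly_up[OF p_pos] by (simp add: UP_carrier)

lemma cyclotomic_eq: "cyclotomic_pol p l = lift_poly p (cyc_poly p w)"
  using lift_cyc_poly[OF p_pos] by (simp add: w_eq)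

lemma cyclotomic_ideal: "ideal (PIdl\<^bsub>PP\<^esub> (cyclotomic_pol p l)) PP"
  using cring.cgenideal_ideal[OF PP_cring lift_carrier] by (simp add: cyclotomic_eq)

lemma RR_cring: "cring RR"
  using ideal.quotient_is_cring[OF cyclotomic_ideal PP_cring] by (simp add: cyc_integers_def Let_def)

sublocale R: cring RR by (rule RR_cring)

lemma class_hom: "pol_class p l \<in> ring_hom PP RR"
proof -
  have "pol_class p l = (+>\<^bsub>PP\<^esub>) (PIdl\<^bsub>PP\<^esub> (cyclotomic_pol p l))"
    by (rule ext) (simp add: pol_class_def Let_def)
  then show ?thesis
    using ideal.rcos_ring_hom[OF cyclotomic_ideal] by (simp add: cyc_integers_def Let_def)
qed

lemma class_surj:
  assumes "z \<in> carrier RR"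
  obtains F where "F \<in> carrier PP" "z = pol_class p l F"
  using assms unfolding cyc_integers_def Let_def FactRing_def A_RCOSETS_def' pol_class_def by auto

lemma class_eqD:
  assumes "F \<in> carrier PP" "G \<in> carrier PP" "pol_class p l F = pol_class p l G"
  obtains B where "B \<in> carrier PP" "F = B \<otimes>\<^bsub>PP\<^esub> cyclotomic_pol p l \<oplus>\<^bsub>PP\<^esub> G"
proof -
  interpret P: cring PP by (rule PP_cring)
  have "F \<ominus>\<^bsub>PP\<^esub> G \<in> PIdl\<^bsub>PP\<^esub> (cyclotomic_pol p l)"
    using P.quotient_eq_iff_same_a_r_cos[OF cyclotomic_ideal assms(1,2)] assms(3)
    by (simp add: pol_class_def Let_def)
  then obtain B where B: "B \<in> carrier PP" "F \<ominus>\<^bsub>PP\<^esub> G = B \<otimes>\<^bsub>PP\<^esub> cyclotomic_pol p l"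
    by (auto simp: cgenideal_def)
  have "F = (F \<ominus>\<^bsub>PP\<^esub> G) \<oplus>\<^bsub>PP\<^esub> G"
    using assms(1,2) by (simp add: P.minus_eq P.a_assoc P.l_neg)
  then show ?thesis using that B by metis
qed

lemma ev_closed [simp]: "ev f \<in> carrier RR"
  using ring_hom_closed[OF class_hom lift_carrier] by (simp add: at_theta_def)

lemma ev_add: "ev (f + g) = ev f \<oplus>\<^bsub>RR\<^esub> ev g"
  using ring_hom_add[OF class_hom lift_carrier lift_carrier]
  by (simp add: at_theta_def lift_poly_add[OF p_pos])

lemma ev_mult: "ev (f * g) = ev f \<otimes>\<^bsub>RR\<^esub> ev g"
  using ring_hom_mult[OF class_hom lift_carrier lift_carrier]
  by (simp add: at_theta_def lift_poly_mult[OF p_pos])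

lemma ev_one: "ev 1 = oneR"
  using ring_hom_one[OF class_hom] by (simp add: at_theta_def lift_poly_one)

lemma ev_zero: "ev 0 = zR"
  using R.add.l_cancel_one[of "ev 0" "ev 0"] ev_add[of 0 0] by simp

lemma ev_minus: "ev (- f) = \<ominus>\<^bsub>RR\<^esub> ev f"
  using ev_add[of "- f" f] R.minus_equality[of "ev (- f)" "ev f"] by (simp add: ev_zero)

lemma ev_diff: "ev (f - g) = ev f \<ominus>\<^bsub>RR\<^esub> ev g"
  using ev_add[of f "- g"] by (simp add: ev_minus R.minus_eq)

lemma ev_power: "ev (f ^ n) = ev f [^]\<^bsub>RR\<^esub> n"
  by (induction n) (simp_all add: ev_one ev_mult R.m_comm)

lemma ev_X: "ev polyX = theta p l"
  using lift_poly_X_power[OF p_pos, of 1] by (simp add: at_theta_def theta_def Let_def)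

lemma ev_kap: "ev kap = theta p l \<ominus>\<^bsub>RR\<^esub> oneR"
  by (simp add: kap_def ev_diff ev_X ev_one)

lemma theta_closed [simp]: "theta p l \<in> carrier RR"
  using ev_closed[of polyX] by (simp only: ev_X)

lemma ev_cyc_poly: "ev (cyc_poly p w) = zR"
proof -
  interpret P: cring PP by (rule PP_cring)
  let ?I = "PIdl\<^bsub>PP\<^esub> (cyclotomic_pol p l)"
  have c: "cyclotomic_pol p l \<in> carrier PP" by (simp add: cyclotomic_eq lift_carrier)
  then have "?I +>\<^bsub>PP\<^esub> cyclotomic_pol p l = ?I"
    using P.cgenideal_self P.a_rcos_zero[OF cyclotomic_ideal] by blast
  moreover have "zR = ?I" by (simp add: cyc_integers_def Let_def FactRing_def)
  ultimately show ?thesis by (simp add: at_theta_def pol_class_def Let_def flip: cyclotomic_eq)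
qed

lemma theta_ideal_eq: "K n = {z \<otimes>\<^bsub>RR\<^esub> kpow n | z. z \<in> carrier RR}"
  by (simp add: theta_ideal_def cgenideal_def ev_kap)

lemma theta_ideal_ideal: "ideal (K n) RR"
  using R.cgenideal_ideal[of "kpow n"] by (simp add: theta_ideal_def ev_kap)

lemma ev_in_idealI:
  assumes "f \<in> J n"
  shows "ev f \<in> K n"
proof -
  obtain a b where "f = a * kap ^ n + b * cyc_poly p w" using assms by (auto simp: cyc_filt_def)
  then have "ev f = ev a \<otimes>\<^bsub>RR\<^esub> kpow n" by (simp add: ev_add ev_mult ev_power ev_cyc_poly)
  then show ?thesis by (auto simp: theta_ideal_eq)
qed

lemma truncation_in_filtration:
  assumes "\<And>i. coeff f i mod int p ^ n = 0"
  shows "f \<in> J n"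
proof -
  have "[:int p ^ n:] dvd f" using assms by (simp add: const_poly_dvd_iff mod_eq_0_iff_dvd)
  moreover have "(of_nat p ^ n :: int poly) = [:int p ^ n:]" by (simp add: of_nat_poly poly_const_pow)
  ultimately obtain h where "f = of_nat p ^ n * h" by (metis dvdE)
  then show ?thesis using J_mult_right[OF p_power_filtration] by simp
qed

text \<open>Truncating \<open>p\<close>-adic coefficients modulo \<open>p\<^sup>n\<close> turns a relation between polynomials over
  \<open>\<int>\<^sub>p\<close> into one over \<open>\<int>\<close> modulo \<open>p\<^sup>n\<close>, and \<open>p\<^sup>n\<close> lies in the ideal.\<close>

lemma ev_in_idealD:
  assumes "ev f \<in> K n"
  shows "f \<in> J n"
proof -
  interpret P: cring PP by (rule PP_cring)
  obtain z where z: "z \<in> carrier RR" "ev f = z \<otimes>\<^bsub>RR\<^esub> ev (kap ^ n)"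
    using assms by (auto simp: theta_ideal_eq ev_power)
  obtain F where F: "F \<in> carrier PP" "z = pol_class p l F" using class_surj[OF z(1)] .
  have "pol_class p l (lift_poly p f) = pol_class p l (F \<otimes>\<^bsub>PP\<^esub> lift_poly p (kap ^ n))"
    using z(2) F ring_hom_mult[OF class_hom F(1) lift_carrier] by (simp add: at_theta_def)
  then obtain B where B: "B \<in> carrier PP"
    "lift_poly p f = B \<otimes>\<^bsub>PP\<^esub> lift_poly p (cyc_poly p w) \<oplus>\<^bsub>PP\<^esub> F \<otimes>\<^bsub>PP\<^esub> lift_poly p (kap ^ n)"
    using class_eqD[OF lift_carrier P.m_closed[OF F(1) lift_carrier]] by (metis cyclotomic_eq)
  define T where "T = truncate_poly n"
  define eqm where "eqm f g \<longleftrightarrow> (\<forall>i. coeff f i mod int p ^ n = coeff g i mod int p ^ n)" for f g :: "int poly"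
  have J: "f - g \<in> J n" if "eqm f g" for f g
    using that by (intro truncation_in_filtration) (simp add: eqm_def mod_eq_dvd_iff)
  have up: "B \<otimes>\<^bsub>PP\<^esub> lift_poly p (cyc_poly p w) \<in> up ZP" "F \<otimes>\<^bsub>PP\<^esub> lift_poly p (kap ^ n) \<in> up ZP"
    "B \<in> up ZP" "F \<in> up ZP"
    using B(1) F(1) P.m_closed[OF _ lift_carrier] by (simp_all add: UP_carrier)
  have 1: "T (lift_poly p g) - g \<in> J n" for g
    using truncate_lift[OF p_pos] by (intro J) (simp add: eqm_def T_def)
  have 2: "T (lift_poly p f) - (T (B \<otimes>\<^bsub>PP\<^esub> lift_poly p (cyc_poly p w)) + T (F \<otimes>\<^bsub>PP\<^esub> lift_poly p (kap ^ n))) \<in> J n"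
    unfolding B(2) using truncate_add[OF p_pos up(1,2), of n] by (intro J) (simp add: eqm_def T_def)
  have 3: "T (G \<otimes>\<^bsub>PP\<^esub> lift_poly p g) - T G * T (lift_poly p g) \<in> J n" if "G \<in> up ZP" for G g
    using truncate_mult[OF p_pos that lift_poly_up[OF p_pos], of n] by (intro J) (simp add: eqm_def T_def)
  have 4: "T (G \<otimes>\<^bsub>PP\<^esub> lift_poly p g) \<in> J n" if "G \<in> up ZP" "g \<in> J n" for G g
  proof -
    have "T (lift_poly p g) \<in> J n" using J_add[OF 1[of g] that(2)] by simp
    from J_add[OF 3[OF that(1), of g] J_mult[OF this, of "T G"]] show ?thesis by simp
  qed
  have "T (B \<otimes>\<^bsub>PP\<^esub> lift_poly p (cyc_poly p w)) + T (F \<otimes>\<^bsub>PP\<^esub> lift_poly p (kap ^ n)) \<in> J n"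
    using up by (intro J_add 4 cyc_poly_filtration kap_power_filtration)
  from J_add[OF 2 this] have "T (lift_poly p f) \<in> J n" by simp
  from J_diff[OF this 1[of f]] show ?thesis by simp
qed

lemma ev_in_ideal_iff: "ev f \<in> K n \<longleftrightarrow> f \<in> J n"
  using ev_in_idealI ev_in_idealD by blast

text \<open>Truncating the coefficients modulo p^n changes z by a multiple of p^n, and p^n lies in
  the n-th power of the ideal. Thus every coset of \<open>K n\<close> has a representative in
  Z[X].\<close>

lemma ev_dense:
  assumes z: "z \<in> carrier RR"
  shows "\<exists>f. z \<ominus>\<^bsub>RR\<^esub> ev f \<in> K n"
proof -
  obtain F where F: "F \<in> carrier PP" "z = pol_class p l F" using class_surj[OF z] .
  then obtain G where G: "G \<in> up ZP"
    "F = lift_poly p (truncate_poly n F) \<oplus>\<^bsub>PP\<^esub> (lift_poly p (of_nat p ^ n) \<otimes>\<^bsub>PP\<^esub> G)"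
    using lift_truncate[OF p_pos] by (metis UP_carrier)
  interpret P: cring PP by (rule PP_cring)
  have Gc: "G \<in> carrier PP" using G(1) by (simp add: UP_carrier)
  let ?f = "truncate_poly n F"
  have c: "pol_class p l G \<in> carrier RR" using ring_hom_closed[OF class_hom Gc] .
  have "z = ev ?f \<oplus>\<^bsub>RR\<^esub> (ev (of_nat p ^ n) \<otimes>\<^bsub>RR\<^esub> pol_class p l G)"
    unfolding F(2) at_theta_def
    using ring_hom_add[OF class_hom lift_carrier P.m_closed[OF lift_carrier Gc], of ?f "of_nat p ^ n"]
      ring_hom_mult[OF class_hom lift_carrier Gc, of "of_nat p ^ n"] G(2) by metis
  then have "z \<ominus>\<^bsub>RR\<^esub> ev ?f = ev (of_nat p ^ n) \<otimes>\<^bsub>RR\<^esub> pol_class p l G"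
    using c by (simp add: R.minus_eq R.a_ac R.r_neg1 R.r_neg2 R.r_neg)
  moreover have "ev (of_nat p ^ n) \<otimes>\<^bsub>RR\<^esub> pol_class p l G \<in> K n"
    using ideal.I_r_closed[OF theta_ideal_ideal ev_in_idealI[OF p_power_filtration] c] .
  ultimately show ?thesis by metis
qed

end


section \<open>Main line groups\<close>

locale cyc_group = cyc_ring +
  assumes l_pos: "l > 0"
begin

abbreviation "q \<equiv> p ^ l"
abbreviation "G \<equiv> G_group p l"
abbreviation th :: "nat \<Rightarrow> (nat \<Rightarrow> nat \<Rightarrow> int) set" where "th i \<equiv> ev (polyX ^ i)"

lemma q_eq: "q = p * w"
  using l_pos by (cases l) (auto simp: w_eq)

lemma q_gt_1: "q > 1"
  by (rule one_less_power[OF p_gt_1 l_pos])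

lemma p_neq_0: "p \<noteq> 0"
  using p_pos by simp

declare p_pos [simp] p_neq_0 [simp]

lemma th_mod: "th (i mod q) = th i"
proof -
  have "polyX ^ (p * w) - 1 = (polyX ^ w - 1) * cyc_poly p w"
    using power_diff_1_eq[of "polyX ^ w" p] by (simp add: cyc_poly_def mult.commute flip: power_mult)
  then have "ev (polyX ^ q - 1) = zR" by (simp add: q_eq ev_mult ev_cyc_poly)
  then have q: "ev (polyX ^ q) = oneR" by (simp add: ev_diff ev_one)
  have "ev (polyX ^ (q * k + m)) = ev (polyX ^ m)" for k m
    by (simp add: power_add power_mult ev_mult ev_power[of "polyX ^ q"] q)
  from this[of "i div q" "i mod q"] show ?thesis by simp
qed

lemma th_add: "th (i + j) = th i \<otimes>\<^bsub>RR\<^esub> th j"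
  by (simp add: power_add ev_mult)

lemma th_0: "th 0 = oneR"
  by (simp add: ev_one)

lemma G_carrier: "carrier G = {(z, int i) | z i. z \<in> carrier RR \<and> i < q}"
proof -
  have "carrier G = carrier RR \<times> {0..<int q}"
    using p_pos by (simp add: G_group_def Let_def semidirect_def carrier_integer_mod_group)
  also have "\<dots> = {(z, int i) | z i. z \<in> carrier RR \<and> i < q}"
    by (auto intro!: exI[of _ "nat _"] simp: nat_less_iff)
  finally show ?thesis .
qed

lemma G_mult: "(x, int i) \<otimes>\<^bsub>G\<^esub> (y, int j) = (x \<oplus>\<^bsub>RR\<^esub> (th i \<otimes>\<^bsub>RR\<^esub> y), int ((i + j) mod q))"
  by (simp add: G_group_def Let_def semidirect_def int_pow_int ev_power ev_X zmod_int)

lemma G_one: "\<one>\<^bsub>G\<^esub> = (zR, int 0)"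
  by (simp add: G_group_def Let_def semidirect_def)

lemma G_group: "group G"
proof (rule groupI)
  have q: "q > 0" using q_gt_1 by simp
  then show "\<one>\<^bsub>G\<^esub> \<in> carrier G" by (auto simp: G_one G_carrier)
  fix g assume "g \<in> carrier G"
  then obtain x i where g: "g = (x, int i)" "x \<in> carrier RR" "i < q" by (auto simp: G_carrier)
  show "\<one>\<^bsub>G\<^esub> \<otimes>\<^bsub>G\<^esub> g = g"
    unfolding G_one g(1) G_mult using g by (simp add: th_0 ev_one)
  show "\<exists>h\<in>carrier G. h \<otimes>\<^bsub>G\<^esub> g = \<one>\<^bsub>G\<^esub>"
  proof
    let ?h = "(\<ominus>\<^bsub>RR\<^esub> (th (q - i) \<otimes>\<^bsub>RR\<^esub> x), int ((q - i) mod q))"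
    show "?h \<in> carrier G" using g q by (auto simp: G_carrier)
    show "?h \<otimes>\<^bsub>G\<^esub> g = \<one>\<^bsub>G\<^esub>"
      unfolding G_one g(1) G_mult using g by (simp add: th_mod R.l_neg mod_simps)
  qed
  fix h assume "h \<in> carrier G"
  then obtain y j where h: "h = (y, int j)" "y \<in> carrier RR" "j < q" by (auto simp: G_carrier)
  show "g \<otimes>\<^bsub>G\<^esub> h \<in> carrier G" unfolding g(1) h(1) G_mult using g h q by (auto simp: G_carrier)
  fix k assume "k \<in> carrier G"
  then obtain z m where k: "k = (z, int m)" "z \<in> carrier RR" "m < q" by (auto simp: G_carrier)
  show "g \<otimes>\<^bsub>G\<^esub> h \<otimes>\<^bsub>G\<^esub> k = g \<otimes>\<^bsub>G\<^esub> (h \<otimes>\<^bsub>G\<^esub> k)"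
    unfolding g(1) h(1) k(1) G_mult th_mod th_add
    using g h k by (simp add: R.r_distr R.m_assoc R.a_assoc mod_simps add.assoc)
qed

sublocale G: group G by (rule G_group)

section \<open>The lower central series\<close>

definition base :: "nat \<Rightarrow> ((nat \<Rightarrow> nat \<Rightarrow> int) set \<times> int) set" where
  "base n = K n \<times> {int 0}"

lemma K_sub: "z \<in> K n \<Longrightarrow> z \<in> carrier RR"
  using ideal.Icarr[OF theta_ideal_ideal] .

lemma K_closed: "x \<in> K n \<Longrightarrow> y \<in> K n \<Longrightarrow> x \<oplus>\<^bsub>RR\<^esub> y \<in> K n" "x \<in> K n \<Longrightarrow> \<ominus>\<^bsub>RR\<^esub> x \<in> K n"
  "zR \<in> K n" "x \<in> K n \<Longrightarrow> r \<in> carrier RR \<Longrightarrow> r \<otimes>\<^bsub>RR\<^esub> x \<in> K n"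
proof -
  interpret I: ideal "K n" RR by (rule theta_ideal_ideal)
  show "x \<in> K n \<Longrightarrow> y \<in> K n \<Longrightarrow> x \<oplus>\<^bsub>RR\<^esub> y \<in> K n" "x \<in> K n \<Longrightarrow> \<ominus>\<^bsub>RR\<^esub> x \<in> K n"
    "zR \<in> K n" "x \<in> K n \<Longrightarrow> r \<in> carrier RR \<Longrightarrow> r \<otimes>\<^bsub>RR\<^esub> x \<in> K n"
    by (simp_all add: I.I_l_closed)
qed

lemma K_0: "z \<in> carrier RR \<Longrightarrow> z \<in> K 0"
  by (auto simp: theta_ideal_eq intro!: exI[of _ z])

lemma K_mult:
  assumes "x \<in> K m" "y \<in> K n"
  shows "x \<otimes>\<^bsub>RR\<^esub> y \<in> K (m + n)"
proof -
  obtain u v where uv: "u \<in> carrier RR" "v \<in> carrier RR" "x = u \<otimes>\<^bsub>RR\<^esub> kpow m"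
    "y = v \<otimes>\<^bsub>RR\<^esub> kpow n"
    using assms by (auto simp: theta_ideal_eq)
  then have "x \<otimes>\<^bsub>RR\<^esub> y = (u \<otimes>\<^bsub>RR\<^esub> v) \<otimes>\<^bsub>RR\<^esub> kpow (m + n)"
    by (simp add: R.m_ac flip: R.nat_pow_mult)
  then show ?thesis using uv by (auto simp: theta_ideal_eq)
qed

lemma th_diff: "th i \<ominus>\<^bsub>RR\<^esub> oneR \<in> K 1"
proof -
  have "kap dvd polyX ^ i - 1" by (simp add: kap_dvd_iff)
  then obtain a where "polyX ^ i - 1 = a * kap ^ 1 + 0 * cyc_poly p w" by (metis add_0_right dvdE mult.commute mult_zero_left power_one_right)
  then have "polyX ^ i - 1 \<in> J 1" by (rule cyc_filtI)
  from ev_in_idealI[OF this] show ?thesis by (simp add: ev_diff ev_one)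
qed

lemma base_conj:
  assumes g: "g \<in> carrier G" and k: "k \<in> K n"
  shows "g \<otimes>\<^bsub>G\<^esub> (k, int 0) \<otimes>\<^bsub>G\<^esub> inv\<^bsub>G\<^esub> g \<in> base n"
proof -
  obtain x i where x: "g = (x, int i)" "x \<in> carrier RR" "i < q" using g by (auto simp: G_carrier)
  have kc: "k \<in> carrier RR" by (rule K_sub[OF k])
  have k': "(th i \<otimes>\<^bsub>RR\<^esub> k, int 0) \<in> carrier G" using kc q_gt_1 by (auto simp: G_carrier)
  have "g \<otimes>\<^bsub>G\<^esub> (k, int 0) = (th i \<otimes>\<^bsub>RR\<^esub> k, int 0) \<otimes>\<^bsub>G\<^esub> g"
    unfolding x(1) G_mult using x kc by (simp add: th_0 ev_one R.a_comm)
  then have "g \<otimes>\<^bsub>G\<^esub> (k, int 0) \<otimes>\<^bsub>G\<^esub> inv\<^bsub>G\<^esub> g = (th i \<otimes>\<^bsub>RR\<^esub> k, int 0)"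
    using g k' by (simp add: G.m_assoc)
  then show ?thesis using K_closed(4)[OF k] by (simp add: base_def)
qed

lemma base_subgroup: "subgroup (base n) G"
proof (rule G.subgroupI)
  show "base n \<subseteq> carrier G" using K_sub q_gt_1 by (auto simp: base_def G_carrier)
  show "base n \<noteq> {}" using K_closed(3) by (auto simp: base_def)
  fix a assume "a \<in> base n"
  then obtain k where k: "a = (k, int 0)" "k \<in> K n" by (auto simp: base_def)
  have kc: "k \<in> carrier RR" "(\<ominus>\<^bsub>RR\<^esub> k, int 0) \<in> carrier G" "a \<in> carrier G"
    using K_sub[OF k(2)] q_gt_1 by (auto simp: G_carrier k)
  have "(\<ominus>\<^bsub>RR\<^esub> k, int 0) \<otimes>\<^bsub>G\<^esub> a = \<one>\<^bsub>G\<^esub>"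
    unfolding k(1) G_mult G_one using kc q_gt_1 by (simp add: ev_one R.l_neg)
  then show "inv\<^bsub>G\<^esub> a \<in> base n" using G.inv_equality kc K_closed(2)[OF k(2)] by (simp add: base_def)
  fix b assume "b \<in> base n"
  then obtain m where m: "b = (m, int 0)" "m \<in> K n" by (auto simp: base_def)
  show "a \<otimes>\<^bsub>G\<^esub> b \<in> base n"
    unfolding k(1) m(1) G_mult using k m K_sub K_closed(1) q_gt_1 by (simp add: ev_one base_def)
qed

lemma base_normal: "normal (base n) G"
  unfolding G.normal_inv_iff using base_subgroup base_conj by (auto simp: base_def)

text \<open>The formula is checked in the form g h = c (h g), which requires no expression for the
  inverses.\<close>

lemma commutator_eq:
  assumes x: "x \<in> carrier RR" "i < q" and y: "y \<in> carrier RR" "j < q"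
  shows "(x, int i) \<otimes>\<^bsub>G\<^esub> (y, int j) \<otimes>\<^bsub>G\<^esub> inv\<^bsub>G\<^esub> (x, int i) \<otimes>\<^bsub>G\<^esub> inv\<^bsub>G\<^esub> (y, int j) =
    ((th i \<ominus>\<^bsub>RR\<^esub> oneR) \<otimes>\<^bsub>RR\<^esub> y \<ominus>\<^bsub>RR\<^esub> (th j \<ominus>\<^bsub>RR\<^esub> oneR) \<otimes>\<^bsub>RR\<^esub> x, int 0)"
    (is "?l = (?c, int 0)")
proof -
  have gc: "(x, int i) \<in> carrier G" "(y, int j) \<in> carrier G" "(?c, int 0) \<in> carrier G"
    using x y q_gt_1 by (auto simp: G_carrier)
  have "?c \<oplus>\<^bsub>RR\<^esub> (y \<oplus>\<^bsub>RR\<^esub> th j \<otimes>\<^bsub>RR\<^esub> x) = x \<oplus>\<^bsub>RR\<^esub> th i \<otimes>\<^bsub>RR\<^esub> y"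
    using x(1) y(1) ev_closed[of "polyX ^ i"] ev_closed[of "polyX ^ j"] by algebra
  then have "(x, int i) \<otimes>\<^bsub>G\<^esub> (y, int j) = (?c, int 0) \<otimes>\<^bsub>G\<^esub> ((y, int j) \<otimes>\<^bsub>G\<^esub> (x, int i))"
    unfolding G_mult using x y by (simp add: ev_one add.commute)
  then have "?l = (?c, int 0) \<otimes>\<^bsub>G\<^esub> ((y, int j) \<otimes>\<^bsub>G\<^esub> (x, int i)) \<otimes>\<^bsub>G\<^esub> inv\<^bsub>G\<^esub> (x, int i) \<otimes>\<^bsub>G\<^esub> inv\<^bsub>G\<^esub> (y, int j)"
    by simp
  also have "\<dots> = (?c, int 0)" using gc by (simp add: G.m_assoc)
  finally show ?thesis .
qed

text \<open>Commutators carry factors theta^i - 1 from \<open>K 1\<close> and so descend one level.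
  Conversely, commutation with the generator of the cyclic group multiplies a translation by 1 -
  theta, so every element of \<open>base (Suc n)\<close> is itself a commutator. The whole group
  plays the part of level 0, which forces the case distinction on n.\<close>

lemma lower_central_step:
  assumes L: "(n = 0 \<and> L = carrier G) \<or> (n > 0 \<and> L = base n)"
  shows "generate G {x \<otimes>\<^bsub>G\<^esub> y \<otimes>\<^bsub>G\<^esub> inv\<^bsub>G\<^esub> x \<otimes>\<^bsub>G\<^esub> inv\<^bsub>G\<^esub> y | x y. x \<in> L \<and> y \<in> carrier G} = base (Suc n)"
    (is "generate G ?S = _")
proof
  show "generate G ?S \<subseteq> base (Suc n)"
  proof (rule G.generate_subgroup_incl[OF _ base_subgroup], rule subsetI)
    fix c assume "c \<in> ?S"
    then obtain g h where gh: "g \<in> L" "h \<in> carrier G"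
      "c = g \<otimes>\<^bsub>G\<^esub> h \<otimes>\<^bsub>G\<^esub> inv\<^bsub>G\<^esub> g \<otimes>\<^bsub>G\<^esub> inv\<^bsub>G\<^esub> h" by blast
    obtain y j where y: "h = (y, int j)" "y \<in> carrier RR" "j < q" using gh(2) by (auto simp: G_carrier)
    obtain x i where x: "g = (x, int i)" "x \<in> K n" "i < q" "n > 0 \<longrightarrow> i = 0"
      using L gh(1) q_gt_1 K_0 by (auto simp: G_carrier base_def)
    have c: "c = ((th i \<ominus>\<^bsub>RR\<^esub> oneR) \<otimes>\<^bsub>RR\<^esub> y \<ominus>\<^bsub>RR\<^esub> (th j \<ominus>\<^bsub>RR\<^esub> oneR) \<otimes>\<^bsub>RR\<^esub> x, int 0)"
      unfolding gh(3) y(1) x(1) by (rule commutator_eq[OF K_sub[OF x(2)] x(3) y(2,3)])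
    have 1: "(th j \<ominus>\<^bsub>RR\<^esub> oneR) \<otimes>\<^bsub>RR\<^esub> x \<in> K (Suc n)"
      using K_mult[OF th_diff x(2)] by simp
    have 2: "(th i \<ominus>\<^bsub>RR\<^esub> oneR) \<otimes>\<^bsub>RR\<^esub> y \<in> K (Suc n)"
    proof (cases "n = 0")
      case True
      then show ?thesis using K_mult[OF th_diff K_0[OF y(2)]] by simp
    next
      case False
      then have eq: "th i \<ominus>\<^bsub>RR\<^esub> oneR = zR" using x(4) by (simp add: ev_one R.minus_eq R.r_neg)
      show ?thesis unfolding eq using y(2) K_closed(3) by simp
    qed
    show "c \<in> base (Suc n)" unfolding c base_def R.minus_eq[of _ "(th j \<ominus>\<^bsub>RR\<^esub> oneR) \<otimes>\<^bsub>RR\<^esub> x"]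
      using K_closed(1)[OF 2 K_closed(2)[OF 1]] by simp
  qed
  show "base (Suc n) \<subseteq> generate G ?S"
  proof
    fix c assume "c \<in> base (Suc n)"
    then obtain u where u: "u \<in> carrier RR" "c = (u \<otimes>\<^bsub>RR\<^esub> kpow (Suc n), int 0)"
      by (auto simp: base_def theta_ideal_eq simp del: R.nat_pow_Suc)
    \<comment> \<open>The sign compensates for the commutator of (a, 0) with (0, 1), whose
      translation part is -(theta - 1) a.\<close>
    define a where "a = \<ominus>\<^bsub>RR\<^esub> (u \<otimes>\<^bsub>RR\<^esub> kpow n)"
    have ac: "a \<in> carrier RR" using u(1) by (simp add: a_def)
    have "u \<otimes>\<^bsub>RR\<^esub> kpow n \<in> K n" using u(1) by (auto simp: theta_ideal_eq)
    then have "a \<in> K n" unfolding a_def by (rule K_closed(2))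
    then have aL: "(a, int 0) \<in> L" using L ac q_gt_1 by (auto simp: base_def G_carrier)
    have yc: "(zR, int 1) \<in> carrier G" using q_gt_1 by (auto simp: G_carrier intro!: exI[of _ 1])
    have "(th 0 \<ominus>\<^bsub>RR\<^esub> oneR) \<otimes>\<^bsub>RR\<^esub> zR \<ominus>\<^bsub>RR\<^esub> (th 1 \<ominus>\<^bsub>RR\<^esub> oneR) \<otimes>\<^bsub>RR\<^esub> a =
        \<ominus>\<^bsub>RR\<^esub> (ev kap \<otimes>\<^bsub>RR\<^esub> a)"
      using ac by (simp add: ev_X ev_kap R.minus_eq)
    also have "\<dots> = u \<otimes>\<^bsub>RR\<^esub> kpow (Suc n)"
      unfolding a_def using u(1) by (simp add: R.r_minus R.m_ac)
    finally have "c = (a, int 0) \<otimes>\<^bsub>G\<^esub> (zR, int 1) \<otimes>\<^bsub>G\<^esub> inv\<^bsub>G\<^esub> (a, int 0) \<otimes>\<^bsub>G\<^esub> inv\<^bsub>G\<^esub> (zR, int 1)"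
      using commutator_eq[OF ac _ R.zero_closed, of 0 1] q_gt_1 by (simp only: u(2))
    then show "c \<in> generate G ?S" using aL yc by (intro generate.incl) blast
  qed
qed

lemma lower_central_base: "n > 0 \<Longrightarrow> lower_central G n = base n"
proof (induction n)
  case (Suc n)
  then show ?case using lower_central_step[of n "lower_central G n"] by (cases n) auto
qed simp

section \<open>The lower central quotients as presented groups\<close>

definition quotient_el :: "nat \<Rightarrow> int poly \<Rightarrow> nat \<Rightarrow> ((nat \<Rightarrow> nat \<Rightarrow> int) set \<times> int) set" where
  "quotient_el n x i = base n #>\<^bsub>G\<^esub> (ev x, int i)"

lemma coset_eq:
  assumes x: "x \<in> carrier RR" "i < q" and y: "y \<in> carrier RR" "j < q"
  shows "base n #>\<^bsub>G\<^esub> (x, int i) = base n #>\<^bsub>G\<^esub> (y, int j) \<longleftrightarrow> x \<ominus>\<^bsub>RR\<^esub> y \<in> K n \<and> i = j"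
proof
  have gc: "(x, int i) \<in> carrier G" "(y, int j) \<in> carrier G" using x y by (auto simp: G_carrier)
  assume "base n #>\<^bsub>G\<^esub> (x, int i) = base n #>\<^bsub>G\<^esub> (y, int j)"
  then have "(x, int i) \<in> base n #>\<^bsub>G\<^esub> (y, int j)"
    using G.rcos_self[OF gc(1) base_subgroup] by metis
  then obtain k where k: "k \<in> K n" "(x, int i) = (k, int 0) \<otimes>\<^bsub>G\<^esub> (y, int j)"
    by (auto simp: r_coset_def base_def)
  then have "x = k \<oplus>\<^bsub>RR\<^esub> y" "i = j" using y K_sub[OF k(1)] by (auto simp: G_mult[of k 0, simplified] ev_one)
  moreover from this have "x \<ominus>\<^bsub>RR\<^esub> y = k"
    using y K_sub[OF k(1)] by (simp add: R.minus_eq R.a_assoc R.r_neg)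
  ultimately show "x \<ominus>\<^bsub>RR\<^esub> y \<in> K n \<and> i = j" using k by simp
next
  have gc: "(x, int i) \<in> carrier G" "(y, int j) \<in> carrier G" using x y by (auto simp: G_carrier)
  assume k: "x \<ominus>\<^bsub>RR\<^esub> y \<in> K n \<and> i = j"
  have "x = (x \<ominus>\<^bsub>RR\<^esub> y) \<oplus>\<^bsub>RR\<^esub> y" using x y by (simp add: R.minus_eq R.a_assoc R.l_neg)
  then have "(x, int i) = (x \<ominus>\<^bsub>RR\<^esub> y, int 0) \<otimes>\<^bsub>G\<^esub> (y, int j)"
    using k x y unfolding G_mult by (simp add: ev_one)
  then have "(x, int i) \<in> base n #>\<^bsub>G\<^esub> (y, int j)" using k by (auto simp: r_coset_def base_def)
  then show "base n #>\<^bsub>G\<^esub> (x, int i) = base n #>\<^bsub>G\<^esub> (y, int j)"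
    using G.repr_independence[OF _ gc(2) base_subgroup] by metis
qed

text \<open>These quotients are split extensions with abelian translation part, so the lattice
  starts at level 0 and the cocycle is zero. By \<open>ev_dense\<close> polynomials suffice as coset
  representatives.\<close>

lemma quotient_presented:
  assumes n: "e + w \<le> n"
  shows "presented_group J kap polyX p w e (G Mod base n) (quotient_el n) 0 n q (\<lambda>_ _. 0)"
proof
  show "q = p * w" by (rule q_eq)
  show "e + w \<le> n" by (rule n)
  show "carrier (G Mod base n) = {quotient_el n x i | x i. x \<in> J 0 \<and> i < q}"
  proof (intro equalityI subsetI)
    fix C assume "C \<in> carrier (G Mod base n)"
    then obtain z i where z: "z \<in> carrier RR" "i < q" "C = base n #>\<^bsub>G\<^esub> (z, int i)"
      by (auto simp: FactGroup_def RCOSETS_def G_carrier)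
    obtain f where "z \<ominus>\<^bsub>RR\<^esub> ev f \<in> K n" using ev_dense[OF z(1)] by blast
    then have "C = quotient_el n f i" using z by (simp add: quotient_el_def coset_eq)
    then show "C \<in> {quotient_el n x i | x i. x \<in> J 0 \<and> i < q}" using z(2) cyc_filt_0 by blast
  next
    fix C assume "C \<in> {quotient_el n x i | x i. x \<in> J 0 \<and> i < q}"
    then obtain x i where C: "C = base n #>\<^bsub>G\<^esub> (ev x, int i)" "i < q" by (auto simp: quotient_el_def)
    then have "(ev x, int i) \<in> carrier G" by (auto simp: G_carrier)
    from G.rcosetsI[OF subgroup.subset[OF base_subgroup] this, of n]
    show "C \<in> carrier (G Mod base n)" by (simp add: FactGroup_def C(1))
  qed
  show "quotient_el n x i = quotient_el n y j \<longleftrightarrow> x - y \<in> J (0 + n) \<and> i = j" if "i < q" "j < q" for x y i j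
    using that by (simp add: quotient_el_def coset_eq ev_in_ideal_iff flip: ev_diff)
  show "quotient_el n x i \<otimes>\<^bsub>G Mod base n\<^esub> quotient_el n y j =
      quotient_el n (x + polyX ^ i * y + 0) ((i + j) mod q)" if "i < q" "j < q" for x y i j
  proof -
    have "(ev x, int i) \<in> carrier G" "(ev y, int j) \<in> carrier G" using that by (auto simp: G_carrier)
    from normal.rcos_sum[OF base_normal this, of n] show ?thesis
      unfolding quotient_el_def FactGroup_def G_mult by (simp add: ev_add ev_mult)
  qed
  show "\<one>\<^bsub>G Mod base n\<^esub> = quotient_el n 0 0"
    using G.coset_join2[OF G.one_closed base_subgroup subgroup.one_closed[OF base_subgroup], of n]
    by (simp add: FactGroup_def quotient_el_def ev_zero G_one)
qed (simp_all add: cyc_filt_zero)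

end

theorem main_line_groups_equivalent:
  assumes p: "Factorial_Ring.prime p"
  shows "\<exists>F. finite F \<and> F \<subseteq> main_line_groups p (G_group p 1) 1 \<and>
    (\<forall>H\<in>main_line_groups p (G_group p 1) 1 - F. \<forall>H'\<in>main_line_groups p (G_group p 1) 1 - F.
       equivalent_categories (quillen p H) (quillen p H'))"
proof -
  obtain s where s: "prime_power_cyc p 1 (p - 1) s 0" using prime_power_cyc_prime[OF p] by blast
  interpret cyc_group p 1 "p - 1" s 0 1
    using s by (simp add: cyc_group_def cyc_ring_def cyc_ring_axioms_def cyc_group_axioms_def)
  let ?M = "main_line_groups p (G_group p 1) 1"
  \<comment> \<open>Here e = p - 1 and w = 1, so indices from p on satisfy e + w <= n. The
    exceptional set also absorbs index 0, where the lower central term is the whole group and not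
    \<open>base 0\<close>.\<close>
  let ?F = "?M \<inter> (\<lambda>n. G Mod lower_central G n) ` {..p}"
  have large: "\<exists>n>p. H = G Mod base n" if H: "H \<in> ?M - ?F" for H
  proof -
    obtain n where n: "H = G Mod lower_central G n" using H by (auto simp: main_line_groups_def)
    then have "\<not> n \<le> p" using H by blast
    then show ?thesis using n lower_central_base[of n] by (intro exI[of _ n]) auto
  qed
  have "equivalent_categories (quillen p H) (quillen p H')"
    if HH': "H \<in> ?M - ?F" "H' \<in> ?M - ?F" for H H'
  proof -
    obtain n n' where "n > p" "n' > p" "H = G Mod base n" "H' = G Mod base n'"
      using large HH' by metis
    then show ?thesis
      using presented_groups_equivalent[OF quotient_presented[of n] quotient_presented[of n']] p_gt_1 by simp
  qed
  then show ?thesis by (intro exI[of _ ?F]) auto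
qed


section \<open>Galois automorphisms\<close>

text \<open>Substituting X^k for X is the polynomial counterpart of the Galois automorphism that
  sends theta to theta^k.\<close>

abbreviation sub :: "nat \<Rightarrow> int poly \<Rightarrow> int poly" where
  "sub k f \<equiv> pcompose f (polyX ^ k)"

lemma sub_power: "sub k (f ^ n) = sub k f ^ n"
  by (induction n) (simp_all add: pcompose_1 pcompose_mult)

lemma sub_X: "sub k polyX = polyX ^ k"
  by (simp add: pcompose_pCons)

context cyc_group
begin

abbreviation "sc \<equiv> scalar p l"

lemma scalar_hom: "sc \<in> ring_hom ZP RR"
proof -
  have "(\<lambda>a. up_ring.monom PP a 0) \<in> ring_hom ZP PP"
    using UP_ring.const_ring_hom[of ZP] ZP_cring by (simp add: UP_ring_def cring_def)
  moreover have "sc = pol_class p l \<circ> (\<lambda>a. up_ring.monom PP a 0)"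
    by (rule ext) (simp add: scalar_def)
  ultimately show ?thesis using ring_hom_trans[OF _ class_hom] by metis
qed

lemma monom_carrier:
  "a \<in> carrier ZP \<Longrightarrow> up_ring.monom PP a n \<in> carrier PP"
  using UP_ring.monom_closed[of ZP] ZP_cring by (simp add: UP_ring_def cring_def)

lemma scalar_eq: "sc a = pol_class p l (up_ring.monom PP a 0)"
  by (simp add: scalar_def)

lemma ev_const: "ev [:z:] = sc (padic_of_int p z)"
  by (simp add: at_theta_def scalar_def lift_const_poly)

lemma theta_class: "theta p l = pol_class p l (up_ring.monom PP \<one>\<^bsub>ZP\<^esub> (Suc 0))"
  by (simp add: theta_def)

lemma hom_ev:
  assumes h: "h \<in> ring_hom RR RR" and c: "\<And>a. a \<in> carrier ZP \<Longrightarrow> h (sc a) = sc a"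
    and t: "h (theta p l) = ev (polyX ^ k)"
  shows "h (ev f) = ev (sub k f)"
proof (induction f)
  case 0
  show ?case using c[of "padic_of_int p 0"] ev_const[of 0] padic_of_int_closed by simp
next
  case (pCons a f)
  have f: "pCons a f = [:a:] + polyX * f" by simp
  have "h (ev (pCons a f)) = h (ev [:a:]) \<oplus>\<^bsub>RR\<^esub> h (ev polyX) \<otimes>\<^bsub>RR\<^esub> h (ev f)"
    unfolding f ev_add ev_mult
    using ring_hom_add[OF h] ring_hom_mult[OF h] by (simp add: ring_hom_closed[OF h])
  also have "\<dots> = ev [:a:] \<oplus>\<^bsub>RR\<^esub> ev (polyX ^ k) \<otimes>\<^bsub>RR\<^esub> ev (sub k f)"
    using pCons c[of "padic_of_int p a"] padic_of_int_closed by (simp add: ev_const ev_X t)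
  also have "\<dots> = ev (sub k (pCons a f))" by (simp add: pcompose_pCons ev_add ev_mult)
  finally show ?case .
qed

text \<open>After composition with the quotient map both become homomorphisms on the polynomial ring
  that agree on constants and on X.\<close>

lemma hom_unique:
  assumes h: "h \<in> ring_hom RR RR" and c: "\<And>a. a \<in> carrier ZP \<Longrightarrow> h (sc a) = sc a"
    and h': "h' \<in> ring_hom RR RR" and c': "\<And>a. a \<in> carrier ZP \<Longrightarrow> h' (sc a) = sc a"
    and t: "h (theta p l) = h' (theta p l)" and z: "z \<in> carrier RR"
  shows "h z = h' z"
proof -
  interpret U: UP_pre_univ_prop ZP RR sc PP
    using UP_pre_univ_propI[OF ZP_cring RR_cring scalar_hom] by simp
  obtain F where F: "F \<in> carrier PP" "z = pol_class p l F" using class_surj[OF z] .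
  have "(h \<circ> pol_class p l) F = (h' \<circ> pol_class p l) F"
  proof (rule U.UP_hom_unique[OF _ _ _ _ _ _ F(1)])
    show "ring_hom_cring PP RR (h \<circ> pol_class p l)" "ring_hom_cring PP RR (h' \<circ> pol_class p l)"
      using U.ring_homD ring_hom_trans[OF class_hom h] ring_hom_trans[OF class_hom h'] by auto
    show "(h \<circ> pol_class p l) (up_ring.monom PP \<one>\<^bsub>ZP\<^esub> (Suc 0)) = h (theta p l)"
      "(h' \<circ> pol_class p l) (up_ring.monom PP \<one>\<^bsub>ZP\<^esub> (Suc 0)) = h (theta p l)"
      using t by (simp_all add: theta_class)
    show "h (theta p l) \<in> carrier RR" using ring_hom_closed[OF h] by simp
  qed (use c c' in \<open>simp_all add: scalar_eq\<close>)
  then show ?thesis by (simp add: F(2))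
qed

text \<open>The hypothesis says that theta^k is a root of the cyclotomic polynomial, so evaluation
  at theta^k factors through the quotient. The map h is defined by choosing a polynomial in each
  class, and \<open>wd\<close> makes the choice irrelevant.\<close>

lemma galois_hom_ex:
  assumes k: "ev (sub k (cyc_poly p w)) = zR"
  shows "\<exists>h. h \<in> extensional (carrier RR) \<and> h \<in> ring_hom RR RR \<and> (\<forall>a\<in>carrier ZP. h (sc a) = sc a) \<and>
    h (theta p l) = ev (polyX ^ k)"
proof -
  interpret PR: cring PP by (rule PP_cring)
  interpret U: UP_pre_univ_prop ZP RR sc PP
    using UP_pre_univ_propI[OF ZP_cring RR_cring scalar_hom] by simp
  obtain psi where psi: "psi \<in> ring_hom PP RR" "psi (up_ring.monom PP \<one>\<^bsub>ZP\<^esub> 1) = ev (polyX ^ k)"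
    "\<And>a. a \<in> carrier ZP \<Longrightarrow> psi (up_ring.monom PP a 0) = sc a"
    using U.UP_universal_property[OF ev_closed[of "polyX ^ k"]] by blast
  have psil: "psi (lift_poly p f) = ev (sub k f)" for f
  proof (induction f)
    case 0
    show ?case using psi(3)[of "padic_of_int p 0"] lift_const_poly[of p 0] ev_const[of 0]
      padic_of_int_closed by simp
  next
    case (pCons a f)
    have f: "pCons a f = [:a:] + polyX ^ 1 * f" by simp
    have "psi (lift_poly p (pCons a f)) =
        psi (lift_poly p [:a:]) \<oplus>\<^bsub>RR\<^esub> psi (lift_poly p (polyX ^ 1)) \<otimes>\<^bsub>RR\<^esub> psi (lift_poly p f)"
      unfolding f lift_poly_add[OF p_pos] lift_poly_mult[OF p_pos]
      using ring_hom_add[OF psi(1) lift_carrier PR.m_closed[OF lift_carrier lift_carrier]]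
        ring_hom_mult[OF psi(1) lift_carrier lift_carrier] by simp
    also have "psi (lift_poly p [:a:]) = ev [:a:]"
      using psi(3)[of "padic_of_int p a"] padic_of_int_closed by (simp add: lift_const_poly ev_const)
    also have "psi (lift_poly p (polyX ^ 1)) = ev (polyX ^ k)"
      using psi(2) by (simp only: lift_poly_X_power[OF p_pos])
    finally show ?case using pCons by (simp add: pcompose_pCons ev_add ev_mult)
  qed
  have wd: "psi F = psi F'" if F: "F \<in> carrier PP" "F' \<in> carrier PP" "pol_class p l F = pol_class p l F'" for F F'
  proof -
    obtain B where B: "B \<in> carrier PP" "F = B \<otimes>\<^bsub>PP\<^esub> cyclotomic_pol p l \<oplus>\<^bsub>PP\<^esub> F'" using class_eqD[OF F] .
    have "psi (B \<otimes>\<^bsub>PP\<^esub> cyclotomic_pol p l) = zR"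
      using ring_hom_mult[OF psi(1) B(1) lift_carrier] ring_hom_closed[OF psi(1) B(1)]
      by (simp add: cyclotomic_eq psil k)
    moreover have "cyclotomic_pol p l \<in> carrier PP" by (simp add: cyclotomic_eq lift_carrier)
    ultimately show ?thesis
      using ring_hom_add[OF psi(1) PR.m_closed[OF B(1)] F(2)] ring_hom_closed[OF psi(1) F(2)]
      by (simp add: B(2))
  qed
  define h where "h = (\<lambda>z\<in>carrier RR. psi (SOME F. F \<in> carrier PP \<and> z = pol_class p l F))"
  have cc: "pol_class p l F \<in> carrier RR" if "F \<in> carrier PP" for F
    using ring_hom_closed[OF class_hom that] .
  have hc: "h (pol_class p l F) = psi F" if F: "F \<in> carrier PP" for F
  proof -
    let ?F = "SOME F'. F' \<in> carrier PP \<and> pol_class p l F = pol_class p l F'"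
    have "?F \<in> carrier PP \<and> pol_class p l F = pol_class p l ?F"
      by (rule someI[of _ F]) (simp add: F)
    then have "psi F = psi ?F" using wd[OF F] by blast
    then show ?thesis using cc[OF F] by (simp add: h_def)
  qed
  have "h \<in> ring_hom RR RR"
  proof (rule ring_hom_memI)
    show "h oneR = oneR"
      using hc[OF PR.one_closed] ring_hom_one[OF class_hom] ring_hom_one[OF psi(1)] by simp
    fix x assume "x \<in> carrier RR"
    then obtain F where F: "F \<in> carrier PP" "x = pol_class p l F" using class_surj by blast
    show "h x \<in> carrier RR" using hc[OF F(1)] ring_hom_closed[OF psi(1) F(1)] F(2) by simp
    fix y assume "y \<in> carrier RR"
    then obtain F' where F': "F' \<in> carrier PP" "y = pol_class p l F'" using class_surj by blast
    show "h (x \<otimes>\<^bsub>RR\<^esub> y) = h x \<otimes>\<^bsub>RR\<^esub> h y"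
      using hc[OF PR.m_closed[OF F(1) F'(1)]] hc[OF F(1)] hc[OF F'(1)]
        ring_hom_mult[OF class_hom F(1) F'(1)] ring_hom_mult[OF psi(1) F(1) F'(1)] by (simp add: F(2) F'(2))
    show "h (x \<oplus>\<^bsub>RR\<^esub> y) = h x \<oplus>\<^bsub>RR\<^esub> h y"
      using hc[OF PR.a_closed[OF F(1) F'(1)]] hc[OF F(1)] hc[OF F'(1)]
        ring_hom_add[OF class_hom F(1) F'(1)] ring_hom_add[OF psi(1) F(1) F'(1)] by (simp add: F(2) F'(2))
  qed
  moreover have "h (sc a) = sc a" if "a \<in> carrier ZP" for a
    using hc[OF monom_carrier[OF that]] psi(3)[OF that] by (simp add: scalar_eq)
  moreover have "\<one>\<^bsub>ZP\<^esub> \<in> carrier ZP" using padic_of_int_closed[OF p_pos, of 1] by (simp add: padic_of_int_one)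
  then have "h (theta p l) = ev (polyX ^ k)"
    using hc[OF monom_carrier] psi(2) by (simp add: theta_class)
  moreover have "h \<in> extensional (carrier RR)" by (simp add: h_def)
  ultimately show ?thesis by blast
qed

text \<open>The homomorphisms for k and k' are mutually inverse because theta^(k k') = theta. Unique
  existence is the form needed to evaluate the definite description in
  \<open>sigma9\<close>.\<close>

lemma galois_automorphism:
  assumes k: "ev (sub k (cyc_poly p w)) = zR" and k': "ev (sub k' (cyc_poly p w)) = zR"
    and kk': "(k * k') mod q = 1"
  shows "\<exists>!h. h \<in> extensional (carrier RR) \<and> h \<in> ring_iso RR RR \<and> (\<forall>a\<in>carrier ZP. h (sc a) = sc a) \<and>
    h (theta p l) = ev (polyX ^ k)"
proof -
  obtain h where h: "h \<in> extensional (carrier RR)" "h \<in> ring_hom RR RR" "\<And>a. a \<in> carrier ZP \<Longrightarrow> h (sc a) = sc a"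
    "h (theta p l) = ev (polyX ^ k)" using galois_hom_ex[OF k] by blast
  obtain h' where h': "h' \<in> ring_hom RR RR" "\<And>a. a \<in> carrier ZP \<Longrightarrow> h' (sc a) = sc a"
    "h' (theta p l) = ev (polyX ^ k')" using galois_hom_ex[OF k'] by blast
  have id: "(\<lambda>z. z) \<in> ring_hom RR RR" by (rule ring_hom_memI) auto
  have th1: "ev (polyX ^ (k * k')) = theta p l"
    using th_mod[of "k * k'"] kk' by (simp add: ev_X)
  have 1: "h (h' z) = z" if "z \<in> carrier RR" for z
  proof -
    have "h (h' (theta p l)) = theta p l"
      using hom_ev[OF h(2-4), of "polyX ^ k'"] th1 by (simp add: h'(3) sub_power pcompose_pCons flip: power_mult)
    then show ?thesis
      using hom_unique[OF ring_hom_trans[OF h'(1) h(2)] _ id _ _ that] h(3) h'(2) by simp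
  qed
  have 2: "h' (h z) = z" if "z \<in> carrier RR" for z
  proof -
    have "h' (h (theta p l)) = theta p l"
      using hom_ev[OF h'(1-3), of "polyX ^ k"] th1
      by (simp add: h(4) sub_power pcompose_pCons mult.commute flip: power_mult)
    then show ?thesis
      using hom_unique[OF ring_hom_trans[OF h(2) h'(1)] _ id _ _ that] h(3) h'(2) by simp
  qed
  have "bij_betw h (carrier RR) (carrier RR)"
    by (rule bij_betw_byWitness[of _ h'])
      (use 1 2 ring_hom_closed[OF h(2)] ring_hom_closed[OF h'(1)] in auto)
  then have iso: "h \<in> ring_iso RR RR" using h(2) by (simp add: ring_iso_def)
  show ?thesis
  proof (rule ex1I[of _ h])
    show "h \<in> extensional (carrier RR) \<and> h \<in> ring_iso RR RR \<and> (\<forall>a\<in>carrier ZP. h (sc a) = sc a) \<and>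
      h (theta p l) = ev (polyX ^ k)" using h iso by blast
    fix f assume f: "f \<in> extensional (carrier RR) \<and> f \<in> ring_iso RR RR \<and> (\<forall>a\<in>carrier ZP. f (sc a) = sc a) \<and>
      f (theta p l) = ev (polyX ^ k)"
    then have "f \<in> ring_hom RR RR" by (simp add: ring_iso_def)
    then show "f = h"
      using f h hom_unique[of f h] by (intro extensionalityI[of f "carrier RR" h]) auto
  qed
qed

text \<open>Each quotient of successive terms has at most p elements, with digits 0, ..., p - 1 as
  representatives. This finiteness later bounds the number of commutator forms that have to be
  distinguished.\<close>

lemma finite_residues: "\<exists>R. finite R \<and> (\<forall>f. \<exists>r\<in>R. f - r \<in> J n)"
proof (induction n)
  case 0
  show ?case by (intro exI[of _ "{0}"]) (simp add: cyc_filt_0)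
next
  case (Suc n)
  then obtain R where R: "finite R" "\<And>f. \<exists>r\<in>R. f - r \<in> J n" by blast
  let ?R = "(\<lambda>(r, d). r + kap ^ n * of_nat d) ` (R \<times> {..<p})"
  have "\<exists>r\<in>?R. f - r \<in> J (Suc n)" for f
  proof -
    obtain r where r: "r \<in> R" "f - r \<in> J n" using R(2) by blast
    obtain b where b: "f - r - kap ^ n * b \<in> J (Suc n)" using J_lift[OF r(2)] by blast
    \<comment> \<open>The residue field is reached by evaluating at 1 and reducing modulo p: both
      \<open>kap\<close> and p lie in \<open>J 1\<close>.\<close>
    define d where "d = nat (poly b 1 mod int p)"
    have "poly b 1 - int d = int p * (poly b 1 div int p)"
      using p_pos by (simp add: d_def minus_mod_eq_mult_div)
    then have "of_int (poly b 1) - of_nat d = (of_nat p * of_int (poly b 1 div int p) :: int poly)"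
      by (metis of_int_diff of_int_mult of_int_of_nat_eq)
    then have 1: "of_int (poly b 1) - of_nat d \<in> J 1"
      using J_mult_right[OF J_mono[OF p_filtration, of 1]] e_pos by simp
    have "kap dvd b - of_int (poly b 1)" by (simp add: kap_dvd_iff)
    then obtain a where "b - of_int (poly b 1) = kap * a" by blast
    then have 2: "b - of_int (poly b 1) \<in> J 1" using J_mult_right[OF kappa_J] by simp
    have "b - of_nat d \<in> J 1" using J_add[OF 2 1] by simp
    then have "kap ^ n * (b - of_nat d) \<in> J (Suc n)" using kappa_power_iff[of n _ 1] by simp
    from J_add[OF b this] have "f - (r + kap ^ n * of_nat d) \<in> J (Suc n)" by (simp add: algebra_simps)
    moreover have "d < p" using p_pos by (simp add: d_def nat_less_iff)
    ultimately show ?thesis using r(1) by force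
  qed
  then show ?case using R(1) by (intro exI[of _ ?R]) simp
qed

end


section \<open>Skeleton groups associated with \<open>G\<^sub>9\<close>\<close>

lemma pcompose_diff_dvd: "(A - B :: int poly) dvd pcompose f A - pcompose f B"
proof (induction f)
  case (pCons a f)
  have "pcompose (pCons a f) A - pcompose (pCons a f) B =
      A * (pcompose f A - pcompose f B) + (A - B) * pcompose f B"
    by (simp add: pcompose_pCons algebra_simps)
  then show ?case using pCons by simp
qed simp

text \<open>\<gamma>\<open>\<^sub>0\<close> on polynomials. Since theta^9 = 1, the automorphism with
  s = -1 is substitution of X^8.\<close>

definition gam :: "int poly \<Rightarrow> int poly \<Rightarrow> int poly" where
  "gam x y = sub 2 x * sub 8 y - sub 8 x * sub 2 y"

lemma gam_add: "gam (x + y) z = gam x z + gam y z" "gam x (y + z) = gam x y + gam x z"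
  by (simp_all add: gam_def pcompose_add algebra_simps)

section \<open>Galois action and depth estimates for the commutator form\<close>

locale nine = cyc_group 3 3 6 s t 2 for s t
begin

lemma cyc_poly_9: "cyc_poly 3 3 = 1 + polyX ^ 3 + polyX ^ 6"
proof -
  have "(\<Sum>i<3::nat. Y ^ (3 * i)) = 1 + Y ^ 3 + Y ^ 6" for Y :: "int poly"
    by (simp add: lessThan_nat_numeral lessThan_Suc)
  then show ?thesis unfolding cyc_poly_def .
qed

text \<open>Each of these k is 2 modulo 3, so passing to theta^k interchanges theta^3 and theta^6.
  The value 5 is present as the inverse of 2 modulo 9; 8 is its own inverse.\<close>

lemma sub_cyc_poly:
  assumes "k \<in> {2, 5, 8}"
  shows "ev (sub k (cyc_poly 3 3)) = zR"
proof -
  have "sub k (cyc_poly 3 3) = 1 + polyX ^ (k * 3) + polyX ^ (k * 6)"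
    unfolding cyc_poly_9 by (simp only: pcompose_add pcompose_1 sub_power sub_X power_mult)
  then have "ev (sub k (cyc_poly 3 3)) = oneR \<oplus>\<^bsub>RR\<^esub> th (k * 3) \<oplus>\<^bsub>RR\<^esub> th (k * 6)"
    by (simp only: ev_add ev_one)
  also have "\<dots> = oneR \<oplus>\<^bsub>RR\<^esub> th 3 \<oplus>\<^bsub>RR\<^esub> th 6"
  proof -
    have "(k * 3) mod 3\<^sup>2 = 6 \<and> (k * 6) mod 3\<^sup>2 = 3" using assms by auto
    then have "th (k * 3) = th 6" "th (k * 6) = th 3" using th_mod by metis+
    then show ?thesis by (simp only: R.a_assoc R.a_comm[of "th 6"] ev_closed R.one_closed)
  qed
  also have "\<dots> = zR"
    using ev_cyc_poly unfolding cyc_poly_9 by (simp only: ev_add ev_one)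
  finally show ?thesis .
qed

text \<open>The Galois automorphisms preserve the powers of the maximal ideal: the image of
  \<open>kap\<close> still vanishes at 1, and the image of the cyclotomic polynomial vanishes at
  theta, hence lies in every \<open>J n\<close>.\<close>

lemma sub_J:
  assumes k: "k \<in> {2, 8}" and f: "f \<in> J n"
  shows "sub k f \<in> J n"
proof -
  obtain a b where ab: "f = a * kap ^ n + b * cyc_poly 3 3" using f by (auto simp: cyc_filt_def)
  have "ev (sub k (cyc_poly 3 3)) \<in> K n" using sub_cyc_poly[of k] k K_closed(3) by auto
  then have 1: "sub k (cyc_poly 3 3) \<in> J n" by (rule ev_in_idealD)
  have "kap dvd sub k kap" unfolding kap_dvd_iff poly_pcompose by (simp add: kap_def)
  then obtain r where r: "sub k kap = kap * r" by blast
  have 2: "sub k (kap ^ n) \<in> J n"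
    unfolding sub_power r power_mult_distrib by (rule J_mult_right[OF kappa_power_J])
  show ?thesis unfolding ab pcompose_add pcompose_mult by (intro J_add J_mult 1 2)
qed

text \<open>The exponents differ by 6, a multiple of 3, so X^3 - 1 divides the difference, and it
  has depth 3.\<close>

lemma X8_X2: "polyX ^ 8 - polyX ^ 2 \<in> J 3"
proof -
  have "polyX ^ 3 - 1 - kap ^ 3 \<in> J (Suc 3)" by (rule theta_w)
  from J_add[OF J_Suc[OF this] kappa_power_J] have "polyX ^ 3 - 1 \<in> J 3" by simp
  then have "polyX ^ 2 * (polyX ^ 3 + 1) * (polyX ^ 3 - 1) \<in> J 3" by (rule J_mult)
  moreover have "Y ^ 2 * (Y ^ 3 + 1) * (Y ^ 3 - 1) = Y ^ 8 - Y ^ 2" for Y :: "int poly"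
    by (simp add: algebra_simps eval_nat_numeral)
  ultimately show ?thesis by metis
qed

lemma sub_8_2: "sub 8 f - sub 2 f \<in> J 3"
proof -
  obtain r where "sub 8 f - sub 2 f = (polyX ^ 8 - polyX ^ 2) * r" using pcompose_diff_dvd by blast
  then show ?thesis using J_mult_right[OF X8_X2] by simp
qed

abbreviation "kap2 \<equiv> sub 2 kap"
abbreviation "kap8 \<equiv> sub 8 kap"

lemma kap28: "kap2 ^ n \<in> J n" "kap8 ^ n \<in> J n"
  using sub_J[of 2 "kap ^ n" n] sub_J[of 8 "kap ^ n" n] kappa_power_J by (simp_all add: sub_power)

lemma kap28_1: "kap2 \<in> J 1" "kap8 \<in> J 1"
  using kap28[of 1] by simp_all

text \<open>In a telescoping expansion one factor of depth 1 is replaced by the difference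
  \<open>kap8 - kap2\<close> of depth 3, a gain of 2.\<close>

lemma kap_power_diff: "kap8 ^ d - kap2 ^ d \<in> J (d + 2)"
proof (induction d)
  case (Suc d)
  have "kap8 ^ Suc d - kap2 ^ Suc d = kap8 * (kap8 ^ d - kap2 ^ d) + (kap8 - kap2) * kap2 ^ d"
    by (simp add: algebra_simps)
  moreover have "kap8 * (kap8 ^ d - kap2 ^ d) \<in> J (Suc d + 2)" by (rule J_mono[OF J_prod[OF kap28_1(2) Suc]]) simp
  moreover have "(kap8 - kap2) * kap2 ^ d \<in> J (Suc d + 2)"
    by (rule J_mono[OF J_prod[OF sub_8_2 kap28(1)]]) simp
  ultimately show ?case using J_add by metis
qed (simp add: J_zero)

text \<open>For cubes the gain improves to 3: with D = \<open>kap8 - kap2\<close>, the difference of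
  cubes is D^3 plus a multiple of 3, so it has depth at least 6, whereas the general estimate gives
  only 5. Telescoping over cubes extends this to all exponents divisible by 3.\<close>

lemma kap_power_diff_3: "kap8 ^ (3 * d) - kap2 ^ (3 * d) \<in> J (3 * d + 3)"
proof (induction d)
  case (Suc d)
  let ?D = "kap8 - kap2"
  have D: "?D \<in> J 3" by (rule sub_8_2)
  have "?D ^ 3 + of_nat 3 * (kap8 * kap2 * ?D) \<in> J 6"
  proof (rule J_add)
    have "?D * (?D * ?D) \<in> J (3 + (3 + 3))" by (intro J_prod D)
    then have "?D ^ 3 \<in> J 9" by (simp add: power3_eq_cube mult.assoc)
    then show "?D ^ 3 \<in> J 6" by (rule J_mono) simp
    show "of_nat 3 * (kap8 * kap2 * ?D) \<in> J 6" by (rule J_mult_right[OF p_filtration])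
  qed
  moreover have "?D ^ 3 + of_nat 3 * (kap8 * kap2 * ?D) = kap8 ^ 3 - kap2 ^ 3"
    by (simp add: power3_eq_cube algebra_simps)
  ultimately have C: "kap8 ^ 3 - kap2 ^ 3 \<in> J 6" by simp
  have eq: "kap8 ^ (3 * Suc d) - kap2 ^ (3 * Suc d) =
      kap8 ^ 3 * (kap8 ^ (3 * d) - kap2 ^ (3 * d)) + (kap8 ^ 3 - kap2 ^ 3) * kap2 ^ (3 * d)"
    by (simp add: algebra_simps power_add)
  show ?case
    unfolding eq
  proof (rule J_add)
    show "kap8 ^ 3 * (kap8 ^ (3 * d) - kap2 ^ (3 * d)) \<in> J (3 * Suc d + 3)"
      by (rule J_mono[OF J_prod[OF kap28(2) Suc]]) simp
    show "(kap8 ^ 3 - kap2 ^ 3) * kap2 ^ (3 * d) \<in> J (3 * Suc d + 3)"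
      by (rule J_mono[OF J_prod[OF C kap28(1)]]) simp
  qed
qed (simp add: J_zero)

text \<open>The two automorphisms agree modulo \<open>\<pp>\<^sup>3\<close>, so \<open>\<gamma>\<^sub>0\<close> has larger valuation than
  the product; the gain depends on whether the valuations of the arguments agree modulo 3.\<close>

lemma gam_leading:
  assumes E: "\<And>d. (u = r + d \<or> r = u + d) \<Longrightarrow> kap8 ^ d - kap2 ^ d \<in> J (d + v)" and v: "v \<le> 3"
  shows "gam (kap ^ r * x) (kap ^ u * y) \<in> J (r + u + v)"
proof -
  let ?P = "sub 2 x * sub 8 y" and ?Q = "sub 8 x * sub 2 y"
  have "gam (kap ^ r * x) (kap ^ u * y) =
      kap2 ^ r * kap8 ^ u * (?P - ?Q) + (kap2 ^ r * kap8 ^ u - kap8 ^ r * kap2 ^ u) * ?Q"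
    by (simp add: gam_def pcompose_mult sub_power algebra_simps)
  moreover have "kap2 ^ r * kap8 ^ u * (?P - ?Q) \<in> J (r + u + v)"
  proof -
    have "?P - ?Q = sub 2 x * (sub 8 y - sub 2 y) - (sub 8 x - sub 2 x) * sub 2 y"
      by (simp add: algebra_simps)
    also have "\<dots> \<in> J 3" by (intro J_diff J_mult J_mult_right sub_8_2)
    finally have "kap2 ^ r * kap8 ^ u * (?P - ?Q) \<in> J (r + u + 3)"
      by (intro J_prod kap28)
    then show ?thesis using v J_mono by simp
  qed
  moreover have "kap2 ^ r * kap8 ^ u - kap8 ^ r * kap2 ^ u \<in> J (r + u + v)"
  proof (cases "r \<le> u")
    case True
    then obtain d where d: "u = r + d" using le_Suc_ex by blast
    have "kap2 ^ r * kap8 ^ u - kap8 ^ r * kap2 ^ u = kap2 ^ r * kap8 ^ r * (kap8 ^ d - kap2 ^ d)"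
      by (simp add: d power_add algebra_simps)
    moreover have "\<dots> \<in> J (r + r + (d + v))" using E d by (intro J_prod kap28) auto
    ultimately show ?thesis by (simp add: d add.assoc)
  next
    case False
    then obtain d where d: "r = u + d" using le_Suc_ex nat_le_linear by blast
    have "kap2 ^ r * kap8 ^ u - kap8 ^ r * kap2 ^ u = - (kap2 ^ u * kap8 ^ u * (kap8 ^ d - kap2 ^ d))"
      by (simp add: d power_add algebra_simps)
    moreover have "kap2 ^ u * kap8 ^ u * (kap8 ^ d - kap2 ^ d) \<in> J (u + u + (d + v))"
      using E d by (intro J_prod kap28) auto
    ultimately show ?thesis using J_minus by (simp add: d ac_simps)
  qed
  ultimately show ?thesis using J_add J_mult_right by metis
qed

text \<open>Up to terms of depth r + u + v the arguments are multiples of \<open>kap ^ r\<close> and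
  \<open>kap ^ u\<close>, and \<open>gam\<close> does not decrease depth in either argument; this
  leaves \<open>gam_leading\<close>. The gain v is the one available for powers with exponent the
  difference of r and u.\<close>

lemma gam_J:
  assumes x: "x \<in> J r" and y: "y \<in> J u"
    and E: "\<And>d. (u = r + d \<or> r = u + d) \<Longrightarrow> kap8 ^ d - kap2 ^ d \<in> J (d + v)" and v: "v \<le> 3"
  shows "gam x y \<in> J (r + u + v)"
proof -
  obtain x' where x': "x - kap ^ r * x' \<in> J (r + u + v)" using J_lift[OF x] by blast
  obtain y' where y': "y - kap ^ u * y' \<in> J (r + u + v)" using J_lift[OF y] by blast
  have l: "gam \<xi> \<eta> \<in> J n" if "\<xi> \<in> J n" for \<xi> \<eta> n
    unfolding gam_def using that by (intro J_diff J_mult_right sub_J) auto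
  have l': "gam \<xi> \<eta> \<in> J n" if "\<eta> \<in> J n" for \<xi> \<eta> n
    unfolding gam_def using that by (intro J_diff J_mult sub_J) auto
  have "gam x y = gam (kap ^ r * x') (kap ^ u * y') + gam (kap ^ r * x') (y - kap ^ u * y')
      + gam (x - kap ^ r * x') y"
    by (simp flip: gam_add)
  also have "\<dots> \<in> J (r + u + v)" by (intro J_add gam_leading E v l[OF x'] l'[OF y'])
  finally show ?thesis .
qed

lemma gam_J2: "x \<in> J r \<Longrightarrow> y \<in> J u \<Longrightarrow> gam x y \<in> J (r + u + 2)"
  by (rule gam_J[OF _ _ kap_power_diff]) auto

lemma gam_J3:
  assumes "x \<in> J (u + 3 * d)" "y \<in> J u"
  shows "gam x y \<in> J (2 * u + 3 * d + 3)" "gam y x \<in> J (2 * u + 3 * d + 3)"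
proof -
  have E: "kap8 ^ d' - kap2 ^ d' \<in> J (d' + 3)" if "d' = 3 * d" for d'
    unfolding that by (rule kap_power_diff_3)
  have "gam x y \<in> J (u + 3 * d + u + 3)" by (rule gam_J[OF assms E]) auto
  then show "gam x y \<in> J (2 * u + 3 * d + 3)" by (rule J_mono) simp
  have "gam y x \<in> J (u + (u + 3 * d) + 3)" by (rule gam_J[OF assms(2,1) E]) auto
  then show "gam y x \<in> J (2 * u + 3 * d + 3)" by (rule J_mono) simp
qed

text \<open>The images of theta under the two automorphisms are theta^2 and theta^8, with product
  theta^10 = theta; so the form is equivariant under theta.\<close>

lemma gam_theta: "polyX * gam x y - gam (polyX * x) (polyX * y) \<in> J n"
proof -
  have "polyX * gam x y - gam (polyX * x) (polyX * y) = (polyX ^ 1 - polyX ^ 10) * gam x y"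
    unfolding gam_def pcompose_mult sub_X by (simp add: eval_nat_numeral algebra_simps del: mult_pCons_left mult_pCons_right)
  moreover have "polyX ^ 1 - polyX ^ 10 \<in> J n" using theta_power_mod[of 10 n] by simp
  ultimately show ?thesis using J_mult_right by metis
qed

text \<open>Both automorphisms send theta^3 to theta^6, so scaling the two arguments by powers of
  theta^3 scales both products equally, and they cancel when the arguments are multiples of one x.
  In exponents: 24 and 6 agree modulo 9.\<close>

lemma gam_omega: "gam (polyX ^ (3 * i) * x) (polyX ^ (3 * k) * x) \<in> J n"
proof -
  have "gam (polyX ^ (3 * i) * x) (polyX ^ (3 * k) * x) =
      (polyX ^ (6 * i + 24 * k) - polyX ^ (24 * i + 6 * k)) * (sub 2 x * sub 8 x)"
    unfolding gam_def pcompose_mult sub_power sub_X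
    by (simp add: power_add algebra_simps flip: power_mult del: mult_pCons_left mult_pCons_right)
  moreover have "polyX ^ (6 * i + 24 * k) - polyX ^ (24 * i + 6 * k) \<in> J n"
  proof -
    have "6 * i + 24 * k = 6 * i + 6 * k + 2 * k * 9" "24 * i + 6 * k = 6 * i + 6 * k + 2 * i * 9" by simp_all
    then have "(6 * i + 24 * k) mod (3 * 3) = (24 * i + 6 * k) mod (3 * 3)"
      by (simp only: mod_mult_self1 numeral_times_numeral num.simps semiring_norm)
    then show ?thesis
      using J_diff[OF theta_power_mod[of "24 * i + 6 * k" n] theta_power_mod[of "6 * i + 24 * k" n]] by simp
  qed
  ultimately show ?thesis using J_mult_right by metis
qed

end


section \<open>Polynomial representatives modulo powers of the maximal ideal\<close>

context cyc_group
begin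

text \<open>f stands for z at precision n. Compatibility of this relation with the ring operations
  transfers calculations with cosets of \<open>K n\<close> to integer polynomials.\<close>

definition rep :: "nat \<Rightarrow> (nat \<Rightarrow> nat \<Rightarrow> int) set \<Rightarrow> int poly \<Rightarrow> bool" where
  "rep n z f \<longleftrightarrow> z \<in> carrier RR \<and> z \<ominus>\<^bsub>RR\<^esub> ev f \<in> K n"

lemma rep_ev: "rep n (ev f) f"
  using K_closed(3) by (simp add: rep_def R.minus_eq R.r_neg)

lemma rep_ex: "z \<in> carrier RR \<Longrightarrow> \<exists>f. rep n z f"
  using ev_dense by (simp add: rep_def)

lemma rep_closed: "rep n z f \<Longrightarrow> z \<in> carrier RR"
  by (simp add: rep_def)

lemma repE:
  assumes "rep n z f"
  obtains k where "k \<in> K n" "k \<in> carrier RR" "z = k \<oplus>\<^bsub>RR\<^esub> ev f"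
proof -
  have "z = (z \<ominus>\<^bsub>RR\<^esub> ev f) \<oplus>\<^bsub>RR\<^esub> ev f"
    using rep_closed[OF assms] by (simp add: R.minus_eq R.a_assoc R.l_neg)
  then show ?thesis using that assms K_sub by (metis rep_def)
qed

lemma repI:
  assumes "k \<in> K n" "z = k \<oplus>\<^bsub>RR\<^esub> ev f"
  shows "rep n z f"
proof -
  have "z \<ominus>\<^bsub>RR\<^esub> ev f = k"
    using assms K_sub by (simp add: R.minus_eq R.a_assoc R.r_neg)
  then show ?thesis using assms K_sub by (simp add: rep_def)
qed

lemma rep_add:
  assumes z: "rep n z f" and z': "rep n z' f'"
  shows "rep n (z \<oplus>\<^bsub>RR\<^esub> z') (f + f')"
proof -
  obtain k k' where k: "k \<in> K n" "k \<in> carrier RR" "z = k \<oplus>\<^bsub>RR\<^esub> ev f"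
    and k': "k' \<in> K n" "k' \<in> carrier RR" "z' = k' \<oplus>\<^bsub>RR\<^esub> ev f'"
    using repE[OF z] repE[OF z'] by metis
  show ?thesis
    by (rule repI[OF K_closed(1)[OF k(1) k'(1)]]) (use k k' in \<open>simp add: ev_add R.a_ac\<close>)
qed

lemma rep_minus:
  assumes z: "rep n z f"
  shows "rep n (\<ominus>\<^bsub>RR\<^esub> z) (- f)"
proof -
  obtain k where k: "k \<in> K n" "k \<in> carrier RR" "z = k \<oplus>\<^bsub>RR\<^esub> ev f" using repE[OF z] .
  show ?thesis
    by (rule repI[OF K_closed(2)[OF k(1)]]) (use k in \<open>simp add: ev_minus R.minus_add\<close>)
qed

lemma rep_diff: "rep n z f \<Longrightarrow> rep n z' f' \<Longrightarrow> rep n (z \<ominus>\<^bsub>RR\<^esub> z') (f - f')"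
  using rep_add[of n z f "\<ominus>\<^bsub>RR\<^esub> z'" "- f'"] rep_minus by (simp add: R.minus_eq)

lemma rep_mult:
  assumes z: "rep n z f" and z': "rep n z' f'"
  shows "rep n (z \<otimes>\<^bsub>RR\<^esub> z') (f * f')"
proof -
  obtain k k' where k: "k \<in> K n" "k \<in> carrier RR" "z = k \<oplus>\<^bsub>RR\<^esub> ev f"
    and k': "k' \<in> K n" "k' \<in> carrier RR" "z' = k' \<oplus>\<^bsub>RR\<^esub> ev f'"
    using repE[OF z] repE[OF z'] by metis
  show ?thesis
  proof (rule repI[OF K_closed(1)[OF K_closed(4)[OF k'(1) k(2)] K_closed(1)[OF K_closed(4)[OF k'(1) ev_closed] K_closed(4)[OF k(1) ev_closed]]]])
    show "z \<otimes>\<^bsub>RR\<^esub> z' = k \<otimes>\<^bsub>RR\<^esub> k' \<oplus>\<^bsub>RR\<^esub> (ev f \<otimes>\<^bsub>RR\<^esub> k' \<oplus>\<^bsub>RR\<^esub> ev f' \<otimes>\<^bsub>RR\<^esub> k) \<oplus>\<^bsub>RR\<^esub> ev (f * f')"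
      using k(2) k'(2) by (simp add: k(3) k'(3) ev_mult R.l_distr R.r_distr R.a_ac R.m_ac)
  qed
qed

lemma rep_diff_iff:
  assumes "rep n z f" "rep n z' f'"
  shows "z \<ominus>\<^bsub>RR\<^esub> z' \<in> K n \<longleftrightarrow> f - f' \<in> J n"
proof -
  have "rep n (z \<ominus>\<^bsub>RR\<^esub> z') (f - f')" by (rule rep_diff[OF assms])
  then obtain k where k: "k \<in> K n" "k \<in> carrier RR" "z \<ominus>\<^bsub>RR\<^esub> z' = k \<oplus>\<^bsub>RR\<^esub> ev (f - f')" using repE by blast
  have "ev (f - f') = (z \<ominus>\<^bsub>RR\<^esub> z') \<oplus>\<^bsub>RR\<^esub> \<ominus>\<^bsub>RR\<^esub> k" unfolding k(3) using k(2)
    by (simp add: R.a_ac R.r_neg R.r_neg1 R.r_neg2)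
  then have "z \<ominus>\<^bsub>RR\<^esub> z' \<in> K n \<longleftrightarrow> ev (f - f') \<in> K n"
    using k K_closed(1)[OF k(1)] K_closed(1)[OF _ K_closed(2)[OF k(1)]] by metis
  then show ?thesis by (simp add: ev_in_ideal_iff)
qed

lemma rep_cong: "rep n z f \<Longrightarrow> f - f' \<in> J n \<Longrightarrow> rep n z f'"
  using rep_diff_iff[OF _ rep_ev, of n z f f'] rep_closed by (simp add: rep_def)

lemma rep_mono_K: "rep (a + m) z f \<Longrightarrow> z \<in> K a \<longleftrightarrow> f \<in> J a"
proof -
  assume "rep (a + m) z f"
  then obtain k where k: "k \<in> K (a + m)" "k \<in> carrier RR" "z = k \<oplus>\<^bsub>RR\<^esub> ev f" using repE by blast
  obtain v where v: "v \<in> carrier RR" "k = v \<otimes>\<^bsub>RR\<^esub> kpow (a + m)"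
    using k(1) by (auto simp: theta_ideal_eq)
  then have "k = (v \<otimes>\<^bsub>RR\<^esub> kpow m) \<otimes>\<^bsub>RR\<^esub> kpow a"
    by (simp add: R.m_ac flip: R.nat_pow_mult)
  moreover have "v \<otimes>\<^bsub>RR\<^esub> kpow m \<in> carrier RR" using v(1) by simp
  ultimately have ka: "k \<in> K a" unfolding theta_ideal_eq by blast
  have "rep a z f" by (rule repI[OF ka k(3)])
  moreover have "rep a zR 0" using rep_ev[of a 0] by (simp add: ev_zero)
  ultimately show ?thesis using rep_diff_iff[of a z f "zR" 0] rep_closed by (simp add: R.minus_eq)
qed

lemma K_coset_eq:
  assumes "z \<in> carrier RR" "z' \<in> carrier RR"
  shows "K n +>\<^bsub>RR\<^esub> z = K n +>\<^bsub>RR\<^esub> z' \<longleftrightarrow> z \<ominus>\<^bsub>RR\<^esub> z' \<in> K n"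
  using R.quotient_eq_iff_same_a_r_cos[OF theta_ideal_ideal assms] by simp

lemma K_coset_rep: "rep n z f \<longleftrightarrow> z \<in> K n +>\<^bsub>RR\<^esub> ev f"
proof
  assume "rep n z f"
  then show "z \<in> K n +>\<^bsub>RR\<^esub> ev f" using repE by (auto simp: a_r_coset_def' elim!: repE)
next
  assume "z \<in> K n +>\<^bsub>RR\<^esub> ev f"
  then show "rep n z f" using repI by (auto simp: a_r_coset_def')
qed

lemma K_coset_of_rep: "rep n z f \<Longrightarrow> K n +>\<^bsub>RR\<^esub> z = K n +>\<^bsub>RR\<^esub> ev f"
  unfolding rep_def using K_coset_eq[OF _ ev_closed[of f], of z n] by blast

end

section \<open>Skeleton groups as presented groups\<close>

context nine
begin

lemma ideal9_eq: "ideal9 n = K n"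
  by (simp add: ideal9_def theta_ideal_def)

lemma theta9_inv: "inv\<^bsub>RR\<^esub> \<theta>9 = ev (polyX ^ 8)"
proof (rule R.comm_inv_char)
  have "\<theta>9 \<otimes>\<^bsub>RR\<^esub> ev (polyX ^ 8) = th (1 + 8)" unfolding th_add by (simp add: ev_X)
  also have "\<dots> = th 0" using th_mod[of 9] by simp
  finally show "\<theta>9 \<otimes>\<^bsub>RR\<^esub> ev (polyX ^ 8) = oneR" by (simp add: ev_one)
qed simp_all

lemma sigma9_hom:
  assumes k: "k = 2 \<and> i = 2 \<or> k = 8 \<and> i = (-1)"
  shows "sigma9 i \<in> ring_hom RR RR" "sigma9 i (ev f) = ev (sub k f)"
proof -
  have t: "\<theta>9 [^]\<^bsub>RR\<^esub> i = ev (polyX ^ k)"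
    using k
  proof
    assume "k = 2 \<and> i = 2"
    then show ?thesis using int_pow_int[of RR \<theta>9 2] by (simp add: ev_power ev_X)
  next
    assume ki: "k = 8 \<and> i = -1"
    have "nat (- (- 1)) = 1" "(- 1 :: int) < 0" by simp_all
    then have "\<theta>9 [^]\<^bsub>RR\<^esub> (- 1 :: int) = inv\<^bsub>RR\<^esub> (\<theta>9 [^]\<^bsub>RR\<^esub> (1::nat))"
      unfolding int_pow_def2 by presburger
    also have "\<theta>9 [^]\<^bsub>RR\<^esub> (1::nat) = \<theta>9" by (rule R.nat_pow_eone) simp
    finally show ?thesis using ki theta9_inv by simp
  qed
  have "\<exists>!h. h \<in> extensional (carrier RR) \<and> h \<in> ring_iso RR RR \<and> (\<forall>a\<in>carrier ZP. h (sc a) = sc a) \<and>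
      h \<theta>9 = ev (polyX ^ k)"
    \<comment> \<open>The inverse exponents modulo 9 are 5 for k = 2 and 8 for k = 8.\<close>
    by (rule galois_automorphism[of _ "if k = 2 then 5 else 8"]) (use k sub_cyc_poly in auto)
  from theI'[OF this] have s: "sigma9 i \<in> ring_iso RR RR" "\<And>a. a \<in> carrier ZP \<Longrightarrow> sigma9 i (sc a) = sc a"
    "sigma9 i \<theta>9 = ev (polyX ^ k)"
    unfolding sigma9_def t by blast+
  then show h: "sigma9 i \<in> ring_hom RR RR" by (simp add: ring_iso_def)
  show "sigma9 i (ev f) = ev (sub k f)" using hom_ev[OF h s(2,3)] by simp
qed

lemma rep_sigma:
  assumes k: "k = 2 \<and> i = 2 \<or> k = 8 \<and> i = (-1)" and z: "rep n z f"
  shows "rep n (sigma9 i z) (sub k f)"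
proof -
  note h = sigma9_hom[OF k]
  obtain u where u: "u \<in> K n" "u \<in> carrier RR" "z = u \<oplus>\<^bsub>RR\<^esub> ev f" using repE[OF z] .
  obtain v where v: "v \<in> carrier RR" "u = v \<otimes>\<^bsub>RR\<^esub> ev (kap ^ n)"
    using u(1) by (auto simp: theta_ideal_eq ev_power)
  have "sigma9 i u = sigma9 i v \<otimes>\<^bsub>RR\<^esub> ev (sub k (kap ^ n))"
    using ring_hom_mult[OF h(1) v(1) ev_closed] h(2) by (simp add: v(2))
  moreover have "ev (sub k (kap ^ n)) \<in> K n"
    using sub_J[OF _ kappa_power_J] k by (intro ev_in_idealI) auto
  ultimately have "sigma9 i u \<in> K n" using K_closed(4) ring_hom_closed[OF h(1) v(1)] by simp
  then show ?thesis
    by (rule repI) (use ring_hom_add[OF h(1) u(2) ev_closed] h(2) u(3) in simp)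
qed

lemma rep_gamma0:
  assumes "rep n x f" "rep n y g"
  shows "rep n (gamma0 x y) (gam f g)"
  unfolding gamma0_def gam_def using assms by (intro rep_diff rep_mult rep_sigma) auto

text \<open>2 is a unit of Z_3: the integers (3^n + 1) / 2 are its inverses modulo 3^n, and they are
  compatible because consecutive ones differ by 3^n.\<close>

lemma half9_closed: "half9 \<in> carrier RR"
proof -
  define y where "y n = ((3 ^ n + 1) div 2) mod (3 ^ n :: int)" for n
  have half: "2 * ((3 ^ n + 1) div 2 :: int) = 3 ^ n + 1" for n
    by (intro dvd_mult_div_cancel) simp
  have yc: "y \<in> carrier ZP"
  proof -
    have "(3 * 3 ^ n + 1) div 2 = (3 ^ n + 1) div 2 + (3 ^ n :: int)" for n
      using half[of n] half[of "Suc n"] by simp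
    then have "(3 ^ Suc n + 1) div 2 mod 3 ^ n = (3 ^ n + 1) div 2 mod (3 ^ n :: int)" for n
      by (simp only: power_Suc mod_add_self2)
    then have "y (Suc n) mod 3 ^ n = y n" for n by (simp add: y_def mod_mod_cancel)
    then show ?thesis by (simp add: padic_integers_def y_def)
  qed
  have "y \<otimes>\<^bsub>ZP\<^esub> padic_of_int 3 2 = \<one>\<^bsub>ZP\<^esub>"
  proof
    fix n
    obtain Y :: int where Y: "(3 ^ n + 1) div 2 = Y" by blast
    have "2 * Y = 3 ^ n + 1" using half[of n] unfolding Y .
    then have "(Y * 2) mod 3 ^ n = 1 mod 3 ^ n" by (simp add: mult.commute)
    moreover have "y n = Y mod 3 ^ n" by (simp only: y_def Y)
    ultimately show "(y \<otimes>\<^bsub>ZP\<^esub> padic_of_int 3 2) n = \<one>\<^bsub>ZP\<^esub> n"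
      by (simp add: padic_mult_apply padic_of_int_def padic_integers_def mod_simps)
  qed
  moreover have c2: "padic_of_int 3 2 \<in> carrier ZP" by (simp add: padic_of_int_closed)
  ultimately have "sc y \<otimes>\<^bsub>RR\<^esub> sc (padic_of_int 3 2) = oneR"
    using ring_hom_mult[OF scalar_hom yc c2] ring_hom_one[OF scalar_hom] by simp
  moreover have "sc (padic_of_int 3 2) = oneR \<oplus>\<^bsub>RR\<^esub> oneR"
    using ev_add[of 1 1] by (simp add: ev_one numeral_poly flip: ev_const)
  moreover have "sc y \<in> carrier RR" "oneR \<oplus>\<^bsub>RR\<^esub> oneR \<in> carrier RR"
    using ring_hom_closed[OF scalar_hom yc] by simp_all
  ultimately have "oneR \<oplus>\<^bsub>RR\<^esub> oneR \<in> Units RR"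
    unfolding Units_def by (auto intro!: bexI[of _ "sc y"] simp: R.m_comm)
  then show ?thesis by (simp add: half9_def)
qed

definition skel_el :: "nat \<Rightarrow> nat \<Rightarrow> int poly \<Rightarrow> nat \<Rightarrow> (nat \<Rightarrow> nat \<Rightarrow> int) set set \<times> int" where
  "skel_el j m x i = (coset9 j m (ev x), int i)"

text \<open>1/2 is a 3-adic integer but not an integer, so a polynomial congruent to it at the
  required precision takes its place.\<close>

definition half_poly :: "nat \<Rightarrow> int poly" where
  "half_poly n = (SOME h. rep n half9 h)"

lemma rep_half: "rep n half9 (half_poly n)"
  unfolding half_poly_def by (rule someI_ex[OF rep_ex[OF half9_closed]])

lemma coset9_of_rep: "rep (j - 3 + m) z f \<Longrightarrow> coset9 j m z = coset9 j m (ev f)"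
  unfolding coset9_def ideal9_eq by (rule K_coset_of_rep)

lemma in_coset9: "z \<in> coset9 j m (ev f) \<longleftrightarrow> rep (j - 3 + m) z f"
  unfolding coset9_def ideal9_eq by (rule K_coset_rep[symmetric])

lemma coset9_eq: "coset9 j m (ev x) = coset9 j m (ev y) \<longleftrightarrow> x - y \<in> J (j - 3 + m)"
  unfolding coset9_def ideal9_eq K_coset_eq[OF ev_closed ev_closed] using ev_in_ideal_iff by (simp flip: ev_diff)

lemma skel_carrier: "carrier (skeleton_group j c m) = {skel_el j m x i | x i. x \<in> J (j - 3) \<and> i < 3 ^ 2}"
proof (intro equalityI subsetI)
  fix h assume "h \<in> carrier (skeleton_group j c m)"
  then obtain z i where z: "z \<in> K (j - 3)" "0 \<le> i" "i < 9" "h = (coset9 j m z, i)"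
    by (auto simp: skeleton_group_def semidirect_def T_group_def carrier_integer_mod_group ideal9_eq)
  obtain f where f: "rep (j - 3 + m) z f" using rep_ex[OF K_sub[OF z(1)]] by blast
  then have "h = skel_el j m f (nat i)" "f \<in> J (j - 3)"
    using z coset9_of_rep[OF f] rep_mono_K[OF f] by (simp_all add: skel_el_def)
  moreover have "nat i < 3 ^ 2" using z by simp
  ultimately show "h \<in> {skel_el j m x i | x i. x \<in> J (j - 3) \<and> i < 3 ^ 2}" by blast
next
  fix h assume "h \<in> {skel_el j m x i | x i. x \<in> J (j - 3) \<and> i < 3 ^ 2}"
  then obtain x i where "h = skel_el j m x i" "x \<in> J (j - 3)" "i < 9" by auto
  then show "h \<in> carrier (skeleton_group j c m)"
    by (auto simp: skel_el_def skeleton_group_def semidirect_def T_group_def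
        carrier_integer_mod_group ideal9_eq intro!: imageI ev_in_idealI)
qed

text \<open>The group operations are unions over all coset representatives. By compatibility of
  \<open>rep\<close> all representatives give the same coset, and the evaluated polynomials are
  among them, so each union is that single coset.\<close>

lemma skel_mult:
  assumes c: "rep (j - 3 + m) c d"
  defines "u \<equiv> half_poly (j - 3 + m) * d"
  shows "skel_el j m x i \<otimes>\<^bsub>skeleton_group j c m\<^esub> skel_el j m y k =
    skel_el j m (x + polyX ^ i * y + u * gam x (polyX ^ i * y)) ((i + k) mod 9)"
proof -
  let ?N = "j - 3 + m"
  have act: "(\<Union>z\<in>coset9 j m (ev y). coset9 j m (\<theta>9 [^]\<^bsub>RR\<^esub> int i \<otimes>\<^bsub>RR\<^esub> z)) = coset9 j m (ev (polyX ^ i * y))"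
  proof -
    have "coset9 j m (\<theta>9 [^]\<^bsub>RR\<^esub> int i \<otimes>\<^bsub>RR\<^esub> z) = coset9 j m (ev (polyX ^ i * y))"
      if "z \<in> coset9 j m (ev y)" for z
    proof -
      have "rep ?N (\<theta>9 [^]\<^bsub>RR\<^esub> int i) (polyX ^ i)"
        using rep_ev[of ?N "polyX ^ i"] by (simp add: int_pow_int ev_power ev_X)
      from rep_mult[OF this that[unfolded in_coset9]] show ?thesis by (rule coset9_of_rep)
    qed
    moreover have "ev y \<in> coset9 j m (ev y)" by (simp add: in_coset9 rep_ev)
    ultimately show ?thesis by blast
  qed
  have T: "monoid.mult (T_group j c m) (coset9 j m (ev x)) (coset9 j m (ev y)) =
      coset9 j m (ev (x + y + u * gam x y))" for y
  proof -
    have "coset9 j m (v \<oplus>\<^bsub>RR\<^esub> v' \<oplus>\<^bsub>RR\<^esub> half9 \<otimes>\<^bsub>RR\<^esub> (c \<otimes>\<^bsub>RR\<^esub> gamma0 v v')) =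
        coset9 j m (ev (x + y + u * gam x y))"
      if "v \<in> coset9 j m (ev x)" "v' \<in> coset9 j m (ev y)" for v v'
      unfolding u_def mult.assoc
      by (rule coset9_of_rep) (use that c in \<open>intro rep_add rep_mult rep_gamma0 rep_half; simp add: in_coset9\<close>)
    moreover have "ev x \<in> coset9 j m (ev x)" "ev y \<in> coset9 j m (ev y)" by (simp_all add: in_coset9 rep_ev)
    ultimately show ?thesis unfolding T_group_def by (simp, blast)
  qed
  show ?thesis
    unfolding skel_el_def skeleton_group_def semidirect_def using T[of "polyX ^ i * y"] by (simp add: act zmod_int)
qed

lemma skel_one: "\<one>\<^bsub>skeleton_group j c m\<^esub> = skel_el j m 0 0"
  by (simp add: skeleton_group_def semidirect_def T_group_def skel_el_def ev_zero)

text \<open>With a = j - 3 the bound on m reads a + m <= 3a + 6 if 3 divides a, and a + m <= 3a + 5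
  otherwise. A value of \<open>gam\<close> on level a has level 2a + 3; a second application adds a
  + 3 if the levels 2a + 3 and a differ by a multiple of 3, that is if 3 divides a, and a + 2 in
  general. So nested values vanish modulo \<open>J (a + m)\<close>. The hypothesis j >= 9 gives m >=
  9 = e + w.\<close>

lemma skeleton_presented:
  assumes j: "9 \<le> j" and m: "j \<le> m" "m \<le> (if 3 dvd j then 2 * j else 2 * j - 1)"
    and c: "rep (j - 3 + m) c d"
  shows "\<exists>el a g. presented_group J kap polyX 3 3 6 (skeleton_group j c m) el a m 9 g"
proof -
  define a where "a = j - 3"
  define u where "u = half_poly (j - 3 + m) * d"
  have a: "a \<ge> 6" "j = a + 3" "j - 3 = a" using j by (simp_all add: a_def)
  have am: "a + m \<le> (if 3 dvd a then 3 * a + 6 else 3 * a + 5)"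
    using m(2) unfolding a(2) by (auto split: if_splits)
  have assoc: "u * gam (u * gam x y) z \<in> J (a + m)" "u * gam z (u * gam x y) \<in> J (a + m)"
    if "x \<in> J a" "y \<in> J a" "z \<in> J a" for x y z
  proof -
    have 1: "u * gam x y \<in> J (2 * a + 3)" using J_mult[OF gam_J3(1)[of x a 0 y]] that by simp
    have "gam (u * gam x y) z \<in> J (a + m) \<and> gam z (u * gam x y) \<in> J (a + m)"
    proof (cases "3 dvd a")
      case True
      then obtain b where b: "a = 3 * b" by blast
      have "u * gam x y \<in> J (a + 3 * (b + 1))" using J_mono[OF 1] b by simp
      from gam_J3[OF this that(3)] show ?thesis using am True b by (auto intro: J_mono)
    next
      case False
      then show ?thesis using gam_J2[OF 1 that(3)] gam_J2[OF that(3) 1] am by (auto intro: J_mono)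
    qed
    then show "u * gam (u * gam x y) z \<in> J (a + m)" "u * gam z (u * gam x y) \<in> J (a + m)"
      using J_mult by blast+
  qed
  \<comment> \<open>The gain of 2 suffices for the remaining depth conditions: 2a + n + 2 >= a + n +
    4 since a >= 2, and (a + m - 6) + a + 2 >= a + m since a >= 4.\<close>
  have small: "u * gam x y \<in> J n" if "x \<in> J r" "y \<in> J v" "n \<le> r + v + 2" for x y n r v
    using J_mult[OF J_mono[OF gam_J2[OF that(1,2)] that(3)]] .
  have "presented_group J kap polyX 3 3 6 (skeleton_group j c m) (skel_el j m) a m 9 (\<lambda>x y. u * gam x y)"
  proof
    show "(9::nat) = 3 * 3" by simp
    show "6 + 3 \<le> m" using j m(1) by simp
    show "carrier (skeleton_group j c m) = {skel_el j m x i | x i. x \<in> J a \<and> i < 9}"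
      using skel_carrier by (simp add: a(3))
    show "skel_el j m x i = skel_el j m y k \<longleftrightarrow> x - y \<in> J (a + m) \<and> i = k" for x y i k
      by (simp add: skel_el_def coset9_eq a(3))
    show "skel_el j m x i \<otimes>\<^bsub>skeleton_group j c m\<^esub> skel_el j m y k =
      skel_el j m (x + polyX ^ i * y + u * gam x (polyX ^ i * y)) ((i + k) mod 9)" for x y i k
      unfolding u_def by (rule skel_mult[OF c])
    show "\<one>\<^bsub>skeleton_group j c m\<^esub> = skel_el j m 0 0" by (rule skel_one)
    show "u * gam (x + y) z = u * gam x z + u * gam y z" "u * gam x (y + z) = u * gam x y + u * gam x z"
      for x y z by (simp_all only: gam_add distrib_left)
    show "polyX * (u * gam x y) - u * gam (polyX * x) (polyX * y) \<in> J (a + m)" for x y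
    proof -
      have "polyX * (u * gam x y) - u * gam (polyX * x) (polyX * y) =
          u * (polyX * gam x y - gam (polyX * x) (polyX * y))"
        by (simp only: right_diff_distrib mult.left_commute)
      then show ?thesis using J_mult[OF gam_theta] by metis
    qed
    show "u * gam (u * gam x y) z \<in> J (a + m)" "u * gam x (u * gam y z) \<in> J (a + m)"
      if "x \<in> J a" "y \<in> J a" "z \<in> J a" for x y z
      using assoc that by blast+
    show "u * gam x y \<in> J (a + n + 3 + 1)" if "x \<in> J (a + n)" "y \<in> J a" for x y n
      by (rule small[OF that]) (use a in simp)
    show "u * gam x y \<in> J (a + n + 3 + 1)" if "x \<in> J a" "y \<in> J (a + n)" for x y n
      by (rule small[OF that]) (use a in simp)
    show "u * gam x y \<in> J (a + m)" if "x \<in> J (a + m - 6)" "y \<in> J a" for x y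
      by (rule small[OF that]) (use a in simp)
    show "u * gam x y \<in> J (a + m)" if "x \<in> J a" "y \<in> J (a + m - 6)" for x y
      by (rule small[OF that]) (use a in simp)
    show "u * gam (polyX ^ (3 * i) * x) (polyX ^ (3 * k) * x) \<in> J (a + m)" for x i k
      by (rule J_mult[OF gam_omega])
  qed
  then show ?thesis by blast
qed

text \<open>c enters the product only through a polynomial representative at precision j - 3 + m, so
  units with a common representative give the same product on the same carrier.\<close>

lemma skeleton_iso:
  assumes "rep (j - 3 + m) c d" "rep (j - 3 + m) c' d"
  shows "skeleton_group j c m \<cong> skeleton_group j c' m"
proof -
  have "carrier (skeleton_group j c m) = carrier (skeleton_group j c' m)" by (simp add: skel_carrier)
  moreover have "x \<otimes>\<^bsub>skeleton_group j c m\<^esub> y = x \<otimes>\<^bsub>skeleton_group j c' m\<^esub> y"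
    if "x \<in> carrier (skeleton_group j c m)" "y \<in> carrier (skeleton_group j c m)" for x y
    using that skel_mult[OF assms(1)] skel_mult[OF assms(2)] by (auto simp: skel_carrier)
  ultimately have "(\<lambda>x. x) \<in> iso (skeleton_group j c m) (skeleton_group j c' m)"
    by (simp add: iso_def hom_def bij_betw_def)
  then show ?thesis by (auto simp: is_iso_def)
qed

text \<open>For fixed j and m the group depends on c only through its residue class, and there are
  finitely many classes; one element of \<open>U\<close> is chosen in each class that meets
  \<open>U\<close>.\<close>

lemma finite_skeleton_classes:
  "\<exists>F. finite F \<and> F \<subseteq> {skeleton_group j c m | c. c \<in> U} \<and>
    (\<forall>c\<in>U. \<exists>K\<in>F. skeleton_group j c m \<cong> K)" if U: "U \<subseteq> carrier RR"
proof -
  obtain R where R: "finite R" "\<And>f. \<exists>r\<in>R. f - r \<in> J (j - 3 + m)" using finite_residues by blast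
  define pick where "pick r = (SOME c. c \<in> U \<and> rep (j - 3 + m) c r)" for r
  let ?R = "{r \<in> R. \<exists>c\<in>U. rep (j - 3 + m) c r}"
  have pick: "pick r \<in> U \<and> rep (j - 3 + m) (pick r) r" if "r \<in> ?R" for r
    unfolding pick_def by (rule someI_ex) (use that in blast)
  let ?F = "(\<lambda>r. skeleton_group j (pick r) m) ` ?R"
  have "\<exists>K\<in>?F. skeleton_group j c m \<cong> K" if c: "c \<in> U" for c
  proof -
    obtain f where f: "rep (j - 3 + m) c f" using rep_ex U c by blast
    obtain r where r: "r \<in> R" "f - r \<in> J (j - 3 + m)" using R(2) by blast
    have cr: "rep (j - 3 + m) c r" by (rule rep_cong[OF f r(2)])
    then have "r \<in> ?R" using r c by blast
    then show ?thesis using skeleton_iso[OF cr] pick by blast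
  qed
  moreover have "?F \<subseteq> {skeleton_group j c m | c. c \<in> U}" using pick by blast
  ultimately show ?thesis using R(1) by (intro exI[of _ ?F]) simp
qed

end

theorem skeleton_groups_equivalent:
  "\<exists>F. finite F \<and> F \<subseteq> skeleton_groups \<and>
    (\<forall>H\<in>skeleton_groups. \<forall>H'\<in>skeleton_groups.
       (\<forall>K\<in>F. \<not> H \<cong> K) \<and> (\<forall>K\<in>F. \<not> H' \<cong> K) \<longrightarrow>
       equivalent_categories (quillen_category 3 H) (quillen_category 3 H'))"
proof -
  obtain s t where st: "prime_power_cyc 3 3 6 s t" using prime_power_cyc_9 by blast
  interpret nine s t
    using st by (simp add: nine_def cyc_group_def cyc_ring_def cyc_ring_axioms_def cyc_group_axioms_def)
  \<comment> \<open>The pairs below the threshold j = 9, that is j = 7 and j = 8 with finitely many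
    m each. Every pair contributes a finite set \<open>F j m\<close> of groups that represents all
    its isomorphism classes, so a group isomorphic to no member of \<open>?F\<close> has j >=
    9.\<close>
  let ?I = "{(j :: nat, m :: nat). 7 \<le> j \<and> j < 9 \<and> j \<le> m \<and> m \<le> (if 3 dvd j then 2 * j else 2 * j - 1)}"
  define P where "P j m F \<longleftrightarrow> finite F \<and> F \<subseteq> {skeleton_group j c m | c. c \<in> Units O9} \<and>
    (\<forall>c\<in>Units O9. \<exists>K\<in>F. skeleton_group j c m \<cong> K)" for j m F
  define F where "F j m = (SOME F. P j m F)" for j m
  have "P j m (F j m)" for j m
  proof -
    have "Units O9 \<subseteq> carrier O9" by (auto simp: Units_def)
    then show ?thesis
      unfolding F_def P_def by (rule someI_ex[OF finite_skeleton_classes])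
  qed
  then have F: "finite (F j m)" "F j m \<subseteq> {skeleton_group j c m | c. c \<in> Units O9}"
    "c \<in> Units O9 \<Longrightarrow> \<exists>K\<in>F j m. skeleton_group j c m \<cong> K" for j m c
    unfolding P_def by blast+
  let ?F = "\<Union>(j, m)\<in>?I. F j m"
  have fin: "finite ?F"
  proof (rule finite_UN_I)
    show "finite ?I" by (rule finite_subset[of _ "{..<9} \<times> {..18}"]) (auto split: if_splits)
  qed (auto simp: F(1))
  have sub: "?F \<subseteq> skeleton_groups"
  proof
    fix H assume "H \<in> ?F"
    then obtain j m where jm: "(j, m) \<in> ?I" "H \<in> F j m" by blast
    then obtain c where "c \<in> Units O9" "H = skeleton_group j c m" using F(2) by blast
    then show "H \<in> skeleton_groups" using jm(1) unfolding skeleton_groups_def by blast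
  qed
  have large: "\<exists>el a m q g. presented_group J kap polyX 3 3 6 H el a m q g"
    if H: "H \<in> skeleton_groups" "\<forall>K\<in>?F. \<not> H \<cong> K" for H
  proof -
    obtain j c m where jm: "H = skeleton_group j c m" "7 \<le> j" "c \<in> Units O9" "j \<le> m"
      "m \<le> (if 3 dvd j then 2 * j else 2 * j - 1)" using H(1) unfolding skeleton_groups_def by blast
    have "9 \<le> j"
    proof (rule ccontr)
      assume "\<not> 9 \<le> j"
      then have "(j, m) \<in> ?I" using jm by simp
      moreover obtain K where "K \<in> F j m" "H \<cong> K" using F(3)[OF jm(3)] jm(1) by blast
      ultimately show False using H(2) by blast
    qed
    moreover have "c \<in> carrier O9" using jm(3) by (simp add: Units_def)
    then obtain d where "rep (j - 3 + m) c d" using rep_ex by blast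
    ultimately show ?thesis using skeleton_presented jm by blast
  qed
  have "equivalent_categories (quillen_category 3 H) (quillen_category 3 H')"
    if H: "H \<in> skeleton_groups" "\<forall>K\<in>?F. \<not> H \<cong> K" and H': "H' \<in> skeleton_groups" "\<forall>K\<in>?F. \<not> H' \<cong> K"
    for H H'
  proof -
    obtain el a m q g el' a' m' q' g' where "presented_group J kap polyX 3 3 6 H el a m q g"
      "presented_group J kap polyX 3 3 6 H' el' a' m' q' g'"
      using large[OF H] large[OF H'] by (elim exE) (rule that)
    then show ?thesis by (rule presented_groups_equivalent)
  qed
  then show ?thesis using fin sub by (intro exI[of _ ?F]) blast
qed

theorem theorem1p1:
  shows "(\<forall>p::nat. Factorial_Ring.prime p \<longrightarrow>
      (\<exists>F. finite F \<and> F \<subseteq> main_line_groups p (G_group p 1) 1 \<and>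
        (\<forall>H\<in>main_line_groups p (G_group p 1) 1 - F. \<forall>H'\<in>main_line_groups p (G_group p 1) 1 - F.
           equivalent_categories (quillen_category p H) (quillen_category p H')))) \<and>
    (\<exists>F. finite F \<and> F \<subseteq> skeleton_groups \<and>
        (\<forall>H\<in>skeleton_groups. \<forall>H'\<in>skeleton_groups.
           (\<forall>K\<in>F. \<not> H \<cong> K) \<and> (\<forall>K\<in>F. \<not> H' \<cong> K) \<longrightarrow>
           equivalent_categories (quillen_category 3 H) (quillen_category 3 H')))"
  using main_line_groups_equivalent skeleton_groups_equivalent by blast
end
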